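(* Let $n\geq 2$ be an integer, $0<\alpha\leq 2$, $n>2\alpha$, $c_1,c_2\geq 0$ with $c_1+c_2>0$, $0<p_1\leq 1$, $0<p_2\leq\frac{n+\alpha}{n-\alpha}$, and let $u$ be a positive classical solution of $$(-\Delta)^{\frac{\alpha}{2}}u(y)=c_1\Big(\int_{\mathbb{R}^n}\frac{u^2(z)}{|y-z|^{2\alpha}}\,dz\Big)u^{p_1}(y)+c_2u^{p_2}(y),\qquad y\in\mathbb{R}^n.$$ Fix an arbitrary $x\in\mathbb{R}^n$. For $\lambda>0$, let $\Omega$ be a narrow region in $B_\lambda(x)\setminus\{x\}$ with small thickness $0<l<\lambda$, in the sense that $\Omega\subseteq A_{\lambda,l}(x):=\{y\in\mathbb{R}^n\mid \lambda-l<|y-x|<\lambda\}$. Suppose that $\omega_{x,\lambda}\in\mathcal{L}_\alpha(\mathbb{R}^n)\cap C^{1,1}_{loc}(\Omega)$ if $0<\alpha<2$ (respectively $\omega_{x,\lambda}\in C^2(\Omega)$ if $\alpha=2$) and that: (a) for all $y\in\Omega\cap B_\lambda^-$, $$(-\Delta)^{\frac{\alpha}{2}}\omega_{x,\lambda}(y)-\mathcal{L}_{x,\lambda}(y)\,\omega_{x,\lambda}(y)-2c_1\Big(\int_{B_\lambda^-}\frac{u(z)\omega_{x,\lambda}(z)}{|y-z|^{2\alpha}}\,dz\Big)u^{p_1}(y)\geq 0;$$ (b) if $B_\lambda^-\neq\emptyset$, then the negative minimum of $\omega_{x,\lambda}$ is attained in the interior of $B_\lambda(x)\setminus\{x\}$;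 (c) the negative minimum of $\omega_{x,\lambda}$ cannot be attained in $(B_\lambda(x)\setminus\{x\})\setminus\Omega$. Here $\mathcal{L}_{x,\lambda}(y):=c_1p_1P(y)u_{x,\lambda}^{p_1-1}(y)+c_2p_2\max\{u^{p_2-1}(y),u_{x,\lambda}^{p_2-1}(y)\}$. Then: (i) there exists a sufficiently small constant $\delta_0(x)>0$ such that, for all $0<\lambda\leq\delta_0(x)$, $\omega_{x,\lambda}(y)\geq 0$ for every $y\in\Omega$; (ii) there exists a sufficiently small $l_0(x,\lambda)>0$, depending continuously on $\lambda$, such that, for all $0<l\leq l_0(x,\lambda)$, $\omega_{x,\lambda}(y)\geq 0$ for every $y\in\Omega$.
   Context: A positive classical solution is $u:\mathbb{R}^n\to(0,\infty)$ satisfying the equation pointwise, with $u\in C^{1,1}_{loc}(\mathbb{R}^n)\cap\mathcal{L}_\alpha(\mathbb{R}^n)$ if $0<\alpha<2$, and $u\in C^2(\mathbb{R}^n)$ if $\alpha=2$. Here $\mathcal{L}_\alpha(\mathbb{R}^n):=\{u\mid \int_{\mathbb{R}^n}\frac{|u(y)|}{1+|y|^{n+\alpha}}dy<\infty\}$ (a function space, not to be confused with the coefficient $\mathcal{L}_{x,\lambda}$). For $0<\alpha<2$, $(-\Delta)^{\frac{\alpha}{2}}w(y)=C_{\alpha,n}\lim_{\epsilon\to0}\int_{|z-y|\geq\epsilon}\frac{w(y)-w(z)}{|y-z|^{n+\alpha}}dz$ with $C_{\alpha,n}=\big(\int_{\mathbb{R}^n}\frac{1-\cos(2\pi\zeta_1)}{|\zeta|^{n+\alpha}}d\zeta\big)^{-1}$;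 for $\alpha=2$ it is $-\Delta$. Notation: $B_\lambda(x)=\{y\mid |y-x|<\lambda\}$; for $y\in\mathbb{R}^n\setminus\{x\}$, $y^{x,\lambda}=\frac{\lambda^2(y-x)}{|y-x|^2}+x$, $u_{x,\lambda}(y)=\big(\frac{\lambda}{|y-x|}\big)^{n-\alpha}u(y^{x,\lambda})$, $\omega_{x,\lambda}(y)=u_{x,\lambda}(y)-u(y)$; $B_\lambda^-=\{y\in B_\lambda(x)\setminus\{x\}\mid \omega_{x,\lambda}(y)<0\}$; $P(y)=\int_{\mathbb{R}^n}\frac{u^2(z)}{|y-z|^{2\alpha}}dz$. The "negative minimum of $\omega_{x,\lambda}$" means the minimum of $\omega_{x,\lambda}$ over $B_\lambda(x)\setminus\{x\}$ when it is negative. The constants $\delta_0(x)$ and $l_0(x,\lambda)$ may depend on $u$ and on $n,\alpha,c_1,c_2,p_1,p_2$, but not on $\Omega$. *)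

theory Defs
  imports "HOL-Analysis.Analysis"
begin

text \<open>The ambient space $\mathbb{R}^n$ is a type \<open>'a::euclidean_space\<close>, with $n$ = \<open>DIM('a)\<close>.\<close>

subsection \<open>Function spaces\<close>

text \<open>The two local classes are those of functions that are regular on a neighbourhood of
  \<open>S\<close>; for open \<open>S\<close> one may take \<open>U = S\<close>, and these are the usual
  $C^2(S)$ and $C^{1,1}_{loc}(S)$.\<close>

definition C2_on :: "'a::euclidean_space set \<Rightarrow> ('a \<Rightarrow> real) \<Rightarrow> bool" where
  "C2_on S f \<longleftrightarrow> (\<exists>U (f' :: 'a \<Rightarrow> 'a \<Rightarrow>\<^sub>L real) (f'' :: 'a \<Rightarrow> 'a \<Rightarrow>\<^sub>L ('a \<Rightarrow>\<^sub>L real)).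
     open U \<and> S \<subseteq> U \<and>
     (\<forall>y\<in>U. (f has_derivative blinfun_apply (f' y)) (at y)) \<and>
     (\<forall>y\<in>U. (f' has_derivative blinfun_apply (f'' y)) (at y)) \<and>
     continuous_on U f'')"

definition C11_loc_on :: "'a::euclidean_space set \<Rightarrow> ('a \<Rightarrow> real) \<Rightarrow> bool" where
  "C11_loc_on S f \<longleftrightarrow> (\<exists>U (f' :: 'a \<Rightarrow> 'a \<Rightarrow>\<^sub>L real).
     open U \<and> S \<subseteq> U \<and>
     (\<forall>y\<in>U. (f has_derivative blinfun_apply (f' y)) (at y)) \<and>
     (\<forall>y\<in>U. \<exists>r>0. \<exists>L. L-lipschitz_on (ball y r) f'))"

definition L_space :: "real \<Rightarrow> ('a::euclidean_space \<Rightarrow> real) set" where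
  "L_space \<alpha> = {u. integrable lborel (\<lambda>y. u y / (1 + norm y powr (real DIM('a) + \<alpha>)))}"

subsection \<open>The fractional Laplacian\<close>

text \<open>The coordinate $\zeta_1$ is represented by the coordinate along some fixed basis vector; by
  rotation invariance the value of the integral does not depend on which one.\<close>

definition frac_lap_const :: "'a::euclidean_space itself \<Rightarrow> real \<Rightarrow> real" where
  "frac_lap_const _ \<alpha> =
     inverse (\<integral>\<zeta>. (1 - cos (2 * pi * (\<zeta> \<bullet> (SOME b. b \<in> Basis))))
                    / norm \<zeta> powr (real DIM('a) + \<alpha>) \<partial>(lborel :: 'a measure))"

definition laplacian :: "('a::euclidean_space \<Rightarrow> real) \<Rightarrow> 'a \<Rightarrow> real" where
  "laplacian f y = (\<Sum>b\<in>Basis. (deriv ^^ 2) (\<lambda>t. f (y + t *\<^sub>R b)) 0)"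

text \<open>\<open>frac_lap \<alpha>\<close> is $(-\Delta)^{\alpha/2}$. The principal value exists at every point near which
  the function is $C^{1,1}$, provided that the function lies in \<open>L_space \<alpha>\<close>.\<close>

definition frac_lap :: "real \<Rightarrow> ('a::euclidean_space \<Rightarrow> real) \<Rightarrow> 'a \<Rightarrow> real" where
  "frac_lap \<alpha> w y =
     (if \<alpha> = 2 then - laplacian w y
      else frac_lap_const TYPE('a) \<alpha> *
        Lim (at_right 0) (\<lambda>\<epsilon>. LINT z:{z. norm (z - y) \<ge> \<epsilon>}|lborel.
          (w y - w z) / norm (y - z) powr (real DIM('a) + \<alpha>)))"

subsection \<open>The equation\<close>

definition P :: "real \<Rightarrow> ('a::euclidean_space \<Rightarrow> real) \<Rightarrow> 'a \<Rightarrow> real" where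
  "P \<alpha> u y = (\<integral>z. (u z)\<^sup>2 / norm (y - z) powr (2 * \<alpha>) \<partial>lborel)"

text \<open>The Bochner integral is 0 for non-integrable functions, so finiteness of the nonlocal
  term is required explicitly; it is vacuous when that term is absent from the equation.\<close>

definition positive_classical_solution ::
  "real \<Rightarrow> real \<Rightarrow> real \<Rightarrow> real \<Rightarrow> real \<Rightarrow> ('a::euclidean_space \<Rightarrow> real) \<Rightarrow> bool" where
  "positive_classical_solution \<alpha> c1 c2 p1 p2 u \<longleftrightarrow>
     (\<forall>y. u y > 0) \<and>
     (if \<alpha> < 2 then C11_loc_on UNIV u \<and> u \<in> L_space \<alpha> else C2_on UNIV u) \<and>
     (c1 \<noteq> 0 \<longrightarrow> (\<forall>y. integrable lborel (\<lambda>z. (u z)\<^sup>2 / norm (y - z) powr (2 * \<alpha>)))) \<and>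
     (\<forall>y. frac_lap \<alpha> u y = c1 * P \<alpha> u y * u y powr p1 + c2 * u y powr p2)"

subsection \<open>Moving spheres\<close>

definition inversion :: "'a::euclidean_space \<Rightarrow> real \<Rightarrow> 'a \<Rightarrow> 'a" where
  "inversion x r y = (r\<^sup>2 / (norm (y - x))\<^sup>2) *\<^sub>R (y - x) + x"

text \<open>Only the values at \<open>y \<noteq> x\<close> are meaningful; at \<open>y = x\<close> the function below is 0.\<close>

definition kelvin :: "real \<Rightarrow> ('a::euclidean_space \<Rightarrow> real) \<Rightarrow> 'a \<Rightarrow> real \<Rightarrow> 'a \<Rightarrow> real" where
  "kelvin \<alpha> u x r y = (r / norm (y - x)) powr (real DIM('a) - \<alpha>) * u (inversion x r y)"

definition omega :: "real \<Rightarrow> ('a::euclidean_space \<Rightarrow> real) \<Rightarrow> 'a \<Rightarrow> real \<Rightarrow> 'a \<Rightarrow> real" where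
  "omega \<alpha> u x r y = kelvin \<alpha> u x r y - u y"

definition B_minus :: "real \<Rightarrow> ('a::euclidean_space \<Rightarrow> real) \<Rightarrow> 'a \<Rightarrow> real \<Rightarrow> 'a set" where
  "B_minus \<alpha> u x r = {y \<in> ball x r - {x}. omega \<alpha> u x r y < 0}"

definition L_coeff :: "real \<Rightarrow> real \<Rightarrow> real \<Rightarrow> real \<Rightarrow> real \<Rightarrow>
    ('a::euclidean_space \<Rightarrow> real) \<Rightarrow> 'a \<Rightarrow> real \<Rightarrow> 'a \<Rightarrow> real" where
  "L_coeff \<alpha> c1 c2 p1 p2 u x r y =
     c1 * p1 * P \<alpha> u y * kelvin \<alpha> u x r y powr (p1 - 1)
     + c2 * p2 * max (u y powr (p2 - 1)) (kelvin \<alpha> u x r y powr (p2 - 1))"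

definition annulus :: "'a::euclidean_space \<Rightarrow> real \<Rightarrow> real \<Rightarrow> 'a set" where
  "annulus x r l = {y. r - l < norm (y - x) \<and> norm (y - x) < r}"

definition negative_minimum_at ::
  "real \<Rightarrow> ('a::euclidean_space \<Rightarrow> real) \<Rightarrow> 'a \<Rightarrow> real \<Rightarrow> 'a \<Rightarrow> bool" where
  "negative_minimum_at \<alpha> u x r y0 \<longleftrightarrow>
     y0 \<in> ball x r - {x} \<and> omega \<alpha> u x r y0 < 0 \<and>
     (\<forall>y\<in>ball x r - {x}. omega \<alpha> u x r y0 \<le> omega \<alpha> u x r y)"

text \<open>The standing hypotheses on a narrow region \<open>\<Omega>\<close> of thickness \<open>l\<close> inside the
  punctured ball of radius \<open>r\<close> about \<open>x\<close>.\<close>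

definition narrow_region_hyps :: "real \<Rightarrow> real \<Rightarrow> real \<Rightarrow> real \<Rightarrow> real \<Rightarrow>
    ('a::euclidean_space \<Rightarrow> real) \<Rightarrow> 'a \<Rightarrow> real \<Rightarrow> real \<Rightarrow> 'a set \<Rightarrow> bool" where
  "narrow_region_hyps \<alpha> c1 c2 p1 p2 u x r l \<Omega> \<longleftrightarrow>
     \<Omega> \<subseteq> (ball x r - {x}) \<inter> annulus x r l \<and>
     (if \<alpha> < 2 then omega \<alpha> u x r \<in> L_space \<alpha> \<and> C11_loc_on \<Omega> (omega \<alpha> u x r)
      else C2_on \<Omega> (omega \<alpha> u x r)) \<and>
     (\<forall>y \<in> \<Omega> \<inter> B_minus \<alpha> u x r.
        frac_lap \<alpha> (omega \<alpha> u x r) y - L_coeff \<alpha> c1 c2 p1 p2 u x r y * omega \<alpha> u x r y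
        - 2 * c1 * (LINT z:B_minus \<alpha> u x r|lborel.
              u z * omega \<alpha> u x r z / norm (y - z) powr (2 * \<alpha>)) * u y powr p1 \<ge> 0) \<and>
     (B_minus \<alpha> u x r \<noteq> {} \<longrightarrow>
        (\<exists>y0 \<in> interior (ball x r - {x}). negative_minimum_at \<alpha> u x r y0)) \<and>
     \<not> (\<exists>y0 \<in> (ball x r - {x}) - \<Omega>. negative_minimum_at \<alpha> u x r y0)"

end

theory Submission
  imports Defs
begin

text \<open>
  Part (i): for small \<open>\<lambda>\<close> one has \<open>\<omega> \<ge> 0\<close> on the whole punctured ball. Where both \<open>y\<close> and its
  reflection are close to \<open>x\<close> this is the monotonicity of $t^{(n-\alpha)/2} u(x+t\theta)$ in \<open>t\<close>; elsewhere it
  follows from $u(z) \ge c|z-x|^{\alpha-n}$, a consequence of superharmonicity.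

  For part (ii) let \<open>d\<close> be the distance from a negative minimum of \<open>\<omega>\<close> to the sphere. If \<open>\<alpha> < 2\<close>,
  the antisymmetry of \<open>\<omega>\<close> under inversion bounds its fractional Laplacian at the minimum by
  $C d^{-\alpha}$ times the minimum, and (a) then bounds \<open>d\<close> from below. If \<open>\<alpha> = 2\<close>, the
  pointwise inequality at the minimum has no such gain; instead the equation for \<open>u\<close> and its Kelvin transform give a
  differential inequality for \<open>\<omega>\<close> near the sphere, and a quadratic barrier bounds \<open>d\<close> from below.
  Both bounds are locally uniform in \<open>\<lambda>\<close>, so the threshold can be chosen continuous.
\<close>

section \<open>Power integrals and inversion\<close>

text \<open>The definitions are total functions with default values: \<open>Lim\<close> says nothing
  unless the limit exists, a divergent integral is 0, and so is the inverse of 0. Existence of the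
  principal value, integrability of each piece and positivity of the normalizing constant therefore
  precede any inequality about \<open>frac_lap\<close>. The other thread is conformal. Inversion has
  Jacobian (r/|z-x|)^(2n), and the exponents n-\<alpha> of \<open>kelvin\<close>, n+\<alpha> of the
  fractional kernel and 2\<alpha> of \<open>P\<close> fit it: (n-\<alpha>)+(n+\<alpha>) =
  2(n-\<alpha>)+2\<alpha> = 2n. The condition n > 2\<alpha> makes the kernel of \<open>P\<close>
  locally integrable. The Jacobian is found by comparing measures of cones, without differentiating
  the inversion. The threshold must not depend on \<Omega>. The bound on the distance from a
  negative minimum to the sphere has a constant that involves only u, x, the parameters and a range
  of radii. Hypotheses (b) and (c) enter at the end: they place a negative minimum in \<Omega>, so
  at distance less than l from the sphere.\<close>

lemma sigma_sets_polar:
  fixes E :: "'a::euclidean_space set set"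
  defines "E \<equiv> {{z. sgn z \<in> A \<and> norm z \<le> t} | A t. A \<in> sets borel}"
  shows "sigma_sets UNIV E = sets borel"
proof
  have "E \<subseteq> sets borel"
    unfolding E_def by (auto intro!: borel_measurable_sgn) measurable
  then show "sigma_sets UNIV E \<subseteq> sets borel"
    using sets.sigma_sets_subset[of E "borel :: 'a measure"] by simp
next
  let ?M = "sigma UNIV E"
  have sE: "sets ?M = sigma_sets UNIV E" and sp: "space ?M = UNIV"
    by auto
  have n: "norm \<in> borel_measurable ?M"
  proof (rule borel_measurableI_le)
    fix t :: real
    have "{z::'a. norm z \<le> t} = {z. sgn z \<in> UNIV \<and> norm z \<le> t}" by simp
    then have "{z::'a. norm z \<le> t} \<in> E"
      unfolding E_def by (intro CollectI exI[of _ UNIV] exI[of _ t]) simp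
    then show "{z \<in> space ?M. norm z \<le> t} \<in> sets ?M" by (auto simp: sE)
  qed
  have s: "sgn \<in> measurable ?M borel"
  proof (rule measurableI)
    fix A :: "'a set" assume A: "A \<in> sets borel"
    have "sgn -` A = (\<Union>k::nat. {z::'a. sgn z \<in> A \<and> norm z \<le> real k})"
      using real_arch_simple by auto
    also have "\<dots> \<in> sigma_sets UNIV E"
      using A unfolding E_def by (intro sigma_sets.Union sigma_sets.Basic) blast
    finally show "sgn -` A \<inter> space ?M \<in> sets ?M" by (simp add: sE)
  qed simp
  \<comment> \<open>The identity factors as \<open>norm\<close> times \<open>sgn\<close>, and both
    are measurable for the sigma-algebra generated by the truncated cones; hence every Borel set
    belongs to it.\<close>
  have "(\<lambda>z::'a. norm z *\<^sub>R sgn z) \<in> measurable ?M borel"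
    using n s by (rule borel_measurable_scaleR)
  then have i: "(\<lambda>z::'a. z) \<in> measurable ?M borel"
  proof (rule measurable_cong[THEN iffD1, rotated])
    show "norm z *\<^sub>R sgn z = z" for z :: 'a by (cases "z = 0") (simp_all add: sgn_div_norm)
  qed
  show "sets borel \<subseteq> sigma_sets UNIV E"
  proof
    fix A :: "'a set" assume "A \<in> sets borel"
    from measurable_sets[OF i this] show "A \<in> sigma_sets UNIV E" by (simp add: sE)
  qed
qed

text \<open>Truncated cones are stable under intersection, the radii combining by
  \<open>min\<close>, and balls exhaust the space. They are the convenient generator because an
  inversion about the origin maps each cone to itself and only reverses the radial order.\<close>

lemma measure_eqI_polar:
  fixes M N :: "'a::euclidean_space measure"
  assumes "sets M = sets borel" "sets N = sets borel"
    and eq: "\<And>A t. A \<in> sets borel \<Longrightarrow> 0 \<le> t \<Longrightarrow>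
      emeasure M {z. sgn z \<in> A \<and> norm z \<le> t} = emeasure N {z. sgn z \<in> A \<and> norm z \<le> t}"
    and fin: "\<And>t. emeasure M (cball 0 t) \<noteq> \<infinity>"
  shows "M = N"
proof (rule measure_eqI_generator_eq)
  let ?E = "{{z::'a. sgn z \<in> A \<and> norm z \<le> t} | A t. A \<in> sets borel}"
  show "Int_stable ?E"
  proof (rule Int_stableI)
    fix a b assume "a \<in> ?E" "b \<in> ?E"
    then obtain A s B t where "A \<in> sets borel" "B \<in> sets borel"
      "a = {z. sgn z \<in> A \<and> norm z \<le> s}" "b = {z. sgn z \<in> B \<and> norm z \<le> t}" by blast
    then have "a \<inter> b = {z. sgn z \<in> A \<inter> B \<and> norm z \<le> min s t}" "A \<inter> B \<in> sets borel" by auto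
    then show "a \<inter> b \<in> ?E" by blast
  qed
  show "emeasure M X = emeasure N X" if X: "X \<in> ?E" for X
  proof -
    from X obtain A t where *: "X = {z. sgn z \<in> A \<and> norm z \<le> t}" "A \<in> sets borel" by blast
    show ?thesis
    proof (cases "t \<ge> 0")
      case False
      then have "X = {}" using * by (auto dest: order_trans[OF norm_ge_zero])
      then show ?thesis by simp
    qed (use * eq in auto)
  qed
  show "sets M = sigma_sets UNIV ?E" "sets N = sigma_sets UNIV ?E"
    using assms(1,2) sigma_sets_polar by auto
  show "range (\<lambda>k. cball (0::'a) (real k)) \<subseteq> ?E"
  proof -
    have "cball (0::'a) (real k) = {z. sgn z \<in> UNIV \<and> norm z \<le> real k}" for k
      by (simp add: cball_def)
    then show ?thesis
      by (intro image_subsetI CollectI, rule_tac x = UNIV in exI, rule_tac x = "real x" in exI) simp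
  qed
  show "(\<Union>k. cball (0::'a) (real k)) = UNIV" using real_arch_simple by auto
  show "emeasure M (cball 0 (real k)) \<noteq> \<infinity>" for k using fin by blast
qed auto

section \<open>Integrability of powers of the norm, by scaling and dyadic shells\<close>

lemma nn_integral_lborel_affine:
  fixes f :: "'a::euclidean_space \<Rightarrow> ennreal"
  assumes [measurable]: "f \<in> borel_measurable borel" and "c \<noteq> 0"
  shows "(\<integral>\<^sup>+z. f z \<partial>lborel) = ennreal (\<bar>c\<bar> ^ DIM('a)) * (\<integral>\<^sup>+z. f (t + c *\<^sub>R z) \<partial>lborel)"
  by (subst lborel_affine[OF assms(2), of t])
     (simp add: nn_integral_density nn_integral_distr nn_integral_cmult ennreal_power)

text \<open>A substitute for polar coordinates: covering each dyadic shell by the whole ball around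
  it costs only a constant factor, so the integral is dominated by a multiple of the series of
  \<open>a k * R k ^ DIM('a)\<close>.\<close>

lemma ball_dyadic_sum:
  fixes a :: "nat \<Rightarrow> real" and R :: "nat \<Rightarrow> real"
  assumes "\<And>k. a k \<ge> 0" "\<And>k. R k \<ge> 0" and "summable (\<lambda>k. a k * R k ^ DIM('a))"
    and cov: "\<And>z::'a::euclidean_space. f z > 0 \<Longrightarrow> \<exists>k. norm z < R k \<and> f z \<le> a k"
  shows "(\<integral>\<^sup>+z. ennreal (f z) \<partial>(lborel :: 'a measure)) < \<infinity>"
proof -
  have "(\<integral>\<^sup>+z. ennreal (f z) \<partial>(lborel :: 'a measure))
      \<le> (\<integral>\<^sup>+z. (\<Sum>k. ennreal (a k) * indicator (ball 0 (R k)) z) \<partial>(lborel :: 'a measure))"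
  proof (rule nn_integral_mono)
    fix z :: 'a
    show "ennreal (f z) \<le> (\<Sum>k. ennreal (a k) * indicator (ball 0 (R k)) z)"
    proof (cases "f z > 0")
      case True
      then obtain k where k: "norm z < R k" "f z \<le> a k" using cov by blast
      have "ennreal (f z) \<le> (\<Sum>k\<in>{k}. ennreal (a k) * indicator (ball 0 (R k)) z)"
        using k by (auto intro: ennreal_leI)
      also have "\<dots> \<le> (\<Sum>k. ennreal (a k) * indicator (ball 0 (R k)) z)"
        by (rule sum_le_suminf) auto
      finally show ?thesis .
    qed (simp add: ennreal_neg)
  qed
  also have "\<dots> = (\<Sum>k. \<integral>\<^sup>+z. ennreal (a k) * indicator (ball 0 (R k)) z \<partial>(lborel :: 'a measure))"
    by (rule nn_integral_suminf) (auto intro!: borel_measurable_times_ennreal borel_measurable_indicator)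
  also have "\<dots> = (\<Sum>k. ennreal (unit_ball_vol (DIM('a)) * (a k * R k ^ DIM('a))))"
  proof (rule suminf_cong)
    fix k
    have bm: "ball (0::'a) (R k) \<in> sets lborel" by simp
    show "(\<integral>\<^sup>+z. ennreal (a k) * indicator (ball 0 (R k)) z \<partial>(lborel :: 'a measure))
      = ennreal (unit_ball_vol (DIM('a)) * (a k * R k ^ DIM('a)))"
      unfolding nn_integral_cmult_indicator[OF bm] emeasure_ball[OF assms(2)]
      by (subst ennreal_mult[symmetric]) (simp_all add: assms(1,2) mult_ac)
  qed
  also have "\<dots> = ennreal (\<Sum>k. unit_ball_vol (DIM('a)) * (a k * R k ^ DIM('a)))"
    by (rule suminf_ennreal2) (use assms(1,2) in simp, rule summable_mult[OF assms(3)])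
  also have "\<dots> < \<infinity>" by simp
  finally show ?thesis .
qed

text \<open>On the shells \<rho> 2^k \<le> |z| < \<rho> 2^(k+1) the dyadic bound is a geometric
  series of ratio 2^(n-s), which is below 1 because s > n.\<close>

lemma nn_integral_norm_powr_far:
  assumes "s > real DIM('a::euclidean_space)" "\<rho> > 0"
  shows "(\<integral>\<^sup>+z. ennreal (indicator {z. \<rho> \<le> norm z} z * norm z powr (-s)) \<partial>(lborel :: 'a measure)) < \<infinity>"
proof (rule ball_dyadic_sum[where a = "\<lambda>k. (\<rho> * 2 ^ k) powr (-s)" and R = "\<lambda>k. \<rho> * 2 ^ Suc k"])
  have "(\<rho> * 2 ^ k) powr (-s) * (\<rho> * 2 ^ Suc k) ^ DIM('a)
      = \<rho> powr (-s) * (\<rho> * 2) ^ DIM('a) * (2 powr (real DIM('a) - s)) ^ k" for k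
  proof -
    have "(2 ^ k :: real) powr (-s) = (2 powr (-s)) ^ k"
      by (simp add: powr_realpow[symmetric] powr_powr mult.commute)
    moreover have "(2::real) powr (real DIM('a) - s) = 2 powr (-s) * 2 ^ DIM('a)"
      by (simp add: powr_add[symmetric] powr_realpow[symmetric] algebra_simps)
    ultimately show ?thesis using assms
      by (simp add: powr_mult power_mult_distrib power_mult[symmetric] mult_ac)
  qed
  moreover have "(2::real) powr (real DIM('a) - s) < 1" using assms by (simp add: powr_less_one)
  ultimately show "summable (\<lambda>k. (\<rho> * 2 ^ k) powr (-s) * (\<rho> * 2 ^ Suc k) ^ DIM('a))"
    by (auto intro!: summable_mult summable_geometric)
  fix z :: 'a assume "0 < indicator {z. \<rho> \<le> norm z} z * norm z powr (-s)"
  then have z: "\<rho> \<le> norm z" by (cases "\<rho> \<le> norm z") auto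
  define k where "k = nat \<lfloor>log 2 (norm z / \<rho>)\<rfloor>"
  have "norm z / \<rho> \<ge> 1" using z assms by simp
  then have l: "log 2 (norm z / \<rho>) \<ge> 0" by simp
  then have k: "real k \<le> log 2 (norm z / \<rho>)" "log 2 (norm z / \<rho>) < real (Suc k)"
    unfolding k_def by linarith+
  have p: "0 < norm z / \<rho>" using z assms by (intro divide_pos_pos) linarith+
  have "2 ^ k \<le> norm z / \<rho>" "norm z / \<rho> < 2 ^ Suc k"
    using k p by (simp_all add: le_log_iff log_less_iff powr_realpow[symmetric] del: power_Suc of_nat_Suc)
  then have b: "\<rho> * 2 ^ k \<le> norm z" "norm z < \<rho> * 2 ^ Suc k"
    using assms by (simp_all add: field_simps)
  moreover have "norm z powr (-s) \<le> (\<rho> * 2 ^ k) powr (-s)"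
    using b assms by (intro powr_mono2') auto
  ultimately show "\<exists>k. norm z < \<rho> * 2 ^ Suc k \<and> indicator {z. \<rho> \<le> norm z} z * norm z powr (-s) \<le> (\<rho> * 2 ^ k) powr (-s)"
    by (intro exI[of _ k]) (auto simp: indicator_def)
qed (use assms in auto)

text \<open>The shells now shrink towards the origin and the ratio becomes 2^(s-n), below 1 because
  s < n.\<close>

lemma nn_integral_norm_powr_near:
  assumes "s < real DIM('a::euclidean_space)" "\<rho> > 0" "s \<ge> 0"
  shows "(\<integral>\<^sup>+z. ennreal (indicator (ball 0 \<rho>) z * norm z powr (-s)) \<partial>(lborel :: 'a measure)) < \<infinity>"
proof (rule ball_dyadic_sum[where a = "\<lambda>k. (\<rho> / 2 ^ Suc k) powr (-s)" and R = "\<lambda>k. \<rho> / 2 ^ k"])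
  have "(\<rho> / 2 ^ Suc k) powr (-s) * (\<rho> / 2 ^ k) ^ DIM('a)
      = (\<rho> / 2) powr (-s) * \<rho> ^ DIM('a) * (2 powr (s - real DIM('a))) ^ k" for k
  proof -
    have "\<rho> / 2 ^ Suc k = (\<rho> / 2) * 2 powr (- real k)"
      by (simp add: powr_minus powr_realpow field_simps)
    then have "(\<rho> / 2 ^ Suc k) powr (-s) = ((\<rho> / 2) * 2 powr (- real k)) powr (-s)" by (rule arg_cong)
    also have "\<dots> = (\<rho> / 2) powr (-s) * 2 powr (real k * s)"
      using assms by (subst powr_mult) (simp_all add: powr_powr)
    finally have "(\<rho> / 2 ^ Suc k) powr (-s) = (\<rho> / 2) powr (-s) * 2 powr (real k * s)" .
    moreover have "(\<rho> / 2 ^ k) ^ DIM('a) = \<rho> ^ DIM('a) * 2 powr (- (real k * real DIM('a)))"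
      by (simp add: powr_minus powr_realpow[symmetric] powr_powr power_divide field_simps power_mult[symmetric])
    moreover have "(2 powr (s - real DIM('a))) ^ k = 2 powr (real k * s) * 2 powr (- (real k * real DIM('a)))"
      by (simp add: powr_add[symmetric] powr_realpow[symmetric] powr_powr algebra_simps)
    ultimately show ?thesis by simp
  qed
  moreover have "(2::real) powr (s - real DIM('a)) < 1" using assms by (simp add: powr_less_one)
  ultimately show "summable (\<lambda>k. (\<rho> / 2 ^ Suc k) powr (-s) * (\<rho> / 2 ^ k) ^ DIM('a))"
    by (auto intro!: summable_mult summable_geometric)
  fix z :: 'a assume "0 < indicator (ball 0 \<rho>) z * norm z powr (-s)"
  then have z: "norm z < \<rho>" "norm z > 0" by (cases "norm z < \<rho>"; auto)+
  \<comment> \<open>The covering by open balls needs the strict inequality at the outer radius of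
    the shell, hence the ceiling minus one where the previous lemma takes a floor.\<close>
  define k where "k = nat (\<lceil>log 2 (\<rho> / norm z)\<rceil> - 1)"
  have "\<rho> / norm z > 1" using z assms by simp
  then have l: "log 2 (\<rho> / norm z) > 0" by simp
  then have k: "real k < log 2 (\<rho> / norm z)" "log 2 (\<rho> / norm z) \<le> real (Suc k)"
    unfolding k_def by linarith+
  have p: "0 < \<rho> / norm z" using z assms by simp
  have "2 ^ k < \<rho> / norm z" "\<rho> / norm z \<le> 2 ^ Suc k"
    using k p by (simp_all add: less_log_iff log_le_iff powr_realpow[symmetric] del: power_Suc of_nat_Suc)
  then have b: "norm z < \<rho> / 2 ^ k" "\<rho> / 2 ^ Suc k \<le> norm z"
    using z assms by (simp_all add: field_simps)
  moreover have "norm z powr (-s) \<le> (\<rho> / 2 ^ Suc k) powr (-s)"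
    using b assms by (intro powr_mono2') auto
  ultimately show "\<exists>k. norm z < \<rho> / 2 ^ k \<and> indicator (ball 0 \<rho>) z * norm z powr (-s) \<le> (\<rho> / 2 ^ Suc k) powr (-s)"
    by (intro exI[of _ k]) (auto simp: indicator_def)
qed (use assms in auto)

lemma sphere_null_sets: "sphere (c::'a::euclidean_space) r \<in> null_sets lborel"
  using negligible_sphere[of c r]
  by (auto simp: null_sets_completion_iff negligible_iff_null_sets negligible_convex_frontier)

lemma measurable_cone [measurable]:
  assumes [measurable]: "A \<in> sets borel"
  shows "Measurable.pred borel (\<lambda>z::'a::euclidean_space. sgn z \<in> A)"
proof -
  have [measurable]: "(sgn :: 'a \<Rightarrow> 'a) \<in> borel_measurable borel"
    by (simp add: sgn_div_norm[abs_def])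
  show ?thesis by measurable
qed

text \<open>Scaling determines both the volume of a truncated cone over \<open>A\<close> and the mass of the tail of
  the cone under $|z|^{-2n} dz$ up to a constant; comparing the two on a thin shell
  $1 \le |z| < q$ and letting $q$ tend to 1 shows that the two constants agree.\<close>

lemma cone_tail:
  fixes A :: "'a::euclidean_space set"
  assumes A [measurable]: "A \<in> sets borel" and "s > 0"
  shows "(\<integral>\<^sup>+z. ennreal (indicator {z. sgn z \<in> A \<and> s \<le> norm z} z * norm z powr (- (2 * real DIM('a)))) \<partial>lborel)
    = ennreal ((1 / s) ^ DIM('a)) * emeasure lborel {z. sgn z \<in> A \<and> norm z < 1}"
proof -
  let ?n = "DIM('a)"
  define T where "T = (\<lambda>s. \<integral>\<^sup>+z. ennreal (indicator {z. sgn z \<in> A \<and> s \<le> norm z} z * norm z powr (- (2 * real DIM('a)))) \<partial>lborel)"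
  define C where "C = (\<lambda>t. emeasure lborel {z. sgn z \<in> A \<and> norm z < t})"
  have sgn_scale: "sgn (t *\<^sub>R z) = sgn z" if "t > 0" for t :: real and z :: 'a
    using that by (simp add: sgn_scaleR)
  \<comment> \<open>The volume contributes t^n and the weight t^(-2n), so a tail scales by t^(-n),
    inversely to a truncated cone.\<close>
  have Tscale: "T t = ennreal ((1 / t) ^ ?n) * T 1" if t: "t > 0" for t
  proof -
    have e: "indicator {z. sgn z \<in> A \<and> t \<le> norm z} (t *\<^sub>R z) * norm (t *\<^sub>R z) powr (- (2 * real ?n))
        = (1 / t) ^ (2 * ?n) * (indicator {z. sgn z \<in> A \<and> 1 \<le> norm z} z * norm z powr (- (2 * real ?n)))" for z :: 'a
    proof -
      have "t powr (- (2 * real ?n)) = (1 / t) ^ (2 * ?n)"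
        using t by (simp add: powr_minus powr_realpow[symmetric] power_one_over field_simps)
      then show ?thesis using t by (auto simp: indicator_def sgn_scale powr_mult)
    qed
    have "T t = ennreal (t ^ ?n) * (\<integral>\<^sup>+z. ennreal ((1 / t) ^ (2 * ?n) *
        (indicator {z. sgn z \<in> A \<and> 1 \<le> norm z} z * norm z powr (- (2 * real ?n)))) \<partial>lborel)"
      unfolding T_def using t by (subst nn_integral_lborel_affine[where c = t and t = 0]) (simp_all add: e del: norm_scaleR)
    also have "\<dots> = ennreal (t ^ ?n) * (ennreal ((1 / t) ^ (2 * ?n)) * T 1)"
      unfolding T_def using t by (subst nn_integral_cmult[symmetric]) (auto simp: ennreal_mult)
    also have "\<dots> = ennreal (t ^ ?n * (1 / t) ^ (2 * ?n)) * T 1"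
      using t by (simp add: ennreal_mult mult.assoc)
    also have "t ^ ?n * (1 / t) ^ (2 * ?n) = (1 / t) ^ ?n"
      using t by (simp add: power_one_over power_mult power2_eq_square field_simps mult_2 power_add)
    finally show ?thesis .
  qed
  have Cscale: "C t = ennreal (t ^ ?n) * C 1" if t: "t > 0" for t
  proof -
    have "C t = (\<integral>\<^sup>+z. indicator {z. sgn z \<in> A \<and> norm z < t} z \<partial>lborel)" unfolding C_def by simp
    also have "\<dots> = ennreal (t ^ ?n) * (\<integral>\<^sup>+z. indicator {z. sgn z \<in> A \<and> norm z < t} (t *\<^sub>R z) \<partial>lborel)"
      using t by (subst nn_integral_lborel_affine[where c = t and t = 0]) simp_all
    also have "(\<lambda>z. indicator {z. sgn z \<in> A \<and> norm z < t} (t *\<^sub>R z)) = (indicator {z. sgn z \<in> A \<and> norm z < 1} :: 'a \<Rightarrow> ennreal)"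
      using t by (auto simp: indicator_def sgn_scale)
    finally show ?thesis unfolding C_def by simp
  qed
  have Cfin: "C t < \<infinity>" for t
  proof -
    have "C t \<le> emeasure lborel (ball (0::'a) t)" unfolding C_def by (intro emeasure_mono) auto
    also have "\<dots> < \<infinity>" by (rule emeasure_lborel_ball_finite)
    finally show ?thesis .
  qed
  have Tfin: "T 1 < \<infinity>"
  proof -
    have "T 1 \<le> (\<integral>\<^sup>+z. ennreal (indicator {z. 1 \<le> norm z} z * norm z powr (- (2 * real ?n))) \<partial>(lborel :: 'a measure))"
      unfolding T_def by (intro nn_integral_mono ennreal_leI) (auto simp: indicator_def)
    also have "\<dots> < \<infinity>" by (rule nn_integral_norm_powr_far) auto
    finally show ?thesis .
  qed
  obtain c where c: "C 1 = ennreal c" "c \<ge> 0" using Cfin[of 1] by (cases "C 1") auto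
  obtain \<tau> where \<tau>: "T 1 = ennreal \<tau>" "\<tau> \<ge> 0" using Tfin by (cases "T 1") auto
  have main: "\<tau> \<le> q ^ ?n * c" "c \<le> q ^ ?n * \<tau>" if q: "q > 1" for q
  proof -
    define S where "S = {z::'a. sgn z \<in> A \<and> 1 \<le> norm z \<and> norm z < q}"
    define m where "m = (\<integral>\<^sup>+z. ennreal (indicator S z * norm z powr (- (2 * real ?n))) \<partial>lborel)"
    have [measurable]: "S \<in> sets borel" unfolding S_def by measurable
    have "C q = emeasure lborel ({z. sgn z \<in> A \<and> norm z < 1} \<union> S)"
      unfolding C_def S_def using q by (intro arg_cong[where f = "emeasure lborel"]) auto
    also have "\<dots> = C 1 + emeasure lborel S"
      unfolding C_def by (rule plus_emeasure[symmetric]) (auto simp: S_def)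
    finally have Cq: "C q = C 1 + emeasure lborel S" .
    then have "emeasure lborel S < \<infinity>" using Cfin[of q] by (auto simp: less_top)
    then obtain e where e: "emeasure lborel S = ennreal e" "e \<ge> 0" by (cases "emeasure lborel S") auto
    have e': "e = (q ^ ?n - 1) * c"
    proof -
      have "ennreal (q ^ ?n * c) = ennreal (c + e)"
        using Cq Cscale[of q] q c e by (simp add: ennreal_mult ennreal_plus)
      then have "q ^ ?n * c = c + e" using c e q by (subst (asm) ennreal_inj) auto
      then show ?thesis by (simp add: algebra_simps)
    qed
    have "T 1 = (\<integral>\<^sup>+z. ennreal (indicator {z. sgn z \<in> A \<and> q \<le> norm z} z * norm z powr (- (2 * real DIM('a))))
        + ennreal (indicator S z * norm z powr (- (2 * real ?n))) \<partial>lborel)"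
      unfolding T_def S_def using q by (intro nn_integral_cong) (auto simp: indicator_def)
    also have "\<dots> = T q + m"
      unfolding T_def m_def by (rule nn_integral_add) auto
    finally have Tm: "T 1 = T q + m" .
    then have "m < \<infinity>" using Tfin by (auto simp: less_top)
    then obtain \<mu> where \<mu>: "m = ennreal \<mu>" "\<mu> \<ge> 0" by (cases m) auto
    have \<mu>': "\<mu> = (1 - (1 / q) ^ ?n) * \<tau>"
    proof -
      have "ennreal \<tau> = ennreal ((1 / q) ^ ?n * \<tau> + \<mu>)"
        using Tm Tscale[of q] q \<tau> \<mu> by (simp add: ennreal_mult ennreal_plus)
      then have "\<tau> = (1 / q) ^ ?n * \<tau> + \<mu>" using \<tau> \<mu> q by (subst (asm) ennreal_inj) auto
      then show ?thesis by (simp add: algebra_simps)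
    qed
    have "m \<le> (\<integral>\<^sup>+z. indicator S z \<partial>lborel)"
      unfolding m_def
    proof (rule nn_integral_mono)
      fix z :: 'a
      have "norm z powr (- (2 * real ?n)) \<le> 1" if "z \<in> S"
        using powr_mono2'[of "- (2 * real ?n)" 1 "norm z"] that by (simp add: S_def)
      then show "ennreal (indicator S z * norm z powr (- (2 * real ?n))) \<le> indicator S z"
        by (auto simp: indicator_def)
    qed
    then have m1: "\<mu> \<le> e" using \<mu> e by simp
    have "(\<integral>\<^sup>+z. ennreal (q powr (- (2 * real ?n))) * indicator S z \<partial>lborel) \<le> m"
      unfolding m_def
    proof (rule nn_integral_mono)
      fix z :: 'a
      have "q powr (- (2 * real ?n)) \<le> norm z powr (- (2 * real ?n))" if "z \<in> S"
        using that q by (intro powr_mono2') (auto simp: S_def)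
      then show "ennreal (q powr (- (2 * real ?n))) * indicator S z \<le> ennreal (indicator S z * norm z powr (- (2 * real ?n)))"
        by (auto simp: indicator_def intro: ennreal_leI)
    qed
    then have "ennreal (q powr (- (2 * real ?n)) * e) \<le> ennreal \<mu>"
      using \<mu> e by (simp add: nn_integral_cmult ennreal_mult)
    then have m2: "q powr (- (2 * real ?n)) * e \<le> \<mu>" using \<mu> by (simp add: ennreal_le_iff)
    \<comment> \<open>Both comparisons on the shell carry the factor Q - 1, which tends to 0 with
      the shell. Dividing by it before the passage to the limit is what leaves \<tau> and c
      comparable.\<close>
    define Q where "Q = q ^ ?n"
    have Q: "Q > 1" unfolding Q_def using q by (simp add: one_less_power)
    have *: "(1 / q) ^ ?n = 1 / Q" "q powr (- (2 * real ?n)) = 1 / Q ^ 2"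
      using q by (auto simp: Q_def power_one_over powr_minus powr_realpow[symmetric] powr_powr field_simps)
    from m1 have "(1 - 1 / Q) * \<tau> \<le> (Q - 1) * c" unfolding \<mu>' e' * Q_def[symmetric] .
    then have "(Q - 1) * \<tau> \<le> (Q - 1) * (Q * c)" using Q by (simp add: field_simps)
    then show "\<tau> \<le> q ^ ?n * c" unfolding Q_def[symmetric] using Q by simp
    from m2 have "1 / Q ^ 2 * ((Q - 1) * c) \<le> (1 - 1 / Q) * \<tau>" unfolding \<mu>' e' * Q_def[symmetric] .
    then have "Q ^ 2 * (1 / Q ^ 2 * ((Q - 1) * c)) \<le> Q ^ 2 * ((1 - 1 / Q) * \<tau>)"
      by (rule mult_left_mono) simp
    then have "(Q - 1) * c \<le> (Q - 1) * (Q * \<tau>)" using Q by (simp add: right_diff_distrib left_diff_distrib power2_eq_square)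
    then show "c \<le> q ^ ?n * \<tau>" unfolding Q_def[symmetric] using Q by simp
  qed
  have lim: "((\<lambda>q. q ^ ?n * a) \<longlongrightarrow> 1 ^ ?n * a) (at_right 1)" for a :: real
    by (intro tendsto_intros)
  have ev: "eventually (\<lambda>q::real. q > 1) (at_right 1)" by (simp add: eventually_at_right_less)
  have "\<tau> \<le> 1 ^ ?n * c"
    by (rule tendsto_lowerbound[OF lim[of c]]) (use main in \<open>auto intro: eventually_mono[OF ev]\<close>)
  moreover have "c \<le> 1 ^ ?n * \<tau>"
    by (rule tendsto_lowerbound[OF lim[of \<tau>]]) (use main in \<open>auto intro: eventually_mono[OF ev]\<close>)
  ultimately have "T 1 = C 1" using c \<tau> by simp
  then show ?thesis using Tscale[OF assms(2)] unfolding T_def C_def by simp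
qed

section \<open>Geometry of the inversion and the change of variables it induces\<close>

lemma inversion_at_center [simp]: "inversion x r x = x"
  by (simp add: inversion_def)

lemma norm_inversion: "norm (inversion x r y - x) = r\<^sup>2 / norm (y - x)"
  by (simp add: inversion_def power2_eq_square)

lemma inversion_eq_center_iff: "r > 0 \<Longrightarrow> inversion x r y = x \<longleftrightarrow> y = x"
  by (simp add: inversion_def)

lemma inversion_inversion: "r > 0 \<Longrightarrow> inversion x r (inversion x r y) = y"
proof (cases "y = x")
  case False
  assume "r > 0"
  then have "r\<^sup>2 / (norm (inversion x r y - x))\<^sup>2 * (r\<^sup>2 / (norm (y - x))\<^sup>2) = 1"
    using False by (simp add: norm_inversion power_divide power2_eq_square)
  moreover have "inversion x r y - x = (r\<^sup>2 / (norm (y - x))\<^sup>2) *\<^sub>R (y - x)"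
    by (simp add: inversion_def)
  ultimately show ?thesis
    unfolding inversion_def[of x r "inversion x r y"] by (simp del: divide_divide_eq_right)
qed simp

lemma borel_measurable_inversion [measurable]:
  "inversion x r \<in> borel_measurable borel"
  unfolding inversion_def[abs_def] by measurable

text \<open>Expansion of squared norms. The two distances to the centre that appear, one for each
  point, are what turns a power of |y - z| into the reflected kernel after a change of
  variables.\<close>

lemma dist_inversion:
  assumes "r > 0" "y \<noteq> x" "z \<noteq> x"
  shows "norm (inversion x r y - inversion x r z) = r\<^sup>2 * norm (y - z) / (norm (y - x) * norm (z - x))"
proof -
  define a b where "a = y - x" and "b = z - x"
  have ab: "norm a > 0" "norm b > 0" using assms by (auto simp: a_def b_def)
  have aa: "(norm a)\<^sup>2 = a \<bullet> a" "(norm b)\<^sup>2 = b \<bullet> b" by (simp_all add: power2_norm_eq_inner)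
  have ne: "a \<bullet> a \<noteq> 0" "b \<bullet> b \<noteq> 0" using ab by auto
  have "(norm (inversion x r y - inversion x r z))\<^sup>2 = (norm ((r\<^sup>2 / (a \<bullet> a)) *\<^sub>R a - (r\<^sup>2 / (b \<bullet> b)) *\<^sub>R b))\<^sup>2"
    by (simp add: inversion_def a_def b_def power2_norm_eq_inner)
  also have "\<dots> = (r\<^sup>2 / (a \<bullet> a))\<^sup>2 * (a \<bullet> a) - 2 * (r\<^sup>2 / (a \<bullet> a)) * (r\<^sup>2 / (b \<bullet> b)) * (a \<bullet> b) + (r\<^sup>2 / (b \<bullet> b))\<^sup>2 * (b \<bullet> b)"
    unfolding power2_norm_eq_inner by (simp add: inner_diff_left inner_diff_right inner_commute power2_eq_square)
  also have "\<dots> = r ^ 4 * (a \<bullet> a - 2 * (a \<bullet> b) + b \<bullet> b) / ((a \<bullet> a) * (b \<bullet> b))"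
    using ne by (simp add: field_simps power2_eq_square power4_eq_xxxx)
  also have "a \<bullet> a - 2 * (a \<bullet> b) + b \<bullet> b = (norm (y - z))\<^sup>2"
    unfolding power2_norm_eq_inner a_def b_def by (simp add: inner_diff_left inner_diff_right inner_commute)
  also have "r ^ 4 * (norm (y - z))\<^sup>2 / ((a \<bullet> a) * (b \<bullet> b)) = (r\<^sup>2 * norm (y - z) / (norm (y - x) * norm (z - x)))\<^sup>2"
    unfolding aa[symmetric] by (simp add: a_def b_def power_mult_distrib power_divide)
  finally show ?thesis
    by (rule power2_eq_imp_eq) simp_all
qed

lemma dist_inversion_sphere:
  assumes "r > 0" "norm (y - x) = r" "z \<noteq> x"
  shows "norm (y - inversion x r z) = r * norm (y - z) / norm (z - x)"
proof -
  have "inversion x r y = y" using assms by (simp add: inversion_def)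
  moreover have "y \<noteq> x" using assms by auto
  ultimately show ?thesis using dist_inversion[of r y x z] assms by (simp add: power2_eq_square)
qed

text \<open>This inequality makes the reflected kernel smaller than the original one.\<close>

lemma dist_inversion_ge:
  assumes "r > 0" "norm (y - x) \<le> r" "norm (z - x) \<le> r" "z \<noteq> x"
  shows "norm (y - z) \<le> norm (y - inversion x r z) * norm (z - x) / r"
proof -
  define a b where "a = y - x" and "b = z - x"
  have b: "norm b > 0" using assms by (auto simp: b_def)
  have ne: "b \<bullet> b \<noteq> 0" using b by auto
  have bb: "(norm b)\<^sup>2 = b \<bullet> b" by (simp add: power2_norm_eq_inner)
  have "(norm (y - inversion x r z) * norm (z - x) / r)\<^sup>2 = (norm (a - (r\<^sup>2 / (b \<bullet> b)) *\<^sub>R b))\<^sup>2 * (b \<bullet> b) / r\<^sup>2"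
    by (simp add: inversion_def a_def b_def power_mult_distrib power_divide power2_norm_eq_inner algebra_simps)
  also have "\<dots> = ((a \<bullet> a) - 2 * (r\<^sup>2 / (b \<bullet> b)) * (a \<bullet> b) + (r\<^sup>2 / (b \<bullet> b))\<^sup>2 * (b \<bullet> b)) * (b \<bullet> b) / r\<^sup>2"
    unfolding power2_norm_eq_inner
    by (simp add: inner_diff_left inner_diff_right inner_commute power2_eq_square)
  also have "\<dots> = (a \<bullet> a) * (b \<bullet> b) / r\<^sup>2 - 2 * (a \<bullet> b) + r\<^sup>2"
    using ne assms by (simp add: field_simps power2_eq_square)
  \<comment> \<open>The difference of the two squares factors as (r^2 - |a|^2)(r^2 - |b|^2)/r^2, and
    both factors are nonnegative in the closed ball.\<close>
  also have "\<dots> - (norm (y - z))\<^sup>2 = (r\<^sup>2 - a \<bullet> a) * (r\<^sup>2 - b \<bullet> b) / r\<^sup>2"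
  proof -
    have "(norm (y - z))\<^sup>2 = a \<bullet> a - 2 * (a \<bullet> b) + b \<bullet> b"
      unfolding power2_norm_eq_inner a_def b_def by (simp add: inner_diff_left inner_diff_right inner_commute)
    then show ?thesis using assms by (simp only:) (simp add: field_simps power2_eq_square)
  qed
  finally have "(norm (y - inversion x r z) * norm (z - x) / r)\<^sup>2 - (norm (y - z))\<^sup>2 = (r\<^sup>2 - a \<bullet> a) * (r\<^sup>2 - b \<bullet> b) / r\<^sup>2" .
  moreover have "a \<bullet> a \<le> r\<^sup>2" "b \<bullet> b \<le> r\<^sup>2"
    unfolding power2_norm_eq_inner[symmetric] a_def b_def using assms by (auto intro: power_mono)
  then have "0 \<le> (r\<^sup>2 - a \<bullet> a) * (r\<^sup>2 - b \<bullet> b) / r\<^sup>2" by simp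
  ultimately have "(norm (y - z))\<^sup>2 \<le> (norm (y - inversion x r z) * norm (z - x) / r)\<^sup>2" by linarith
  then show ?thesis by (rule power2_le_imp_le) (use assms in simp)
qed

text \<open>For centre 0 it suffices to test on truncated cones: the preimage of the cone up to
  radius t is its tail from radius r^2/t, whose mass is computed in \<open>cone_tail\<close>. A
  translation then moves the centre to \<open>x\<close>.\<close>

lemma lborel_eq_distr_inversion:
  fixes x :: "'a::euclidean_space"
  assumes r: "r > 0"
  shows "lborel = distr (density lborel (\<lambda>z. ennreal ((r / norm (z - x)) ^ (2 * DIM('a))))) borel (inversion x r)"
proof -
  let ?n = "DIM('a)"
  have "lborel = distr (density (lborel :: 'a measure) (\<lambda>z. ennreal ((r / norm z) ^ (2 * ?n)))) borel (inversion 0 r)" (is "_ = ?N")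
  proof (rule measure_eqI_polar)
    fix A :: "'a set" and t :: real
    assume A [measurable]: "A \<in> sets borel" and t: "t \<ge> 0"
    let ?S = "{z. sgn z \<in> A \<and> norm z \<le> t}"
    have "emeasure ?N ?S = (\<integral>\<^sup>+z. ennreal ((r / norm z) ^ (2 * ?n)) * indicator ?S (inversion 0 r z) \<partial>lborel)"
      by (subst emeasure_distr, simp, simp, subst emeasure_density)
         (auto intro!: nn_integral_cong simp: indicator_def)
    also have "\<dots> = emeasure lborel ?S"
    \<comment> \<open>Here r^2/t would be a division by zero. The set has at most the point 0, whose
      only preimage is 0, and there the density is 0 because r/0 = 0.\<close>
    proof (cases "t = 0")
      case True
      have "(\<integral>\<^sup>+z. ennreal ((r / norm z) ^ (2 * ?n)) * indicator ?S (inversion 0 r z) \<partial>(lborel :: 'a measure)) = (\<integral>\<^sup>+z. 0 \<partial>(lborel :: 'a measure))"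
      proof (rule nn_integral_cong)
        fix z :: 'a
        show "ennreal ((r / norm z) ^ (2 * ?n)) * indicator ?S (inversion 0 r z) = 0"
          using True inversion_eq_center_iff[OF r, of 0 z] by (cases "z = 0") (auto simp: indicator_def)
      qed
      moreover have "emeasure lborel ?S \<le> emeasure lborel {0::'a}"
        using True by (intro emeasure_mono) auto
      ultimately show ?thesis by simp
    next
      case False
      then have t: "t > 0" using t by simp
      let ?c = "emeasure lborel {z. sgn z \<in> A \<and> norm z < 1}"
      have ind: "ennreal ((r / norm z) ^ (2 * ?n)) * indicator ?S (inversion 0 r z) = ennreal (r ^ (2 * ?n)) *
          ennreal (indicator {z. sgn z \<in> A \<and> r\<^sup>2 / t \<le> norm z} z * norm z powr (- (2 * real ?n)))" for z :: 'a
      proof (cases "z = 0")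
        case False
        then have z: "norm z > 0" by simp
        have "sgn (inversion 0 r z) = sgn z" using False r by (simp add: inversion_def sgn_scaleR)
        moreover have "norm (inversion 0 r z) \<le> t \<longleftrightarrow> r\<^sup>2 / t \<le> norm z"
        proof -
          have "norm (inversion 0 r z) = r\<^sup>2 / norm z" using norm_inversion[of 0 r z] by simp
          then show ?thesis using z t by (simp only:) (simp add: field_simps)
        qed
        moreover have "(r / norm z) ^ (2 * ?n) = r ^ (2 * ?n) * norm z powr (- (2 * real ?n))"
          using z by (simp add: powr_minus powr_realpow[symmetric] power_divide field_simps)
        ultimately show ?thesis using r by (auto simp: indicator_def ennreal_mult)
      qed simp
      have "(\<integral>\<^sup>+z. ennreal ((r / norm z) ^ (2 * ?n)) * indicator ?S (inversion 0 r z) \<partial>(lborel :: 'a measure))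
          = ennreal (r ^ (2 * ?n)) * (ennreal ((1 / (r\<^sup>2 / t)) ^ ?n) * ?c)"
        unfolding ind using r t by (subst nn_integral_cmult) (auto simp: cone_tail)
      also have "\<dots> = ennreal (r ^ (2 * ?n) * (1 / (r\<^sup>2 / t)) ^ ?n) * ?c"
        using r t by (simp add: ennreal_mult mult.assoc)
      also have "r ^ (2 * ?n) * (1 / (r\<^sup>2 / t)) ^ ?n = t ^ ?n"
        using r t by (simp add: power_mult power_divide)
      also have "ennreal (t ^ ?n) * ?c = emeasure lborel {z. sgn z \<in> A \<and> norm z < t}"
      proof -
        have "emeasure lborel {z. sgn z \<in> A \<and> norm z < t} = (\<integral>\<^sup>+z. indicator {z. sgn z \<in> A \<and> norm z < t} z \<partial>lborel)" by simp
        also have "\<dots> = ennreal (t ^ ?n) * (\<integral>\<^sup>+z. indicator {z. sgn z \<in> A \<and> norm z < t} (t *\<^sub>R z) \<partial>lborel)"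
          using t by (subst nn_integral_lborel_affine[where c = t and t = 0]) simp_all
        also have "(\<lambda>z. indicator {z. sgn z \<in> A \<and> norm z < t} (t *\<^sub>R z)) = (indicator {z. sgn z \<in> A \<and> norm z < 1} :: 'a \<Rightarrow> ennreal)"
          using t by (auto simp: indicator_def sgn_scaleR)
        finally show ?thesis by simp
      qed
      \<comment> \<open>\<open>cone_tail\<close> produces the open truncation and the generator uses
        the closed one; they differ by a subset of a sphere.\<close>
      also have "\<dots> = emeasure lborel ?S"
        by (rule emeasure_eq_AE) (use AE_not_in[OF sphere_null_sets[of 0 t]] in \<open>eventually_elim; auto\<close>, measurable)
      finally show ?thesis .
    qed
    finally show "emeasure lborel ?S = emeasure ?N ?S" ..
  qed (use emeasure_lborel_cball_finite[of "0::'a"] in \<open>auto simp: less_top\<close>)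
  then have L: "lborel = ?N" .
  have "(lborel :: 'a measure) = distr lborel borel ((+) x)" by (rule lborel_distr_plus[symmetric])
  also have "\<dots> = distr ?N borel ((+) x)" using L by simp
  also have "\<dots> = distr (density lborel (\<lambda>z. ennreal ((r / norm z) ^ (2 * ?n)))) borel (\<lambda>z. x + inversion 0 r z)"
    by (subst distr_distr) (simp_all add: o_def)
  also have "density lborel (\<lambda>z. ennreal ((r / norm z) ^ (2 * ?n)))
      = density (distr (lborel :: 'a measure) borel ((+) (- x))) (\<lambda>z. ennreal ((r / norm z) ^ (2 * ?n)))"
    by (simp only: lborel_distr_plus)
  also have "\<dots> = distr (density lborel (\<lambda>z. ennreal ((r / norm (z - x)) ^ (2 * ?n)))) borel ((+) (- x))"
    by (subst density_distr) simp_all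
  also have "distr \<dots> borel (\<lambda>z. x + inversion 0 r z)
      = distr (density lborel (\<lambda>z. ennreal ((r / norm (z - x)) ^ (2 * ?n)))) borel (inversion x r)"
  proof -
    have "(\<lambda>z. x + inversion 0 r (z - x)) = inversion x r"
      by (rule ext) (simp add: inversion_def)
    then show ?thesis by (subst distr_distr) (simp_all add: o_def)
  qed
  finally show ?thesis .
qed

lemma
  fixes f :: "'a::euclidean_space \<Rightarrow> real"
  assumes r: "r > 0" and [measurable]: "f \<in> borel_measurable borel"
  shows integral_inversion:
      "(\<integral>z. (r / norm (z - x)) ^ (2 * DIM('a)) * f (inversion x r z) \<partial>lborel) = (\<integral>z. f z \<partial>lborel)"
    and integrable_inversion_iff:
      "integrable lborel (\<lambda>z. (r / norm (z - x)) ^ (2 * DIM('a)) * f (inversion x r z)) \<longleftrightarrow> integrable lborel f"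
proof -
  let ?D = "density lborel (\<lambda>z. ennreal ((r / norm (z - x)) ^ (2 * DIM('a))))"
  have m: "inversion x r \<in> measurable ?D borel" by simp
  have "(\<integral>z. f z \<partial>lborel) = (\<integral>z. f z \<partial>(distr ?D borel (inversion x r)))"
    using lborel_eq_distr_inversion[OF r, of x] by simp
  also have "\<dots> = (\<integral>z. f (inversion x r z) \<partial>?D)"
    by (rule integral_distr[OF m]) simp
  also have "\<dots> = (\<integral>z. (r / norm (z - x)) ^ (2 * DIM('a)) *\<^sub>R f (inversion x r z) \<partial>lborel)"
    using r by (intro integral_density) auto
  finally show "(\<integral>z. (r / norm (z - x)) ^ (2 * DIM('a)) * f (inversion x r z) \<partial>lborel) = (\<integral>z. f z \<partial>lborel)" by simp
  have "integrable lborel f \<longleftrightarrow> integrable (distr ?D borel (inversion x r)) f"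
    using lborel_eq_distr_inversion[OF r, of x] by simp
  also have "\<dots> \<longleftrightarrow> integrable ?D (\<lambda>z. f (inversion x r z))"
    by (rule integrable_distr_eq[OF m]) simp
  also have "\<dots> \<longleftrightarrow> integrable lborel (\<lambda>z. (r / norm (z - x)) ^ (2 * DIM('a)) *\<^sub>R f (inversion x r z))"
    using r by (intro integrable_density) auto
  finally show "integrable lborel (\<lambda>z. (r / norm (z - x)) ^ (2 * DIM('a)) * f (inversion x r z)) \<longleftrightarrow> integrable lborel f" by simp
qed

section \<open>Principal values\<close>

lemma
  fixes f :: "'a::euclidean_space \<Rightarrow> real"
  assumes [measurable]: "f \<in> borel_measurable borel"
  shows integral_lborel_shift: "(\<integral>z. f (z - y) \<partial>lborel) = (\<integral>z. f z \<partial>lborel)"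
    and integrable_lborel_shift: "integrable lborel (\<lambda>z. f (z - y)) \<longleftrightarrow> integrable lborel f"
    and integral_lborel_reflect: "(\<integral>z. f (- z) \<partial>lborel) = (\<integral>z. f z \<partial>lborel)"
proof -
  have L: "(lborel :: 'a measure) = distr lborel borel (\<lambda>z. - y + z)"
    by (rule lborel_distr_plus[symmetric])
  show "(\<integral>z. f (z - y) \<partial>lborel) = (\<integral>z. f z \<partial>lborel)"
    by (subst (2) L, subst integral_distr) simp_all
  show "integrable lborel (\<lambda>z. f (z - y)) \<longleftrightarrow> integrable lborel f"
    by (subst (2) L, subst integrable_distr_eq) simp_all
  have R: "(lborel :: 'a measure) = distr lborel borel uminus"
    using lborel_affine[of "-1" "0::'a"] by (simp add: density_1)
  show "(\<integral>z. f (- z) \<partial>lborel) = (\<integral>z. f z \<partial>lborel)"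
    by (subst (2) R, subst integral_distr) simp_all
qed

lemma integrable_kernel_far:
  assumes "s > real DIM('a::euclidean_space)" "\<rho> > 0"
  shows "integrable lborel (\<lambda>z::'a. indicator {z. \<rho> \<le> norm (z - y)} z * (1 / norm (y - z) powr s))"
proof -
  have "integrable lborel (\<lambda>z::'a. indicator {z. \<rho> \<le> norm z} z * norm z powr (-s))"
  proof (rule integrableI_nonneg)
    show "(\<integral>\<^sup>+z. ennreal (indicator {z. \<rho> \<le> norm z} z * norm z powr (-s)) \<partial>(lborel :: 'a measure)) < \<infinity>"
      using assms by (rule nn_integral_norm_powr_far)
  qed auto
  then have "integrable lborel (\<lambda>z::'a. indicator {z. \<rho> \<le> norm z} (z - y) * norm (z - y) powr (-s))"
    by (subst integrable_lborel_shift[where f = "\<lambda>z. indicator {z. \<rho> \<le> norm z} z * norm z powr (-s)"]) auto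
  then show ?thesis
    by (simp add: powr_minus_divide norm_minus_commute indicator_def)
qed

lemma integrable_kernel_near:
  assumes "s < real DIM('a::euclidean_space)" "s \<ge> 0" "\<rho> > 0"
  shows "integrable lborel (\<lambda>z::'a. indicator (ball y \<rho>) z * (1 / norm (y - z) powr s))"
proof -
  have [measurable]: "ball (0::'a) \<rho> \<in> sets borel" by simp
  have "integrable lborel (\<lambda>z::'a. indicator (ball 0 \<rho>) z * norm z powr (-s))"
  proof (rule integrableI_nonneg)
    show "(\<integral>\<^sup>+z. ennreal (indicator (ball 0 \<rho>) z * norm z powr (-s)) \<partial>(lborel :: 'a measure)) < \<infinity>"
      using assms by (intro nn_integral_norm_powr_near) auto
  qed auto
  then have "integrable lborel (\<lambda>z::'a. indicator (ball 0 \<rho>) (z - y) * norm (z - y) powr (-s))"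
    by (subst integrable_lborel_shift[where f = "\<lambda>z. indicator (ball 0 \<rho>) z * norm z powr (-s)"]) auto
  then show ?thesis
    by (simp add: powr_minus_divide norm_minus_commute indicator_def dist_norm)
qed

text \<open>Integrability of the weighted function includes its measurability, and multiplying by
  the positive weight recovers \<open>w\<close>.\<close>

lemma L_space_measurable:
  fixes w :: "'a::euclidean_space \<Rightarrow> real"
  assumes "w \<in> L_space \<alpha>"
  shows "w \<in> borel_measurable borel"
proof -
  let ?d = "\<lambda>y::'a. 1 + norm y powr (real DIM('a) + \<alpha>)"
  have [measurable]: "(\<lambda>y. w y / ?d y) \<in> borel_measurable borel"
    using assms borel_measurable_integrable unfolding L_space_def by fastforce
  have "?d y > 0" for y :: 'a
    using powr_ge_zero[of "norm y"] by (simp add: add_pos_nonneg)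
  then have "w = (\<lambda>y. w y / ?d y * ?d y)" by (simp add: less_imp_neq[symmetric])
  moreover have "(\<lambda>y. w y / ?d y * ?d y) \<in> borel_measurable borel" by measurable
  ultimately show ?thesis by simp
qed

lemma integrable_L_space_far:
  fixes w :: "'a::euclidean_space \<Rightarrow> real"
  assumes w: "w \<in> L_space \<alpha>" and "\<alpha> > 0" "\<epsilon> > 0"
  shows "integrable lborel (\<lambda>z. indicator {z. \<epsilon> \<le> norm (z - y)} z * (w z / norm (y - z) powr (real DIM('a) + \<alpha>)))"
proof -
  let ?s = "real DIM('a) + \<alpha>"
  have [measurable]: "w \<in> borel_measurable borel" using w by (rule L_space_measurable)
  \<comment> \<open>\<open>q\<close> is chosen so that both 1 and |z| are at most q |y - z| as soon
    as |z - y| \<ge> \<epsilon>; then the weight 1 + |z|^s is at most 2 (q |y - z|)^s.\<close>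
  define q where "q = max (1 / \<epsilon>) (1 + norm y / \<epsilon>)"
  have q: "q > 0" using assms by (simp add: q_def less_max_iff_disj)
  have "integrable lborel (\<lambda>z. 2 * q powr ?s * (w z / (1 + norm z powr ?s)))"
    using w unfolding L_space_def by (intro integrable_mult_right) auto
  then show ?thesis
  proof (rule Bochner_Integration.integrable_bound)
    show "AE z in lborel. norm (indicator {z. \<epsilon> \<le> norm (z - y)} z * (w z / norm (y - z) powr ?s))
        \<le> norm (2 * q powr ?s * (w z / (1 + norm z powr ?s)))"
    proof (rule AE_I2)
      fix z :: 'a
      show "norm (indicator {z. \<epsilon> \<le> norm (z - y)} z * (w z / norm (y - z) powr ?s))
        \<le> norm (2 * q powr ?s * (w z / (1 + norm z powr ?s)))"
      proof (cases "\<epsilon> \<le> norm (z - y)")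
        case True
        let ?d = "norm (y - z)"
        have d: "\<epsilon> \<le> ?d" "?d > 0" using True assms by (auto simp: norm_minus_commute)
        have "1 \<le> 1 / \<epsilon> * ?d" using d assms by (simp add: field_simps)
        also have "\<dots> \<le> q * ?d" using d by (intro mult_right_mono) (auto simp: q_def)
        finally have 1: "1 \<le> q * ?d" .
        have "norm y * \<epsilon> \<le> norm y * ?d" using d by (intro mult_left_mono) auto
        then have "norm y \<le> norm y / \<epsilon> * ?d" using assms by (simp add: field_simps)
        moreover have "norm z \<le> norm y + ?d" using norm_triangle_ineq4[of y "y - z"] by simp
        ultimately have "norm z \<le> (1 + norm y / \<epsilon>) * ?d" by (simp add: algebra_simps)
        also have "\<dots> \<le> q * ?d" using d by (intro mult_right_mono) (auto simp: q_def)
        finally have 2: "norm z \<le> q * ?d" .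
        have "1 + norm z powr ?s \<le> 2 * (q * ?d) powr ?s"
          using powr_mono2[of ?s 1 "q * ?d"] powr_mono2[of ?s "norm z" "q * ?d"] 1 2 assms by simp
        then have "1 + norm z powr ?s \<le> 2 * q powr ?s * ?d powr ?s"
          using q d by (simp add: powr_mult)
        then have "1 / ?d powr ?s \<le> 2 * q powr ?s / (1 + norm z powr ?s)"
          using d by (simp add: field_simps add_pos_nonneg)
        then have "\<bar>w z\<bar> * (1 / ?d powr ?s) \<le> \<bar>w z\<bar> * (2 * q powr ?s / (1 + norm z powr ?s))"
          by (rule mult_left_mono) simp
        then show ?thesis using True q by (simp add: abs_mult mult_ac abs_of_nonneg)
      qed simp
    qed
  qed auto
qed

lemma integrable_frac_kernel:
  fixes w :: "'a::euclidean_space \<Rightarrow> real"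
  assumes "w \<in> L_space \<alpha>" and "\<alpha> > 0" "\<epsilon> > 0"
  shows "integrable lborel (\<lambda>z. indicator {z. \<epsilon> \<le> norm (z - y)} z * ((c - w z) / norm (y - z) powr (real DIM('a) + \<alpha>)))"
proof -
  have "integrable lborel (\<lambda>z. c * (indicator {z. \<epsilon> \<le> norm (z - y)} z * (1 / norm (y - z) powr (real DIM('a) + \<alpha>)))
      - indicator {z. \<epsilon> \<le> norm (z - y)} z * (w z / norm (y - z) powr (real DIM('a) + \<alpha>)))"
    using assms by (intro Bochner_Integration.integrable_diff integrable_mult_right integrable_kernel_far integrable_L_space_far) auto
  then show ?thesis
    by (rule back_subst[of "integrable lborel"]) (auto simp: fun_eq_iff field_simps diff_divide_distrib)
qed

text \<open>Mean value inequality for \<open>w\<close> minus its linear part at \<open>y\<close>: on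
  the ball of radius |z - y| the derivative of that difference has norm at most L |z - y|.\<close>

lemma taylor_lipschitz_derivative:
  fixes w :: "'a::euclidean_space \<Rightarrow> real" and w' :: "'a \<Rightarrow> 'a \<Rightarrow>\<^sub>L real"
  assumes d: "\<And>z. z \<in> ball y r \<Longrightarrow> (w has_derivative blinfun_apply (w' z)) (at z)"
    and l: "L-lipschitz_on (ball y r) w'" and z: "z \<in> ball y r"
  shows "\<bar>w z - w y - blinfun_apply (w' y) (z - y)\<bar> \<le> L * (norm (z - y))\<^sup>2"
proof -
  let ?S = "cball y (norm (z - y))"
  have S: "v \<in> ball y r" if "v \<in> ?S" for v using that z by (auto simp: dist_norm norm_minus_commute)
  have "norm ((w z - blinfun_apply (w' y) z) - (w y - blinfun_apply (w' y) y)) \<le> (L * norm (z - y)) * norm (z - y)"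
  proof (rule differentiable_bound[where S = ?S and f' = "\<lambda>v. blinfun_apply (w' v - w' y)"])
    fix v assume v: "v \<in> ?S"
    show "((\<lambda>v. w v - blinfun_apply (w' y) v) has_derivative blinfun_apply (w' v - w' y)) (at v within ?S)"
      by (rule has_derivative_at_withinI) (auto intro!: derivative_eq_intros d S v simp: blinfun.diff_left)
    have "onorm (blinfun_apply (w' v - w' y)) = dist (w' v) (w' y)"
      by (simp add: norm_blinfun.rep_eq dist_norm)
    also have "\<dots> \<le> L * dist v y"
      using lipschitz_onD[OF l] S[OF v] z by (auto simp: le_less_trans[OF zero_le_dist])
    also have "\<dots> \<le> L * norm (z - y)"
      using v lipschitz_on_nonneg[OF l] by (intro mult_left_mono) (auto simp: dist_commute)
    finally show "onorm (blinfun_apply (w' v - w' y)) \<le> L * norm (z - y)" .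
  qed (auto simp: dist_norm norm_minus_commute)
  then show ?thesis by (simp add: blinfun.diff_right power2_eq_square algebra_simps)
qed

text \<open>Near \<open>y\<close> the linear part of \<open>w\<close> is added to the numerator.
  This changes no integral over a centred annulus, and the new integrand \<open>G\<close> is bounded
  by L |y - z|^(2-s), which is integrable near \<open>y\<close> because \<alpha> < 2. The limit then
  follows by dominated convergence.\<close>

lemma frac_pv_exists:
  fixes w :: "'a::euclidean_space \<Rightarrow> real" and w' :: "'a \<Rightarrow> 'a \<Rightarrow>\<^sub>L real"
  assumes n: "DIM('a) \<ge> 2" and \<alpha>: "0 < \<alpha>" "\<alpha> < 2" and w: "w \<in> L_space \<alpha>" and r: "r > 0"
    and d: "\<And>z. z \<in> ball y r \<Longrightarrow> (w has_derivative blinfun_apply (w' z)) (at z)"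
    and l: "L-lipschitz_on (ball y r) w'"
  shows "\<exists>l. ((\<lambda>\<epsilon>. LINT z:{z. norm (z - y) \<ge> \<epsilon>}|lborel. (w y - w z) / norm (y - z) powr (real DIM('a) + \<alpha>)) \<longlongrightarrow> l) (at_right 0)"
proof -
  let ?s = "real DIM('a) + \<alpha>"
  have [measurable]: "w \<in> borel_measurable borel" using w by (rule L_space_measurable)
  have [measurable]: "blinfun_apply (w' y) \<in> borel_measurable borel"
    by (intro borel_measurable_continuous_onI continuous_intros)
  have L0: "L \<ge> 0" using l by (rule lipschitz_on_nonneg)
  define F where "F = (\<lambda>z. (w y - w z) / norm (y - z) powr ?s)"
  define G where "G = (\<lambda>z. (w y - w z + blinfun_apply (w' y) (z - y)) / norm (y - z) powr ?s)"
  define H where "H = (\<lambda>z. blinfun_apply (w' y) (z - y) / norm (y - z) powr ?s)"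
  have [measurable]: "F \<in> borel_measurable borel" "G \<in> borel_measurable borel" "H \<in> borel_measurable borel"
    unfolding F_def G_def H_def by measurable
  have bnd: "integrable lborel (\<lambda>z. L * (indicator (ball y r) z * (1 / norm (y - z) powr (?s - 2))))"
    using n \<alpha> r by (intro integrable_mult_right integrable_kernel_near) auto
  have Gb: "norm (indicator (ball y r) z * G z) \<le> L * (indicator (ball y r) z * (1 / norm (y - z) powr (?s - 2)))" for z
  proof (cases "z \<in> ball y r \<and> z \<noteq> y")
    case True
    then have p: "norm (y - z) > 0" by auto
    have "\<bar>w y - w z + blinfun_apply (w' y) (z - y)\<bar> \<le> L * (norm (y - z))\<^sup>2"
      using taylor_lipschitz_derivative[OF d l, of z] True unfolding norm_minus_commute[of z y] by (simp; linarith)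
    then have "\<bar>G z\<bar> \<le> L * (norm (y - z))\<^sup>2 / norm (y - z) powr ?s"
      unfolding G_def using p by (simp add: divide_right_mono)
    also have "\<dots> = L * (1 / norm (y - z) powr (?s - 2))"
      using p by (simp add: powr_diff powr_realpow)
    finally show ?thesis using True by simp
  qed (auto simp: G_def)
  have [measurable]: "ball y r \<in> sets borel" by simp
  have Gi: "integrable lborel (\<lambda>z. indicator (ball y r) z * G z)"
  proof (rule Bochner_Integration.integrable_bound[OF bnd])
    show "(\<lambda>z. indicator (ball y r) z * G z) \<in> borel_measurable lborel" by measurable
    show "AE z in lborel. norm (indicator (ball y r) z * G z)
        \<le> norm (L * (indicator (ball y r) z * (1 / norm (y - z) powr (?s - 2))))"
      by (rule AE_I2, rule order_trans[OF Gb]) (simp only: real_norm_def abs_ge_self)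
  qed
  have Gint: "integrable lborel (\<lambda>z. indicator {z. \<epsilon> \<le> norm (z - y) \<and> norm (z - y) < r} z * G z)" for \<epsilon>
    using Gi by (rule Bochner_Integration.integrable_bound) (auto simp: indicator_def dist_norm norm_minus_commute)
  have Fint: "integrable lborel (\<lambda>z. indicator {z. \<epsilon> \<le> norm (z - y)} z * F z)" if "\<epsilon> > 0" for \<epsilon>
    unfolding F_def using w \<alpha>(1) that by (rule integrable_frac_kernel)
  have Fint2: "integrable lborel (\<lambda>z. indicator {z. \<epsilon> \<le> norm (z - y) \<and> norm (z - y) < r} z * F z)" if "\<epsilon> > 0" for \<epsilon>
    using Fint[OF that] by (rule Bochner_Integration.integrable_bound) (auto simp: indicator_def)
  \<comment> \<open>The linear part is odd about \<open>y\<close> and the annulus is symmetric, so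
    the integral equals its own negative.\<close>
  have H0: "(\<integral>z. indicator {z. \<epsilon> \<le> norm (z - y) \<and> norm (z - y) < r} z * H z \<partial>lborel) = 0" for \<epsilon>
  proof -
    let ?h = "\<lambda>h::'a. indicator {h. \<epsilon> \<le> norm h \<and> norm h < r} h * (blinfun_apply (w' y) h / norm h powr ?s)"
    have "(\<integral>z. indicator {z. \<epsilon> \<le> norm (z - y) \<and> norm (z - y) < r} z * H z \<partial>lborel) = (\<integral>z. ?h (z - y) \<partial>lborel)"
      by (rule Bochner_Integration.integral_cong) (auto simp: H_def indicator_def norm_minus_commute)
    also have "\<dots> = (\<integral>h. ?h h \<partial>lborel)" by (rule integral_lborel_shift) measurable
    finally have 1: "(\<integral>z. indicator {z. \<epsilon> \<le> norm (z - y) \<and> norm (z - y) < r} z * H z \<partial>lborel) = (\<integral>h. ?h h \<partial>lborel)" .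
    have "(\<integral>h. ?h h \<partial>lborel) = (\<integral>h. ?h (- h) \<partial>lborel)"
      by (rule integral_lborel_reflect[symmetric]) measurable
    also have "\<dots> = (\<integral>h. - ?h h \<partial>lborel)"
      by (rule Bochner_Integration.integral_cong) (auto simp: indicator_def blinfun.minus_right)
    also have "\<dots> = - (\<integral>h. ?h h \<partial>lborel)" by simp
    finally show ?thesis using 1 by simp
  qed
  define c where "c = (\<integral>z. indicator {z. r \<le> norm (z - y)} z * F z \<partial>lborel)"
  have split: "(LINT z:{z. norm (z - y) \<ge> \<epsilon>}|lborel. F z) = c + (\<integral>z. indicator {z. \<epsilon> \<le> norm (z - y) \<and> norm (z - y) < r} z * G z \<partial>lborel)"
    if e: "0 < \<epsilon>" "\<epsilon> < r" for \<epsilon>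
  proof -
    let ?A = "{z. \<epsilon> \<le> norm (z - y) \<and> norm (z - y) < r}"
    have Hi: "integrable lborel (\<lambda>z. indicator ?A z * G z - indicator ?A z * F z)"
      using Gint Fint2 e by (intro Bochner_Integration.integrable_diff) auto
    have GF: "indicator ?A z * G z - indicator ?A z * F z = indicator ?A z * H z" for z
      unfolding G_def F_def H_def by (simp add: indicator_def diff_divide_distrib add_divide_distrib)
    have "(\<integral>z. indicator ?A z * G z \<partial>lborel) - (\<integral>z. indicator ?A z * F z \<partial>lborel) = (\<integral>z. indicator ?A z * H z \<partial>lborel)"
      using Gint Fint2 e by (subst Bochner_Integration.integral_diff[symmetric]) (auto simp: GF)
    then have GF': "(\<integral>z. indicator ?A z * F z \<partial>lborel) = (\<integral>z. indicator ?A z * G z \<partial>lborel)" by (simp add: H0)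
    have "(LINT z:{z. norm (z - y) \<ge> \<epsilon>}|lborel. F z)
        = (\<integral>z. indicator {z. r \<le> norm (z - y)} z * F z + indicator ?A z * F z \<partial>lborel)"
      unfolding set_lebesgue_integral_def
      using e by (intro Bochner_Integration.integral_cong) (auto simp: indicator_def)
    also have "\<dots> = c + (\<integral>z. indicator ?A z * F z \<partial>lborel)"
      unfolding c_def using Fint[OF r] Fint2 e by (intro Bochner_Integration.integral_add) auto
    finally show ?thesis unfolding GF' .
  qed
  \<comment> \<open>The variable t stands for 1/\<epsilon>, so that the limit at 0 from the right
    becomes a limit at infinity.\<close>
  have lim: "((\<lambda>t. \<integral>z. indicator {z. inverse t \<le> norm (z - y) \<and> norm (z - y) < r} z * G z \<partial>lborel) \<longlongrightarrow> (\<integral>z. indicator (ball y r) z * G z \<partial>lborel)) at_top"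
  proof (rule integral_dominated_convergence_at_top)
    show "integrable lborel (\<lambda>z. norm (indicator (ball y r) z * G z))"
      using Gi by (rule integrable_norm)
    show "\<forall>\<^sub>F t in at_top. AE z in lborel. norm (indicator {z. inverse t \<le> norm (z - y) \<and> norm (z - y) < r} z * G z) \<le> norm (indicator (ball y r) z * G z)"
      by (intro always_eventually allI AE_I2) (auto simp: indicator_def dist_norm norm_minus_commute)
    show "AE z in lborel. ((\<lambda>t. indicator {z. inverse t \<le> norm (z - y) \<and> norm (z - y) < r} z * G z) \<longlongrightarrow> indicator (ball y r) z * G z) at_top"
    proof (rule AE_I2)
      fix z
      show "((\<lambda>t. indicator {z. inverse t \<le> norm (z - y) \<and> norm (z - y) < r} z * G z) \<longlongrightarrow> indicator (ball y r) z * G z) at_top"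
      proof (cases "z = y")
        case True
        then show ?thesis by (simp add: G_def)
      next
        case False
        then have p: "norm (z - y) > 0" by simp
        have "eventually (\<lambda>t::real. t \<ge> inverse (norm (z - y))) at_top" by (rule eventually_ge_at_top)
        then have "eventually (\<lambda>t. indicator {z. inverse t \<le> norm (z - y) \<and> norm (z - y) < r} z * G z = indicator (ball y r) z * G z) at_top"
        proof eventually_elim
          case (elim t)
          have "inverse t \<le> norm (z - y)"
            using le_imp_inverse_le[OF elim] p by simp
          then show ?case by (auto simp: indicator_def dist_norm norm_minus_commute)
        qed
        then show ?thesis by (rule tendsto_eventually)
      qed
    qed
  qed measurable
  have "((\<lambda>\<epsilon>. c + (\<integral>z. indicator {z. \<epsilon> \<le> norm (z - y) \<and> norm (z - y) < r} z * G z \<partial>lborel)) \<longlongrightarrow> c + (\<integral>z. indicator (ball y r) z * G z \<partial>lborel)) (at_right 0)"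
    unfolding filterlim_at_right_to_top by (intro tendsto_intros lim)
  moreover have "eventually (\<lambda>\<epsilon>. \<epsilon> \<in> {0<..<r}) (at_right 0)"
    using r by (rule eventually_at_right_real)
  then have "eventually (\<lambda>\<epsilon>. c + (\<integral>z. indicator {z. \<epsilon> \<le> norm (z - y) \<and> norm (z - y) < r} z * G z \<partial>lborel)
      = (LINT z:{z. norm (z - y) \<ge> \<epsilon>}|lborel. F z)) (at_right 0)"
    by eventually_elim (simp add: split)
  ultimately have "((\<lambda>\<epsilon>. LINT z:{z. norm (z - y) \<ge> \<epsilon>}|lborel. F z) \<longlongrightarrow> c + (\<integral>z. indicator (ball y r) z * G z \<partial>lborel)) (at_right 0)"
    by (rule Lim_transform_eventually)
  then show ?thesis unfolding F_def by blast
qed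

text \<open>Integrability has to come first, because a divergent integral would make the constant 0.
  It follows from 1 - cos(2s) = 2 sin(s)^2 \<le> 2 s^2 near the origin and from 1 - cos \<le> 2
  elsewhere. The integrand is nonnegative, so the integral could vanish only if the integrand were 0
  almost everywhere.\<close>

lemma frac_lap_const_pos:
  assumes n: "DIM('a::euclidean_space) \<ge> 2" and \<alpha>: "0 < \<alpha>" "\<alpha> < 2"
  shows "frac_lap_const TYPE('a) \<alpha> > 0"
proof -
  let ?s = "real DIM('a) + \<alpha>"
  define b :: 'a where "b = (SOME b. b \<in> Basis)"
  have b: "b \<in> Basis" unfolding b_def by (rule someI_ex) (use nonempty_Basis in blast)
  define f where "f = (\<lambda>z::'a. (1 - cos (2 * pi * (z \<bullet> b))) / norm z powr ?s)"
  have [measurable]: "f \<in> borel_measurable borel" unfolding f_def by measurable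
  have f0: "f z \<ge> 0" for z unfolding f_def by (simp add: divide_nonneg_nonneg)
  have "integrable lborel (\<lambda>z::'a. (2 * pi\<^sup>2) * (indicator (ball 0 1) z * (1 / norm (0 - z) powr (?s - 2)))
     + 2 * (indicator {z. 1 \<le> norm (z - 0)} z * (1 / norm (0 - z) powr ?s)))"
    using n \<alpha> by (intro Bochner_Integration.integrable_add integrable_mult_right integrable_kernel_near integrable_kernel_far) auto
  then have fi: "integrable lborel f"
  proof (rule Bochner_Integration.integrable_bound)
    show "AE z in lborel. norm (f z) \<le> norm ((2 * pi\<^sup>2) * (indicator (ball 0 1) z * (1 / norm (0 - z) powr (?s - 2)))
     + 2 * (indicator {z. 1 \<le> norm (z - 0)} z * (1 / norm (0 - z) powr ?s)))"
    proof (rule AE_I2)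
      fix z :: 'a
      show "norm (f z) \<le> norm ((2 * pi\<^sup>2) * (indicator (ball 0 1) z * (1 / norm (0 - z) powr (?s - 2)))
        + 2 * (indicator {z. 1 \<le> norm (z - 0)} z * (1 / norm (0 - z) powr ?s)))"
      proof (cases "norm z < 1")
        case True
        show ?thesis
        proof (cases "z = 0")
          case False
          then have p: "norm z > 0" by simp
          have "1 - cos (2 * pi * (z \<bullet> b)) = 2 * (sin (pi * (z \<bullet> b)))\<^sup>2"
            using cos_double_sin[of "pi * (z \<bullet> b)"] by (simp add: mult_ac)
          also have "(sin (pi * (z \<bullet> b)))\<^sup>2 \<le> (pi * norm z)\<^sup>2"
          proof (rule power2_le_iff_abs_le[THEN iffD2])
            have "\<bar>sin (pi * (z \<bullet> b))\<bar> \<le> \<bar>pi * (z \<bullet> b)\<bar>" by (rule abs_sin_x_le_abs_x)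
            also have "\<dots> \<le> pi * norm z" using Basis_le_norm[OF b, of z] by (simp add: abs_mult)
            finally show "\<bar>sin (pi * (z \<bullet> b))\<bar> \<le> pi * norm z" .
          qed simp
          finally have "f z \<le> 2 * (pi * norm z)\<^sup>2 / norm z powr ?s"
            unfolding f_def by (simp add: divide_right_mono)
          also have "\<dots> = 2 * pi\<^sup>2 * (1 / norm z powr (?s - 2))"
            using p by (simp add: powr_diff powr_realpow power_mult_distrib)
          finally show ?thesis using True f0[of z] by (simp add: abs_of_nonneg)
        qed (simp add: f_def)
      next
        case False
        have "1 - cos (2 * pi * (z \<bullet> b)) \<le> 2" using cos_ge_minus_one[of "2 * pi * (z \<bullet> b)"] by linarith
        then have "f z \<le> 2 / norm z powr ?s" unfolding f_def by (simp add: divide_right_mono)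
        then show ?thesis using False f0[of z] by simp
      qed
    qed
  qed measurable
  have "(\<integral>z. f z \<partial>lborel) \<noteq> 0"
  proof
    assume "(\<integral>z. f z \<partial>lborel) = 0"
    then have "AE z in lborel. f z = 0"
      using integral_nonneg_eq_0_iff_AE[OF fi] f0 by simp
    \<comment> \<open>On this ball the coordinate z \<bullet> b lies strictly between 1/4 and 3/4,
      so the cosine stays below 1 and the integrand is positive.\<close>
    then have "AE z in lborel. z \<notin> ball ((1/2) *\<^sub>R b) (1/4)"
    proof eventually_elim
      case (elim z)
      show ?case
      proof
        assume z: "z \<in> ball ((1/2) *\<^sub>R b) (1/4)"
        have "\<bar>(z - (1/2) *\<^sub>R b) \<bullet> b\<bar> \<le> norm (z - (1/2) *\<^sub>R b)" by (rule Basis_le_norm[OF b])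
        also have "\<dots> < 1/4" using z by (simp add: dist_norm norm_minus_commute)
        finally have t: "\<bar>z \<bullet> b - 1/2\<bar> < 1/4" using b by (simp add: inner_diff_left)
        then have "z \<noteq> 0" by auto
        have "cos (2 * pi * (z \<bullet> b)) < 1"
        proof -
          have "sin (pi * (z \<bullet> b)) > 0"
            using t by (intro sin_gt_zero) (auto simp: abs_if split: if_splits)
          then have "2 * (sin (pi * (z \<bullet> b)))\<^sup>2 > 0" by simp
          then show ?thesis using cos_double_sin[of "pi * (z \<bullet> b)"] by (simp add: mult_ac)
        qed
        then have "f z > 0" unfolding f_def using \<open>z \<noteq> 0\<close> by simp
        then show False using elim by simp
      qed
    qed
    then have "emeasure lborel (ball ((1/2) *\<^sub>R b) (1/4)) = 0"
      by (subst (asm) AE_iff_measurable[where N = "ball ((1/2) *\<^sub>R b) (1/4)"]) auto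
    then have "measure lborel (ball ((1/2) *\<^sub>R b) (1/4)) = 0" by (simp add: measure_def)
    then show False by simp
  qed
  moreover have "(\<integral>z. f z \<partial>lborel) \<ge> 0" using f0 by (intro Bochner_Integration.integral_nonneg) auto
  ultimately have "(\<integral>z. f z \<partial>lborel) > 0" by linarith
  then show ?thesis unfolding frac_lap_const_def f_def b_def by simp
qed

lemma frac_lap_eq_limit:
  assumes "\<alpha> < 2"
    and "((\<lambda>\<epsilon>. LINT z:{z. norm (z - y) \<ge> \<epsilon>}|lborel. (w y - w z) / norm (y - z) powr (real DIM('a::euclidean_space) + \<alpha>)) \<longlongrightarrow> l) (at_right 0)"
  shows "frac_lap \<alpha> w (y::'a) = frac_lap_const TYPE('a) \<alpha> * l"
  using assms unfolding frac_lap_def by (simp add: tendsto_Lim)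

section \<open>Lower bounds at infinity and small spheres\<close>

lemma kelvin_inversion:
  assumes "r > 0" "z \<noteq> x"
  shows "kelvin \<alpha> u x r (inversion x r z) = (norm (z - x) / r) powr (real DIM('a::euclidean_space) - \<alpha>) * u (z::'a)"
proof -
  have "r / norm (inversion x r z - x) = norm (z - x) / r"
    using assms by (simp add: norm_inversion power2_eq_square)
  then show ?thesis using assms by (simp add: kelvin_def inversion_inversion)
qed

text \<open>The Kelvin transform is an involution that exchanges \<open>kelvin\<close> and
  \<open>u\<close> up to a conformal factor. So the values of \<omega> outside the ball are
  determined, with opposite sign, by those inside.\<close>

lemma omega_inversion:
  assumes "r > 0" "z \<noteq> x"
  shows "omega \<alpha> u x r (inversion x r z) = - ((norm (z - x) / r) powr (real DIM('a::euclidean_space) - \<alpha>) * omega \<alpha> u x r (z::'a))"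
proof -
  have "(norm (z - x) / r) powr (real DIM('a) - \<alpha>) * (r / norm (z - x)) powr (real DIM('a) - \<alpha>) = 1"
    using assms by (subst powr_mult[symmetric]) simp_all
  then have "(norm (z - x) / r) powr (real DIM('a) - \<alpha>) * kelvin \<alpha> u x r z = u (inversion x r z)"
    unfolding kelvin_def by (simp add: mult.assoc[symmetric])
  then show ?thesis using assms unfolding omega_def by (simp add: kelvin_inversion right_diff_distrib)
qed

lemma const_in_L_space: "\<alpha> > 0 \<Longrightarrow> (\<lambda>z::'a::euclidean_space. c) \<in> L_space \<alpha>"
proof -
  assume \<alpha>: "\<alpha> > 0"
  let ?s = "real DIM('a) + \<alpha>"
  have "integrable lborel (\<lambda>z::'a. indicator (ball 0 1) z * 1 + indicator {z. 1 \<le> norm (z - 0)} z * (1 / norm (0 - z) powr ?s))"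
  proof (intro Bochner_Integration.integrable_add integrable_kernel_far)
    have "emeasure lborel (ball (0::'a) 1) < \<infinity>" by (rule emeasure_lborel_ball_finite)
    then show "integrable lborel (\<lambda>z::'a. indicator (ball 0 1) z * (1::real))" by simp
  qed (use \<alpha> in auto)
  then have "integrable lborel (\<lambda>z::'a. 1 / (1 + norm z powr ?s))"
  proof (rule Bochner_Integration.integrable_bound)
    show "AE z in lborel. norm (1 / (1 + norm z powr ?s)) \<le> norm (indicator (ball 0 1) z * 1 + indicator {z. 1 \<le> norm (z - 0)} z * (1 / norm (0 - z :: 'a) powr ?s))"
    proof (rule AE_I2)
      fix z :: 'a
      have p: "0 \<le> norm z powr ?s" by simp
      define Q where "Q = 1 / (1 + norm z powr ?s)"
      have "Q \<ge> 0" "Q \<le> 1" unfolding Q_def using p by (simp_all add: field_simps add_pos_nonneg)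
      moreover have "Q \<le> 1 / norm z powr ?s" if "1 \<le> norm z"
        unfolding Q_def using that by (intro divide_left_mono) (auto intro!: mult_pos_pos add_pos_nonneg)
      ultimately show "norm (1 / (1 + norm z powr ?s)) \<le> norm (indicator (ball 0 1) z * 1 + indicator {z. 1 \<le> norm (z - 0)} z * (1 / norm (0 - z :: 'a) powr ?s))"
        unfolding Q_def[symmetric] by (auto simp: indicator_def)
    qed
  qed measurable
  then have "integrable lborel (\<lambda>z::'a. c * (1 / (1 + norm z powr ?s)))" by (rule integrable_mult_right)
  then show ?thesis unfolding L_space_def by simp
qed

lemma integrable_power_near:
  fixes x :: "'a::euclidean_space"
  assumes "0 \<le> p" "p < real DIM('a)" "\<rho> > 0"
  shows "integrable lborel (\<lambda>z. indicator (ball x \<rho>) z * norm (z - x) powr (- p))"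
  using integrable_kernel_near[of p \<rho> x] assms by (simp add: powr_minus_divide norm_minus_commute)

lemma power_in_L_space:
  fixes x :: "'a::euclidean_space"
  assumes "\<alpha> > 0" "0 < p" "p < real DIM('a)"
  shows "(\<lambda>z. norm (z - x) powr (- p)) \<in> L_space \<alpha>"
proof -
  let ?s = "real DIM('a) + \<alpha>"
  have "integrable lborel (\<lambda>z. indicator (ball x 1) z * norm (z - x) powr (- p) + 1 / (1 + norm z powr ?s))"
    using assms const_in_L_space[of \<alpha> 1, where 'a = 'a] unfolding L_space_def
    by (intro Bochner_Integration.integrable_add integrable_power_near) auto
  then have "integrable lborel (\<lambda>z. norm (z - x) powr (- p) / (1 + norm z powr ?s))"
  proof (rule Bochner_Integration.integrable_bound)
    show "AE z in lborel. norm (norm (z - x) powr (- p) / (1 + norm z powr ?s))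
        \<le> norm (indicator (ball x 1) z * norm (z - x) powr (- p) + 1 / (1 + norm z powr ?s))"
    proof (rule AE_I2)
      fix z :: 'a
      have p: "0 \<le> norm z powr ?s" by simp
      show "norm (norm (z - x) powr (- p) / (1 + norm z powr ?s))
        \<le> norm (indicator (ball x 1) z * norm (z - x) powr (- p) + 1 / (1 + norm z powr ?s))"
      proof (cases "norm (z - x) < 1")
        case True
        have "norm (z - x) powr (- p) / (1 + norm z powr ?s) \<le> norm (z - x) powr (- p) / 1"
          using p by (intro divide_left_mono) (auto intro: add_pos_nonneg)
        moreover have "0 \<le> 1 / (1 + norm z powr ?s)" using p by (intro divide_nonneg_nonneg) auto
        ultimately have "norm (z - x) powr (- p) / (1 + norm z powr ?s) \<le> norm (z - x) powr (- p) + 1 / (1 + norm z powr ?s)"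
          by linarith
        then show ?thesis using True p
          by (simp add: dist_norm norm_minus_commute abs_of_nonneg)
      next
        case False
        have "norm (z - x) powr (- p) \<le> 1" using powr_mono2'[of "- p" 1 "norm (z - x)"] False assms by simp
        then have "norm (z - x) powr (- p) / (1 + norm z powr ?s) \<le> 1 / (1 + norm z powr ?s)"
          using p by (intro divide_right_mono) auto
        then show ?thesis using False p by (simp add: dist_norm norm_minus_commute abs_of_nonneg)
      qed
    qed
  qed measurable
  then show ?thesis unfolding L_space_def by simp
qed

lemma powr_minus_lipschitz:
  fixes p r s :: real
  assumes "p > 0" "r > 0" "r / 2 \<le> s"
  shows "\<bar>r powr (- p) - s powr (- p)\<bar> \<le> p * (r / 2) powr (- p - 1) * \<bar>r - s\<bar>"
proof -
  have "norm (r powr (- p) - s powr (- p)) \<le> (p * (r / 2) powr (- p - 1)) * norm (r - s)"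
  proof (rule field_differentiable_bound[where S = "{r/2..}" and f' = "\<lambda>t. (- p) * t powr (- p - 1)"])
    fix t assume t: "t \<in> {r/2..}"
    then have t0: "t > 0" using assms by auto
    show "((\<lambda>t. t powr (- p)) has_field_derivative (- p) * t powr (- p - 1)) (at t within {r/2..})"
      using t0 by (intro DERIV_subset[OF has_real_derivative_powr]) auto
    have "t powr (- p - 1) \<le> (r / 2) powr (- p - 1)"
      using t assms by (intro powr_mono2') auto
    then show "norm ((- p) * t powr (- p - 1)) \<le> p * (r / 2) powr (- p - 1)"
      using assms by (simp add: abs_mult)
  qed (use assms in auto)
  then show ?thesis by simp
qed

text \<open>The integrand below is antisymmetric under inversion in the sphere about \<open>x\<close> through \<open>y\<close>, so
  the principal value would vanish identically if the excised ball were invariant under that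
  inversion; it is invariant up to a shell of volume $O(\epsilon^{n+1})$.\<close>

lemma riesz_kernel_pv:
  fixes x y :: "'a::euclidean_space"
  assumes \<alpha>: "0 < \<alpha>" "\<alpha> < 2" "\<alpha> < real DIM('a)" and y: "y \<noteq> x"
  defines "\<Phi> \<equiv> \<lambda>z. norm (z - x) powr (\<alpha> - real DIM('a))"
  shows "((\<lambda>\<epsilon>. LINT z:{z. norm (z - y) \<ge> \<epsilon>}|lborel. (\<Phi> y - \<Phi> z) / norm (y - z) powr (real DIM('a) + \<alpha>)) \<longlongrightarrow> 0) (at_right 0)"
proof -
  let ?n = "DIM('a)"
  let ?s = "real ?n + \<alpha>"
  define p where "p = real ?n - \<alpha>"
  have p: "0 < p" "p < real ?n" using \<alpha> by (auto simp: p_def)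
  have \<Phi>: "\<Phi> = (\<lambda>z. norm (z - x) powr (- p))" by (simp add: \<Phi>_def p_def)
  define r where "r = norm (y - x)"
  have r: "r > 0" using y by (simp add: r_def)
  define F where "F = (\<lambda>z. (\<Phi> y - \<Phi> z) / norm (y - z) powr ?s)"
  define M where "M = (\<lambda>\<epsilon>. {z. \<epsilon> \<le> norm (z - y)})"
  define M' where "M' = (\<lambda>\<epsilon>. {z. \<epsilon> \<le> norm (inversion x r z - y)})"
  have [measurable]: "F \<in> borel_measurable borel" "M \<epsilon> \<in> sets borel" "M' \<epsilon> \<in> sets borel" for \<epsilon>
    unfolding F_def M_def M'_def \<Phi>_def by measurable
  \<comment> \<open>With s = n + \<alpha> and p = n - \<alpha> the Jacobian exponent 2n splits as s
    + p: one part cancels the factor produced by the kernel, the other the factor produced by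
    \<Phi>.\<close>
  have anti: "(r / norm (z - x)) ^ (2 * ?n) * F (inversion x r z) = - F z" if z: "z \<noteq> x" for z
  proof -
    define t where "t = norm (z - x)"
    have t: "t > 0" using z by (simp add: t_def)
    have 1: "\<Phi> (inversion x r z) = r powr (- 2 * p) * t powr p"
    proof -
      have "r\<^sup>2 = r powr 2" using r by simp
      then show ?thesis
        unfolding \<Phi> norm_inversion t_def[symmetric] using r t
        by (simp only: powr_divide powr_powr) (simp add: powr_minus_divide)
    qed
    have tp: "t powr p * t powr (- p) = 1" using t by (simp add: powr_add[symmetric])
    have rp: "r powr (- 2 * p) = r powr (- p) * r powr (- p)" using r by (simp add: powr_add[symmetric])
    have rp1: "r powr p * r powr (- p) = 1" using r by (simp add: powr_add[symmetric])
    have "\<Phi> y - \<Phi> (inversion x r z) = - ((t / r) powr p * (\<Phi> y - \<Phi> z))"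
    proof -
      have "(t / r) powr p = t powr p * r powr (- p)" using r t by (simp add: powr_divide powr_minus_divide)
      then have "(t / r) powr p * (\<Phi> y - \<Phi> z) = t powr p * (r powr (- p) * r powr (- p)) - (t powr p * t powr (- p)) * r powr (- p)"
        unfolding \<Phi> r_def[symmetric] t_def[symmetric] by (simp add: algebra_simps)
      then show ?thesis unfolding 1 unfolding \<Phi> r_def[symmetric] t_def[symmetric] tp rp by simp
    qed
    moreover have "norm (y - inversion x r z) powr ?s = (r / t) powr ?s * norm (y - z) powr ?s"
    proof -
      have "norm (y - inversion x r z) = (r / t) * norm (y - z)"
        using dist_inversion_sphere[OF r _ z, of y] by (simp add: r_def t_def)
      then show ?thesis using r t by (simp only:) (subst powr_mult, auto)
    qed
    moreover have "(r / t) ^ (2 * ?n) = (r / t) powr ?s * (r / t) powr p"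
      using r t by (simp add: powr_add[symmetric] p_def powr_realpow[symmetric])
    moreover have "X * Y * (- (Z * D) / (X * N)) = - ((Y * Z) * (D / N))" if "X > 0" for X Y Z D N :: real
      using that by (cases "N = 0") (simp_all add: field_simps)
    moreover have "(r / t) powr ?s > 0" using r t by simp
    ultimately have "(r / t) ^ (2 * ?n) * F (inversion x r z) = - (((r / t) powr p * (t / r) powr p) * F z)"
      unfolding F_def by (simp only:)
    also have "(r / t) powr p * (t / r) powr p = 1"
      using r t by (subst powr_mult[symmetric]) simp_all
    finally show ?thesis by (simp add: t_def)
  qed
  have \<Phi>L: "\<Phi> \<in> L_space \<alpha>" unfolding \<Phi> using \<alpha> p by (intro power_in_L_space) auto
  have MF: "integrable lborel (\<lambda>z. indicator (M \<epsilon>) z * F z)" if "\<epsilon> > 0" for \<epsilon>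
    unfolding F_def M_def using \<Phi>L \<alpha>(1) that by (rule integrable_frac_kernel)
  define J where "J = (\<lambda>\<epsilon>. \<integral>z. indicator (M \<epsilon>) z * F z \<partial>lborel)"
  have eqz: "AE z in lborel. (r / norm (z - x)) ^ (2 * ?n) * (indicator (M \<epsilon>) (inversion x r z) * F (inversion x r z)) = - (indicator (M' \<epsilon>) z * F z)" for \<epsilon>
  proof (rule AE_mp[OF AE_lborel_singleton[of x]], rule AE_I2, rule impI)
    fix z assume z: "z \<noteq> x"
    have "indicator (M \<epsilon>) (inversion x r z) = (indicator (M' \<epsilon>) z :: real)"
      by (simp add: M_def M'_def indicator_def)
    then show "(r / norm (z - x)) ^ (2 * ?n) * (indicator (M \<epsilon>) (inversion x r z) * F (inversion x r z)) = - (indicator (M' \<epsilon>) z * F z)"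
      using anti[OF z] by (simp add: mult.left_commute)
  qed
  \<comment> \<open>By antisymmetry the integral over the reflected set \<open>M' \<epsilon>\<close>
    is - \<open>J \<epsilon>\<close>. Hence 2 \<open>J \<epsilon>\<close> lives on the symmetric
    difference of \<open>M \<epsilon>\<close> and \<open>M' \<epsilon>\<close>.\<close>
  have M'F: "integrable lborel (\<lambda>z. indicator (M' \<epsilon>) z * F z)" "J \<epsilon> = - (\<integral>z. indicator (M' \<epsilon>) z * F z \<partial>lborel)" if "\<epsilon> > 0" for \<epsilon>
  proof -
    have mf: "(\<lambda>z. indicator (M \<epsilon>) z * F z) \<in> borel_measurable borel" by measurable
    have "integrable lborel (\<lambda>z. (r / norm (z - x)) ^ (2 * ?n) * (indicator (M \<epsilon>) (inversion x r z) * F (inversion x r z)))"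
      using integrable_inversion_iff[OF r mf, of x] MF[OF that] by simp
    then have "integrable lborel (\<lambda>z. - (indicator (M' \<epsilon>) z * F z))"
      by (subst (asm) integrable_cong_AE[OF _ _ eqz]) auto
    from Bochner_Integration.integrable_minus[OF this]
    show "integrable lborel (\<lambda>z. indicator (M' \<epsilon>) z * F z)" by simp
    have "J \<epsilon> = (\<integral>z. (r / norm (z - x)) ^ (2 * ?n) * (indicator (M \<epsilon>) (inversion x r z) * F (inversion x r z)) \<partial>lborel)"
      unfolding J_def by (rule integral_inversion[OF r mf, symmetric])
    also have "\<dots> = (\<integral>z. - (indicator (M' \<epsilon>) z * F z) \<partial>lborel)"
      by (rule integral_cong_AE[OF _ _ eqz]) auto
    finally show "J \<epsilon> = - (\<integral>z. indicator (M' \<epsilon>) z * F z \<partial>lborel)" by simp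
  qed
  define B where "B = p * (r / 2) powr (- p - 1)"
  have B: "B \<ge> 0" unfolding B_def using p by simp
  have n1: "1 - ?s \<le> 0" using DIM_ge_Suc0[where 'a = 'a] \<alpha>(1) by linarith
  have Fb: "\<bar>F z\<bar> \<le> B * (\<epsilon> / 2) powr (1 - ?s)" if "0 < \<epsilon>" "\<epsilon> / 2 \<le> norm (z - y)" "r / 2 \<le> norm (z - x)" for \<epsilon> z
  proof -
    let ?d = "norm (y - z)"
    have d: "\<epsilon> / 2 \<le> ?d" "?d > 0" using that by (auto simp: norm_minus_commute)
    have "\<bar>\<Phi> y - \<Phi> z\<bar> \<le> B * \<bar>r - norm (z - x)\<bar>"
      unfolding \<Phi> r_def[symmetric] B_def using p r that by (intro powr_minus_lipschitz) auto
    also have "\<bar>r - norm (z - x)\<bar> \<le> ?d"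
      unfolding r_def using norm_triangle_ineq3[of "y - x" "z - x"] by simp
    finally have "\<bar>\<Phi> y - \<Phi> z\<bar> \<le> B * ?d" using B by (simp add: mult_left_mono)
    then have "\<bar>F z\<bar> \<le> B * ?d / ?d powr ?s" unfolding F_def by (simp add: divide_right_mono)
    also have "\<dots> = B * ?d powr (1 - ?s)" using d by (simp add: powr_diff)
    also have "\<dots> \<le> B * (\<epsilon> / 2) powr (1 - ?s)"
      using d that \<alpha> B n1 by (intro mult_left_mono powr_mono2') auto
    finally show ?thesis .
  qed
  define V where "V = unit_ball_vol (real ?n)"
  \<comment> \<open>Up to the factor \<open>V * \<epsilon> ^ ?n\<close> this is the volume of the
    shell \<open>S\<close> below. It vanishes at 0 and is differentiable there, so it is of order
    \<epsilon>. As the integrand is of order \<epsilon>^(1-n-\<alpha>) on the shell,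
    \<open>J \<epsilon>\<close> is of order \<epsilon>^(2-\<alpha>).\<close>
  define g where "g = (\<lambda>\<epsilon>. (1 / (1 - \<epsilon> / r)) ^ ?n - (1 - \<epsilon> / r) ^ ?n)"
  have Jb: "\<bar>J \<epsilon>\<bar> \<le> B * (\<epsilon> / 2) powr (1 - ?s) * (V * (\<epsilon> ^ ?n * g \<epsilon>))" if e: "0 < \<epsilon>" "\<epsilon> < r / 2" for \<epsilon>
  proof -
    \<comment> \<open>A point at distance t from \<open>y\<close> and \<sigma> from \<open>x\<close>
      is reflected to distance rt/\<sigma> from \<open>y\<close>, with r - t \<le> \<sigma> \<le> r
      + t. The two sets can therefore disagree only for a \<le> t < b.\<close>
    define a b where "a = \<epsilon> * (1 - \<epsilon> / r)" and "b = \<epsilon> / (1 - \<epsilon> / r)"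
    define S where "S = ball y b - ball y a"
    have er: "1 / 2 < 1 - \<epsilon> / r" "1 - \<epsilon> / r < 1" using e r by (auto simp: field_simps)
    have a: "\<epsilon> / 2 \<le> a" unfolding a_def using er e by (simp add: field_simps)
    have ab: "a \<le> \<epsilon>" "\<epsilon> \<le> b" unfolding a_def b_def using er e by (auto simp: field_simps)
    have b2: "b \<le> 2 * \<epsilon>" unfolding b_def using er e by (simp add: field_simps)
    define K where "K = B * (\<epsilon> / 2) powr (1 - ?s)"
    have K: "K \<ge> 0" unfolding K_def using B by simp
    have diffb: "norm (indicator (M \<epsilon>) z * F z - indicator (M' \<epsilon>) z * F z) \<le> K * indicator S z" if z: "z \<noteq> x" for z
    proof (cases "z \<in> M \<epsilon> \<longleftrightarrow> z \<in> M' \<epsilon>")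
      case True
      then show ?thesis using K by (auto simp: indicator_def)
    next
      case False
      define t where "t = norm (z - y)"
      define \<sigma> where "\<sigma> = norm (z - x)"
      have \<sigma>: "\<sigma> > 0" using z by (simp add: \<sigma>_def)
      have \<sigma>1: "\<sigma> \<le> r + t" unfolding \<sigma>_def r_def t_def using norm_triangle_ineq[of "z - y" "y - x"] by simp
      have \<sigma>2: "r - t \<le> \<sigma>" unfolding \<sigma>_def r_def t_def using norm_triangle_ineq[of "y - z" "z - x"] by (simp add: norm_minus_commute)
      have iv: "norm (inversion x r z - y) = r * t / \<sigma>"
        using dist_inversion_sphere[OF r _ z, of y] by (simp add: r_def t_def \<sigma>_def norm_minus_commute)
      have alt: "(\<epsilon> \<le> t \<and> r * t < \<epsilon> * \<sigma>) \<or> (t < \<epsilon> \<and> \<epsilon> * \<sigma> \<le> r * t)"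
        using False \<sigma> unfolding M_def M'_def by (auto simp: iv t_def[symmetric] field_simps)
      from alt have tS: "a \<le> t \<and> t < b"
      proof
        assume h: "\<epsilon> \<le> t \<and> r * t < \<epsilon> * \<sigma>"
        have "r * t < \<epsilon> * (r + t)" using h \<sigma>1 e by (meson less_le_trans mult_left_mono less_imp_le)
        then have "t * (1 - \<epsilon> / r) < \<epsilon>" using r by (simp add: field_simps)
        then have "t < b" unfolding b_def using er by (subst pos_less_divide_eq; linarith)
        then show ?thesis using ab h by simp
      next
        assume h: "t < \<epsilon> \<and> \<epsilon> * \<sigma> \<le> r * t"
        have "\<epsilon> * (r - \<epsilon>) \<le> \<epsilon> * \<sigma>" using h \<sigma>2 e by (intro mult_left_mono) auto
        then have "\<epsilon> * (r - \<epsilon>) \<le> r * t" using h by linarith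
        then have "a \<le> t" unfolding a_def using r by (simp add: field_simps)
        then show ?thesis using ab h by simp
      qed
      then have "z \<in> S" by (simp add: S_def dist_norm norm_minus_commute t_def)
      moreover have "\<bar>F z\<bar> \<le> K"
        unfolding K_def
      proof (rule Fb)
        show "\<epsilon> / 2 \<le> norm (z - y)" using tS a by (simp add: t_def)
        show "r / 2 \<le> norm (z - x)"
        proof -
          have "r \<le> \<sigma>" if "\<epsilon> \<le> t" "r * t < \<epsilon> * \<sigma>"
          proof -
            have "\<epsilon> * r \<le> r * t" using that r by (simp add: mult.commute mult_left_mono)
            then have "\<epsilon> * r < \<epsilon> * \<sigma>" using that by linarith
            then show ?thesis using e by simp
          qed
          then consider "r \<le> \<sigma>" | "t < \<epsilon>" using alt by blast
          then show ?thesis using e \<sigma>2 r by cases (auto simp: \<sigma>_def[symmetric])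
        qed
      qed (use e in auto)
      ultimately show ?thesis using False by (auto simp: indicator_def)
    qed
    have Sm: "measure lborel S = V * (b ^ ?n - a ^ ?n)"
    proof -
      have "measure lborel S = measure lborel (ball y b) - measure lborel (ball y a)"
        unfolding S_def
        by (rule measure_Diff) (use ab emeasure_lborel_ball_finite[of y b] in \<open>auto intro!: subset_ball simp: less_top\<close>)
      then show ?thesis using a ab e by (simp add: content_ball V_def right_diff_distrib)
    qed
    have Ss: "S \<in> sets lborel" by (simp add: S_def)
    have Sf: "emeasure lborel S < \<infinity>"
      using emeasure_mono[of S "ball y b" lborel] emeasure_lborel_ball_finite[of y b]
      by (auto simp: S_def intro: le_less_trans)
    have Si: "integrable lborel (\<lambda>z. K * indicator S z)"
      using integrable_real_indicator[OF Ss Sf] by (rule integrable_mult_right)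
    have "2 * J \<epsilon> = (\<integral>z. indicator (M \<epsilon>) z * F z \<partial>lborel) - (\<integral>z. indicator (M' \<epsilon>) z * F z \<partial>lborel)"
      using M'F(2)[OF e(1)] by (simp add: J_def)
    also have "\<dots> = (\<integral>z. indicator (M \<epsilon>) z * F z - indicator (M' \<epsilon>) z * F z \<partial>lborel)"
      using MF[OF e(1)] M'F(1)[OF e(1)] by (rule Bochner_Integration.integral_diff[symmetric])
    also have "\<bar>\<dots>\<bar> \<le> (\<integral>z. \<bar>indicator (M \<epsilon>) z * F z - indicator (M' \<epsilon>) z * F z\<bar> \<partial>lborel)"
      by (rule integral_abs_bound)
    also have "\<dots> \<le> (\<integral>z. K * indicator S z \<partial>lborel)"
    proof (rule integral_mono_AE)
      show "integrable lborel (\<lambda>z. \<bar>indicator (M \<epsilon>) z * F z - indicator (M' \<epsilon>) z * F z\<bar>)"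
        using MF[OF e(1)] M'F(1)[OF e(1)] by (intro integrable_abs Bochner_Integration.integrable_diff)
      show "AE z in lborel. \<bar>indicator (M \<epsilon>) z * F z - indicator (M' \<epsilon>) z * F z\<bar> \<le> K * indicator S z"
        by (rule AE_mp[OF AE_lborel_singleton[of x]]) (use diffb in \<open>auto simp del: abs_mult\<close>)
    qed (rule Si)
    also have "\<dots> = K * (V * (b ^ ?n - a ^ ?n))" using Sm by simp
    also have "b ^ ?n - a ^ ?n = \<epsilon> ^ ?n * g \<epsilon>"
      by (simp only: a_def b_def g_def power_mult_distrib power_divide) (simp add: right_diff_distrib)
    finally show ?thesis unfolding K_def[symmetric] by linarith
  qed
  have P1: "((\<lambda>\<epsilon>::real. \<epsilon> powr (2 - \<alpha>)) \<longlongrightarrow> 0) (at_right 0)"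
    proof (rule tendsto_zero_powrI[where b = "2 - \<alpha>"])
      show "\<forall>\<^sub>F \<epsilon>::real in at_right 0. 0 \<le> \<epsilon>"
        by (rule eventually_mono[OF eventually_at_right_less]) simp
    qed (use \<alpha> in \<open>auto intro!: tendsto_intros\<close>)
  have P2: "((\<lambda>\<epsilon>. g \<epsilon> / \<epsilon>) \<longlongrightarrow> 2 * real ?n / r) (at_right 0)"
  proof -
    have "r * r ^ (?n - Suc 0) = r ^ ?n" by (subst power_Suc[symmetric]) simp
    then have "(g has_real_derivative (2 * real ?n / r)) (at 0)"
      unfolding g_def using r by (auto intro!: derivative_eq_intros simp: field_simps)
    then have "((\<lambda>\<epsilon>. (g \<epsilon> - g 0) / (\<epsilon> - 0)) \<longlongrightarrow> 2 * real ?n / r) (at 0)"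
      unfolding has_field_derivative_iff .
    then have "((\<lambda>\<epsilon>. (g \<epsilon> - g 0) / (\<epsilon> - 0)) \<longlongrightarrow> 2 * real ?n / r) (at_right 0)"
      by (rule tendsto_mono[OF at_le, rotated]) simp
    moreover have "g 0 = 0" by (simp add: g_def)
    ultimately show ?thesis by simp
  qed
  have "((\<lambda>\<epsilon>. B * (1/2) powr (1 - ?s) * V * (\<epsilon> powr (2 - \<alpha>) * (g \<epsilon> / \<epsilon>))) \<longlongrightarrow> B * (1/2) powr (1 - ?s) * V * (0 * (2 * real ?n / r))) (at_right 0)"
    by (rule tendsto_mult[OF tendsto_const tendsto_mult[OF P1 P2]])
  then have lim: "((\<lambda>\<epsilon>. B * (1/2) powr (1 - ?s) * V * (\<epsilon> powr (2 - \<alpha>) * (g \<epsilon> / \<epsilon>))) \<longlongrightarrow> 0) (at_right 0)" by simp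
  have "eventually (\<lambda>\<epsilon>. \<epsilon> \<in> {0<..<r / 2}) (at_right 0)"
    using r by (intro eventually_at_right_real) auto
  then have "eventually (\<lambda>\<epsilon>. norm (J \<epsilon>) \<le> B * (1/2) powr (1 - ?s) * V * (\<epsilon> powr (2 - \<alpha>) * (g \<epsilon> / \<epsilon>))) (at_right 0)"
  proof eventually_elim
    case (elim \<epsilon>)
    then have e: "0 < \<epsilon>" "\<epsilon> < r / 2" by auto
    have "(\<epsilon> / 2) powr (1 - ?s) = (1/2) powr (1 - ?s) * \<epsilon> powr (1 - ?s)"
      using e by (simp add: powr_divide)
    moreover have "\<epsilon> powr (1 - ?s) * \<epsilon> ^ ?n = \<epsilon> powr (2 - \<alpha>) / \<epsilon>"
    proof -
      have "\<epsilon> powr (1 - ?s) * \<epsilon> ^ ?n = \<epsilon> powr (1 - ?s) * \<epsilon> powr real ?n"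
        using e by (simp add: powr_realpow)
      also have "\<dots> = \<epsilon> powr (2 - \<alpha> - 1)" by (simp add: powr_add[symmetric])
      also have "\<dots> = \<epsilon> powr (2 - \<alpha>) / \<epsilon> powr 1" by (rule powr_diff)
      finally show ?thesis using e by simp
    qed
    moreover have "B * (X * Y) * (V * (E * G)) = B * X * V * ((Y * E) * G)" for X Y E G :: real
      by simp
    ultimately have "B * (\<epsilon> / 2) powr (1 - ?s) * (V * (\<epsilon> ^ ?n * g \<epsilon>)) = B * (1/2) powr (1 - ?s) * V * (\<epsilon> powr (2 - \<alpha>) / \<epsilon> * g \<epsilon>)"
      by (simp only:)
    then show ?case using Jb[OF e] by simp
  qed
  then have "(J \<longlongrightarrow> 0) (at_right 0)" using lim by (rule Lim_null_comparison)
  then show ?thesis unfolding J_def M_def F_def set_lebesgue_integral_def by simp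
qed

lemma C11_loc_on_ball:
  fixes w :: "'a::euclidean_space \<Rightarrow> real"
  assumes "C11_loc_on S w" "y \<in> S"
  shows "\<exists>r>0. \<exists>L w'. (\<forall>z\<in>ball y r. (w has_derivative blinfun_apply (w' z)) (at z)) \<and> L-lipschitz_on (ball y r) w'"
proof -
  from assms obtain U w' where U: "open U" "S \<subseteq> U"
    "\<forall>z\<in>U. (w has_derivative blinfun_apply (w' z)) (at z)"
    "\<forall>z\<in>U. \<exists>r>0. \<exists>L. L-lipschitz_on (ball z r) w'"
    unfolding C11_loc_on_def by blast
  then obtain r1 L where r1: "r1 > 0" "L-lipschitz_on (ball y r1) w'" using assms(2) by blast
  obtain r2 where r2: "r2 > 0" "ball y r2 \<subseteq> U" using U assms(2) open_contains_ball by blast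
  show ?thesis
  proof (rule exI[of _ "min r1 r2"], intro conjI exI[of _ L] exI[of _ w'] ballI)
    show "L-lipschitz_on (ball y (min r1 r2)) w'"
      using r1(2) by (rule lipschitz_on_subset) auto
    show "min r1 r2 > 0" using r1(1) r2(1) by simp
    show "(w has_derivative blinfun_apply (w' z)) (at z)" if "z \<in> ball y (min r1 r2)" for z
    proof (rule bspec[OF U(3)])
      show "z \<in> U" by (rule subsetD[OF r2(2)]) (use that in simp)
    qed
  qed
qed

lemma frac_lap_limit:
  fixes w :: "'a::euclidean_space \<Rightarrow> real"
  assumes n: "DIM('a) \<ge> 2" and \<alpha>: "0 < \<alpha>" "\<alpha> < 2" and w: "w \<in> L_space \<alpha>" "C11_loc_on S w" "y \<in> S"
  obtains l where "frac_lap \<alpha> w y = frac_lap_const TYPE('a) \<alpha> * l"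
    "((\<lambda>\<epsilon>. LINT z:{z. norm (z - y) \<ge> \<epsilon>}|lborel. (w y - w z) / norm (y - z) powr (real DIM('a) + \<alpha>)) \<longlongrightarrow> l) (at_right 0)"
proof -
  obtain r L w' where "r > 0" "\<forall>z\<in>ball y r. (w has_derivative blinfun_apply (w' z)) (at z)"
    "L-lipschitz_on (ball y r) w'"
    using C11_loc_on_ball[OF w(2,3)] by blast
  then obtain l where l: "((\<lambda>\<epsilon>. LINT z:{z. norm (z - y) \<ge> \<epsilon>}|lborel. (w y - w z) / norm (y - z) powr (real DIM('a) + \<alpha>)) \<longlongrightarrow> l) (at_right 0)"
    using frac_pv_exists[OF n \<alpha> w(1)] by blast
  show ?thesis using frac_lap_eq_limit[OF \<alpha>(2) l] l by (rule that)
qed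

lemma C11_continuous:
  fixes u :: "'a::euclidean_space \<Rightarrow> real"
  assumes "C11_loc_on UNIV u"
  shows "\<exists>u' :: 'a \<Rightarrow> 'a \<Rightarrow>\<^sub>L real. (\<forall>y. (u has_derivative blinfun_apply (u' y)) (at y)) \<and> continuous_on UNIV u'"
proof -
  from assms obtain u' where u': "\<And>y. (u has_derivative blinfun_apply (u' y)) (at y)"
    "\<And>y. \<exists>r>0. \<exists>L. L-lipschitz_on (ball y r) u'"
    unfolding C11_loc_on_def by (metis UNIV_I subset_UNIV top.extremum_uniqueI)
  have "isCont u' y" for y
  proof -
    obtain r L where "r > 0" "L-lipschitz_on (ball y r) u'" using u'(2) by blast
    then show ?thesis using lipschitz_on_continuous_on[of L "ball y r" u'] continuous_on_interior[of "ball y r" u' y] by simp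
  qed
  then have "continuous_on UNIV u'" by (simp add: continuous_at_imp_continuous_on)
  with u'(1) show ?thesis by blast
qed

lemma C2_continuous:
  fixes u :: "'a::euclidean_space \<Rightarrow> real"
  assumes "C2_on UNIV u"
  shows "\<exists>u' :: 'a \<Rightarrow> 'a \<Rightarrow>\<^sub>L real. (\<forall>y. (u has_derivative blinfun_apply (u' y)) (at y)) \<and> continuous_on UNIV u'"
proof -
  from assms obtain u' u'' where u': "\<And>y. (u has_derivative blinfun_apply (u' y)) (at y)"
    "\<And>y. (u' has_derivative blinfun_apply (u'' y)) (at y)"
    unfolding C2_on_def by (metis UNIV_I subset_UNIV top.extremum_uniqueI)
  then have "continuous_on UNIV u'"
    by (intro continuous_at_imp_continuous_on ballI has_derivative_continuous)
  with u'(1) show ?thesis by blast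
qed

lemma positive_min_on_compact:
  fixes u :: "'a::euclidean_space \<Rightarrow> real"
  assumes "continuous_on UNIV u" "\<And>y. u y > 0"
  shows "\<exists>m>0. \<forall>z\<in>cball x R. m \<le> u z"
proof (cases "cball x R = {}")
  case True
  then show ?thesis by (intro exI[of _ 1]) simp
next
  case False
  obtain z0 where "\<forall>z\<in>cball x R. u z0 \<le> u z"
    using continuous_attains_inf[OF compact_cball False continuous_on_subset[OF assms(1) subset_UNIV]] by blast
  then show ?thesis using assms(2)[of z0] by blast
qed

lemma bounded_on_compact:
  fixes u :: "'a::euclidean_space \<Rightarrow> real"
  assumes "continuous_on UNIV u"
  shows "\<exists>M>0. \<forall>z\<in>cball x R. u z \<le> M"
proof -
  have "compact (u ` cball x R)"
    by (intro compact_continuous_image continuous_on_subset[OF assms]) auto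
  then have "bounded (u ` cball x R)" by (rule compact_imp_bounded)
  then obtain M where "M > 0" "\<forall>z\<in>cball x R. norm (u z) \<le> M"
    unfolding bounded_pos by auto
  then show ?thesis by (intro exI[of _ M]) (auto simp: abs_le_iff)
qed

text \<open>At a negative minimum of $u - c|z-x|^{\alpha-n} + \eta$ the principal value of the power vanishes,
  while the positive mass of \<open>u\<close> in the unit ball makes that of \<open>u\<close> strictly negative.\<close>

lemma frac_superharmonic_lower_bound:
  fixes u :: "'a::euclidean_space \<Rightarrow> real"
  assumes n: "DIM('a) \<ge> 2" and \<alpha>: "0 < \<alpha>" "\<alpha> < 2" "\<alpha> < real DIM('a)"
    and u: "u \<in> L_space \<alpha>" "C11_loc_on UNIV u" "\<And>y. u y > 0" and sup: "\<And>y. frac_lap \<alpha> u y \<ge> 0"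
  shows "\<exists>c>0. \<forall>z. 1 \<le> norm (z - x) \<longrightarrow> c * norm (z - x) powr (\<alpha> - real DIM('a)) \<le> u z"
proof -
  let ?n = "DIM('a)"
  let ?s = "real ?n + \<alpha>"
  define \<Phi> where "\<Phi> = (\<lambda>z. norm (z - x) powr (\<alpha> - real ?n))"
  obtain u' where u': "\<And>y. (u has_derivative blinfun_apply (u' y)) (at y)" using C11_continuous[OF u(2)] by blast
  have uc: "continuous_on UNIV u"
    using u' by (intro continuous_at_imp_continuous_on ballI has_derivative_continuous)
  have [measurable]: "u \<in> borel_measurable borel" using u(1) by (rule L_space_measurable)
  have [measurable]: "\<Phi> \<in> borel_measurable borel" unfolding \<Phi>_def by measurable
  have [measurable]: "ball x 1 \<in> sets borel" by simp
  obtain m where m: "m > 0" "\<And>z. z \<in> cball x 2 \<Longrightarrow> m \<le> u z"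
    using positive_min_on_compact[OF uc u(3), of x 2] by blast
  have \<Phi>L: "\<Phi> \<in> L_space \<alpha>"
    using power_in_L_space[of \<alpha> "real ?n - \<alpha>" x] \<alpha> by (simp add: \<Phi>_def)
  have \<Phi>i: "integrable lborel (\<lambda>z. indicator (ball x 1) z * \<Phi> z)"
    using integrable_power_near[of "real ?n - \<alpha>" 1 x] \<alpha> by (simp add: \<Phi>_def)
  define I where "I = (\<integral>z. indicator (ball x 1) z * \<Phi> z \<partial>lborel)"
  have I: "I \<ge> 0" unfolding I_def by (intro Bochner_Integration.integral_nonneg) (simp add: \<Phi>_def)
  define V where "V = measure lborel (ball x 1)"
  have V: "V > 0" unfolding V_def by simp
  \<comment> \<open>The bound c \<le> m excludes a minimum with |y - x| \<le> 2, where u \<ge> m.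
    The second bound makes the unit ball contribute with the right sign: 4^s is the ratio of the
    extreme kernel values at distances D/2 and 2D, and I + 1 stands in for I, which is only known to
    be nonnegative.\<close>
  define c where "c = min m (m * V / (2 * 4 powr ?s * (I + 1)) / 2)"
  have c0: "c > 0" "c \<le> m" unfolding c_def using m V I by auto
  have cI: "c * I * 4 powr ?s < m / 2 * V"
  proof -
    define A where "A = 2 * 4 powr ?s * (I + 1)"
    have "A > 0" unfolding A_def using I by simp
    moreover have "c \<le> m * V / A / 2" unfolding c_def A_def by simp
    ultimately have "c * A * 2 \<le> m * V" by (simp add: pos_le_divide_eq mult_ac)
    then have "c * (2 * 4 powr ?s * (I + 1)) * 2 \<le> m * V" unfolding A_def .
    moreover have "c * I * 4 powr ?s < c * (I + 1) * 4 powr ?s * 2" using c0 I by (simp add: mult_strict_mono)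
    ultimately show ?thesis by (simp add: mult_ac)
  qed
  have "c * \<Phi> z \<le> u z" if z1: "1 \<le> norm (z1 - x)" and zz: "z = z1" for z z1
  proof (rule ccontr)
    assume "\<not> c * \<Phi> z \<le> u z"
    then have neg: "u z1 < c * \<Phi> z1" using zz by simp
    \<comment> \<open>Half of the gap at \<open>z1\<close> keeps \<open>w\<close> negative there and
      makes it positive near infinity, where \<Phi> tends to 0; so the minimum over the exterior
      region is attained.\<close>
    define \<eta> where "\<eta> = (c * \<Phi> z1 - u z1) / 2"
    have \<eta>: "\<eta> > 0" using neg by (simp add: \<eta>_def)
    define w where "w = (\<lambda>z. u z - c * \<Phi> z + \<eta>)"
    have w1: "w z1 < 0" using neg by (simp add: w_def \<eta>_def field_simps)
    have "((\<lambda>t. c * t powr (\<alpha> - real ?n)) \<longlongrightarrow> c * 0) at_top"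
      using \<alpha> by (intro tendsto_mult tendsto_const tendsto_neg_powr filterlim_ident) auto
    then have "eventually (\<lambda>t. c * t powr (\<alpha> - real ?n) < \<eta>) at_top"
      using \<eta> by (intro order_tendstoD(2)[where a = \<eta>]) auto
    then obtain R where R: "\<And>t. t \<ge> R \<Longrightarrow> c * t powr (\<alpha> - real ?n) < \<eta>"
      by (auto simp: eventually_at_top_linorder)
    define S where "S = cball x (max R (norm (z1 - x))) - ball x 1"
    have "compact S" unfolding S_def by (intro compact_diff) auto
    moreover have "z1 \<in> S" using z1 by (simp add: S_def dist_norm norm_minus_commute)
    moreover have "continuous_on S w"
      unfolding w_def \<Phi>_def by (intro continuous_intros continuous_on_subset[OF uc]) (auto simp: S_def)
    ultimately obtain y where y: "y \<in> S" "\<And>z. z \<in> S \<Longrightarrow> w y \<le> w z"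
      using continuous_attains_inf[of S w] by blast
    have wy: "w y < 0" using y(2)[OF \<open>z1 \<in> S\<close>] w1 by simp
    have wmin: "w y \<le> w z" if "1 \<le> norm (z - x)" for z
    proof (cases "z \<in> S")
      case False
      then have "R \<le> norm (z - x)" using that by (auto simp: S_def dist_norm norm_minus_commute)
      then have "w z > 0" using R[of "norm (z - x)"] u(3)[of z] by (simp add: w_def \<Phi>_def)
      then show ?thesis using wy by simp
    qed (rule y(2))
    have \<Phi>1: "\<Phi> z \<le> 1" if "1 \<le> norm (z - x)" for z
      using powr_mono2'[of "\<alpha> - real ?n" 1 "norm (z - x)"] that \<alpha> by (simp add: \<Phi>_def)
    have y1: "1 \<le> norm (y - x)" using y(1) by (auto simp: S_def dist_norm norm_minus_commute)
    have y2: "2 < norm (y - x)"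
    proof (rule ccontr)
      assume "\<not> 2 < norm (y - x)"
      then have "m \<le> u y" by (intro m) (simp add: dist_norm norm_minus_commute)
      moreover have "c * \<Phi> y \<le> m * 1" using \<Phi>1[OF y1] c0 m by (intro mult_mono) (auto simp: \<Phi>_def)
      ultimately show False using wy \<eta> by (simp add: w_def)
    qed
    define D where "D = norm (y - x)"
    have D: "D > 2" using y2 by (simp add: D_def)
    \<comment> \<open>Minimality of \<open>w\<close> at \<open>y\<close> is available only outside
      the unit ball, since \<Phi> blows up at \<open>x\<close>. Inside, u \<ge> m outweighs c \<Phi>
      after integration; the kernel lies between 1/(2D)^s and 1/(D/2)^s because |z - x| < 1 and D >
      2. \<open>\<kappa>\<close> is the net gain.\<close>
    define \<kappa> where "\<kappa> = m / 2 * (1 / (2 * D) powr ?s) * V - c * (1 / (D / 2) powr ?s) * I"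
    have \<kappa>: "\<kappa> > 0"
    proof -
      have "(2 * D) powr ?s = 4 powr ?s * (D / 2) powr ?s"
        using D by (subst powr_mult[symmetric]) auto
      moreover have "m / 2 * (1 / X) * V - c * (1 / Y) * I = 1 / X * (m / 2 * V - c * I * Q)"
        if "X = Q * Y" "Q > 0" "Y > 0" for X Y Q
        using that by (simp add: field_simps)
      ultimately have "\<kappa> = 1 / (2 * D) powr ?s * (m / 2 * V - c * I * 4 powr ?s)"
        unfolding \<kappa>_def using D by simp
      moreover have "1 / (2 * D) powr ?s > 0" using D by simp
      ultimately show ?thesis using cI by (simp only: mult_pos_pos diff_gt_0_iff_gt)
    qed
    define h where "h = (\<lambda>z. indicator (ball x 1) z * (c * (1 / (D / 2) powr ?s) * \<Phi> z - m / 2 * (1 / (2 * D) powr ?s)))"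
    have Bi: "integrable lborel (indicator (ball x 1) :: 'a \<Rightarrow> real)"
      by (rule integrable_real_indicator[OF _ emeasure_lborel_ball_finite]) simp
    have heq: "h = (\<lambda>z. (c * (1 / (D / 2) powr ?s)) * (indicator (ball x 1) z * \<Phi> z) - (m / 2 * (1 / (2 * D) powr ?s)) * indicator (ball x 1) z)"
      by (rule ext) (simp add: h_def algebra_simps)
    have hi: "integrable lborel h"
      unfolding heq using \<Phi>i Bi by (intro Bochner_Integration.integrable_diff integrable_mult_right) auto
    have hI: "(\<integral>z. h z \<partial>lborel) = - \<kappa>"
      unfolding heq using \<Phi>i Bi
      by (subst Bochner_Integration.integral_diff) (auto simp: \<kappa>_def I_def V_def)
    have pv: "(LINT z:{z. norm (z - y) \<ge> \<epsilon>}|lborel. (u y - u z) / norm (y - z) powr ?s)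
        \<le> c * (LINT z:{z. norm (z - y) \<ge> \<epsilon>}|lborel. (\<Phi> y - \<Phi> z) / norm (y - z) powr ?s) - \<kappa>"
      if e: "0 < \<epsilon>" "\<epsilon> < 1" for \<epsilon>
    proof -
      let ?N = "{z. \<epsilon> \<le> norm (z - y)}"
      have ui: "integrable lborel (\<lambda>z. indicator ?N z * ((u y - u z) / norm (y - z) powr ?s))"
        using u(1) \<alpha>(1) e(1) by (rule integrable_frac_kernel)
      have fi: "integrable lborel (\<lambda>z. indicator ?N z * ((\<Phi> y - \<Phi> z) / norm (y - z) powr ?s))"
        using \<Phi>L \<alpha>(1) e(1) by (rule integrable_frac_kernel)
      have fi': "integrable lborel (\<lambda>z. c * (indicator ?N z * ((\<Phi> y - \<Phi> z) / norm (y - z) powr ?s)))"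
        using fi by (rule integrable_mult_right)
      have pw: "indicator ?N z * ((u y - u z) / norm (y - z) powr ?s)
          \<le> c * (indicator ?N z * ((\<Phi> y - \<Phi> z) / norm (y - z) powr ?s)) + h z" for z
      proof (cases "z \<in> ball x 1")
        case False
        then have "w y \<le> w z" by (intro wmin) (simp add: dist_norm norm_minus_commute)
        then have "u y - u z \<le> c * (\<Phi> y - \<Phi> z)" by (simp add: w_def algebra_simps)
        then have "(u y - u z) / norm (y - z) powr ?s \<le> c * (\<Phi> y - \<Phi> z) / norm (y - z) powr ?s"
          by (rule divide_right_mono) simp
        then show ?thesis using False by (auto simp: h_def indicator_def)
      next
        case True
        then have zx: "norm (z - x) < 1" by (simp add: dist_norm norm_minus_commute)
        have d1: "norm (y - z) \<le> 2 * D" unfolding D_def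
          using norm_triangle_ineq4[of "y - x" "z - x"] zx y2 by simp
        have d2: "D / 2 \<le> norm (y - z)" unfolding D_def
          using norm_triangle_ineq[of "y - z" "z - x"] zx y2 by simp
        have N: "z \<in> ?N" using d2 D e by (simp add: norm_minus_commute)
        have "m \<le> u z" by (rule m) (use True in auto)
        moreover have "u y < c * \<Phi> y" using wy \<eta> by (simp add: w_def)
        ultimately have "u y - u z \<le> c * (\<Phi> y - \<Phi> z) + (c * \<Phi> z - m / 2)"
          using m(1) by (simp add: algebra_simps)
        then have "(u y - u z) / norm (y - z) powr ?s \<le> (c * (\<Phi> y - \<Phi> z) + (c * \<Phi> z - m / 2)) / norm (y - z) powr ?s"
          by (rule divide_right_mono) simp
        also have "\<dots> = c * ((\<Phi> y - \<Phi> z) / norm (y - z) powr ?s) + (c * \<Phi> z * (1 / norm (y - z) powr ?s) - m / 2 * (1 / norm (y - z) powr ?s))"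
          by (simp add: add_divide_distrib diff_divide_distrib right_diff_distrib)
        finally have 1: "(u y - u z) / norm (y - z) powr ?s \<le> c * ((\<Phi> y - \<Phi> z) / norm (y - z) powr ?s) + (c * \<Phi> z * (1 / norm (y - z) powr ?s) - m / 2 * (1 / norm (y - z) powr ?s))" .
        have "1 / norm (y - z) powr ?s \<le> 1 / (D / 2) powr ?s"
          using d2 D \<alpha> by (intro divide_left_mono powr_mono2) (auto intro!: mult_pos_pos)
        then have 2: "c * \<Phi> z * (1 / norm (y - z) powr ?s) \<le> c * \<Phi> z * (1 / (D / 2) powr ?s)"
          using c0 by (intro mult_left_mono) (auto simp: \<Phi>_def)
        have "1 / (2 * D) powr ?s \<le> 1 / norm (y - z) powr ?s"
          using d1 d2 D \<alpha> by (intro divide_left_mono powr_mono2) (auto intro!: mult_pos_pos)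
        then have 3: "m / 2 * (1 / (2 * D) powr ?s) \<le> m / 2 * (1 / norm (y - z) powr ?s)"
          using m by (intro mult_left_mono) auto
        have hz: "h z = c * \<Phi> z * (1 / (D / 2) powr ?s) - m / 2 * (1 / (2 * D) powr ?s)"
          using True by (simp add: h_def)
        show ?thesis using 1 2 3 N unfolding hz by simp
      qed
      have "(\<integral>z. indicator ?N z * ((u y - u z) / norm (y - z) powr ?s) \<partial>lborel)
          \<le> (\<integral>z. c * (indicator ?N z * ((\<Phi> y - \<Phi> z) / norm (y - z) powr ?s)) + h z \<partial>lborel)"
        using pw by (intro integral_mono ui Bochner_Integration.integrable_add fi' hi)
      also have "\<dots> = c * (\<integral>z. indicator ?N z * ((\<Phi> y - \<Phi> z) / norm (y - z) powr ?s) \<partial>lborel) - \<kappa>"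
        by (simp only: Bochner_Integration.integral_add[OF fi' hi] integral_mult_right_zero hI)
      finally show ?thesis unfolding set_lebesgue_integral_def by simp
    qed
    obtain l where l: "frac_lap \<alpha> u y = frac_lap_const TYPE('a) \<alpha> * l"
      "((\<lambda>\<epsilon>. LINT z:{z. norm (z - y) \<ge> \<epsilon>}|lborel. (u y - u z) / norm (y - z) powr ?s) \<longlongrightarrow> l) (at_right 0)"
      by (rule frac_lap_limit[OF n \<alpha>(1,2) u(1,2) UNIV_I])
    have "y \<noteq> x" using y2 by auto
    then have "((\<lambda>\<epsilon>. c * (LINT z:{z. norm (z - y) \<ge> \<epsilon>}|lborel. (\<Phi> y - \<Phi> z) / norm (y - z) powr ?s) - \<kappa>) \<longlongrightarrow> c * 0 - \<kappa>) (at_right 0)"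
      unfolding \<Phi>_def using \<alpha> by (intro tendsto_intros riesz_kernel_pv)
    moreover have "eventually (\<lambda>\<epsilon>. \<epsilon> \<in> {0<..<1::real}) (at_right 0)"
      by (rule eventually_at_right_real) simp
    then have "eventually (\<lambda>\<epsilon>. (LINT z:{z. norm (z - y) \<ge> \<epsilon>}|lborel. (u y - u z) / norm (y - z) powr ?s)
        \<le> c * (LINT z:{z. norm (z - y) \<ge> \<epsilon>}|lborel. (\<Phi> y - \<Phi> z) / norm (y - z) powr ?s) - \<kappa>) (at_right 0)"
      by eventually_elim (simp add: pv)
    ultimately have "l \<le> c * 0 - \<kappa>" using l(2) by (intro tendsto_le[OF _ _ l(2)]) auto
    then have "l < 0" using \<kappa> by simp
    then have "frac_lap \<alpha> u y < 0"
      unfolding l(1) using frac_lap_const_pos[OF n \<alpha>(1,2)] by (simp add: mult_pos_neg)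
    then show False using sup[of y] by simp
  qed
  then show ?thesis using c0 unfolding \<Phi>_def by blast
qed

section \<open>Positivity of \<omega> for spheres of small radius\<close>

lemma kelvin_inverted_value:
  assumes "r > 0" "y \<noteq> x"
  shows "kelvin \<alpha> u x r y = (norm (inversion x r y - x) / r) powr (real DIM('a::euclidean_space) - \<alpha>) * u (inversion x r (y::'a))"
proof -
  have "r / norm (y - x) = norm (inversion x r y - x) / r"
    using assms by (simp add: norm_inversion power2_eq_square)
  then show ?thesis by (simp add: kelvin_def)
qed

text \<open>Near \<open>x\<close> the function $t^{(n-\alpha)/2} u(x+t\theta)$ is increasing in \<open>t\<close> because \<open>u\<close> is positive and
  \<open>C\<^sup>1\<close>; far from \<open>x\<close> the lower bound on \<open>u\<close> makes \<open>kelvin\<close> of order $\lambda^{\alpha-n}$.\<close>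

lemma small_sphere_nonneg:
  fixes u :: "'a::euclidean_space \<Rightarrow> real" and u' :: "'a \<Rightarrow> 'a \<Rightarrow>\<^sub>L real"
  assumes \<alpha>: "\<alpha> < real DIM('a)" and pos: "\<And>y. u y > 0"
    and u': "\<And>y. (u has_derivative blinfun_apply (u' y)) (at y)" "continuous_on UNIV u'"
    and c: "c > 0" "\<And>z. 1 \<le> norm (z - x) \<Longrightarrow> c * norm (z - x) powr (\<alpha> - real DIM('a)) \<le> u z"
  shows "\<exists>\<delta>>0. \<forall>r. 0 < r \<and> r \<le> \<delta> \<longrightarrow> (\<forall>y\<in>ball x r - {x}. omega \<alpha> u x r y \<ge> 0)"
proof -
  define p where "p = real DIM('a) - \<alpha>"
  have p: "p > 0" using \<alpha> by (simp add: p_def)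
  have uc: "continuous_on UNIV u"
    using u'(1) by (intro continuous_at_imp_continuous_on ballI has_derivative_continuous)
  obtain m where m: "m > 0" "\<And>z. z \<in> cball x 1 \<Longrightarrow> m \<le> u z"
    using positive_min_on_compact[OF uc pos, of x 1] by blast
  obtain M where M: "M > 0" "\<And>z. z \<in> cball x 1 \<Longrightarrow> u z \<le> M"
    using bounded_on_compact[OF uc, of x 1] by blast
  have "continuous_on UNIV (\<lambda>y. norm (u' y))" using u'(2) by (intro continuous_intros)
  then obtain D where D: "D > 0" "\<And>z. z \<in> cball x 1 \<Longrightarrow> norm (u' z) \<le> D"
    using bounded_on_compact[of "\<lambda>y. norm (u' y)" x 1] by blast
  \<comment> \<open>Up to radius \<open>r0\<close> the gradient term \<tau> |u'| is at most (p/2) u,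
    which makes the derivative of \<tau>^(p/2) u(x + \<tau> e) nonnegative.\<close>
  define r0 where "r0 = min 1 (p / 2 * m / D)"
  have r0: "r0 > 0" "r0 \<le> 1" "D * r0 \<le> p / 2 * m"
  proof -
    have "r0 \<le> p / 2 * m / D" by (simp add: r0_def)
    then show "D * r0 \<le> p / 2 * m" using D(1) by (simp add: pos_le_divide_eq mult_ac)
  qed (use p m D in \<open>auto simp: r0_def\<close>)
  \<comment> \<open>\<open>k\<close> is a lower bound for t^p u(z) at distance t > \<open>r0\<close>
    from \<open>x\<close>: the first entry serves t \<le> 1, the second, from the decay bound, t >
    1. The radius \<delta> below is then such that M r^p \<le> k.\<close>
  define k where "k = min (m * r0 powr p) c"
  have k: "k > 0" using m c r0 by (simp add: k_def)
  define \<delta> where "\<delta> = min r0 ((k / M) powr (1 / p))"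
  have \<delta>: "\<delta> > 0" using r0 k M by (simp add: \<delta>_def)
  have mono: "s powr (p / 2) * u (x + s *\<^sub>R e) \<le> t powr (p / 2) * u (x + t *\<^sub>R e)"
    if st: "0 < s" "s \<le> t" "t \<le> r0" and e: "norm e = 1" for s t e
  proof (rule DERIV_nonneg_imp_nondecreasing[OF st(2)])
    fix \<tau> assume \<tau>: "s \<le> \<tau>" "\<tau> \<le> t"
    then have \<tau>0: "\<tau> > 0" "\<tau> \<le> r0" using st by auto
    let ?z = "x + \<tau> *\<^sub>R e"
    have zb: "?z \<in> cball x 1" using \<tau>0 r0 e by (simp add: dist_norm)
    have du: "((\<lambda>\<tau>. u (x + \<tau> *\<^sub>R e)) has_real_derivative blinfun_apply (u' ?z) e) (at \<tau>)"
    proof -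
      have "((\<lambda>\<tau>. u (x + \<tau> *\<^sub>R e)) has_derivative (\<lambda>h. blinfun_apply (u' ?z) (h *\<^sub>R e))) (at \<tau>)"
        by (rule has_derivative_compose[where f = "\<lambda>\<tau>. x + \<tau> *\<^sub>R e" and g = u, OF _ u'(1)])
           (auto intro!: derivative_eq_intros)
      moreover have "(\<lambda>h. blinfun_apply (u' ?z) (h *\<^sub>R e)) = (*) (blinfun_apply (u' ?z) e)"
        by (rule ext) (simp add: blinfun.scaleR_right)
      ultimately show ?thesis unfolding has_field_derivative_def by (simp only:)
    qed
    have dp: "((\<lambda>\<tau>. \<tau> powr (p / 2)) has_real_derivative p / 2 * \<tau> powr (p / 2 - 1)) (at \<tau>)"
      using \<tau>0(1) by (rule has_real_derivative_powr)
    have "norm (blinfun_apply (u' ?z) e) \<le> norm (u' ?z) * norm e" by (rule norm_blinfun)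
    then have b: "\<bar>blinfun_apply (u' ?z) e\<bar> \<le> D" using D(2)[OF zb] e by simp
    have "\<tau> * \<bar>blinfun_apply (u' ?z) e\<bar> \<le> r0 * D" using b \<tau>0 by (intro mult_mono) auto
    also have "\<dots> \<le> p / 2 * m" using r0(3) by (simp add: mult.commute)
    also have "\<dots> \<le> p / 2 * u ?z" using m(2)[OF zb] p by (intro mult_left_mono) auto
    finally have "\<tau> * \<bar>blinfun_apply (u' ?z) e\<bar> \<le> p / 2 * u ?z" .
    moreover have "\<tau> * (- \<bar>blinfun_apply (u' ?z) e\<bar>) \<le> \<tau> * blinfun_apply (u' ?z) e"
      using \<tau>0 by (intro mult_left_mono) auto
    ultimately have "0 \<le> p / 2 * u ?z + \<tau> * blinfun_apply (u' ?z) e" by linarith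
    then have "0 \<le> \<tau> powr (p / 2 - 1) * (p / 2 * u ?z + \<tau> * blinfun_apply (u' ?z) e)" by simp
    also have "\<dots> = p / 2 * \<tau> powr (p / 2 - 1) * u ?z + blinfun_apply (u' ?z) e * \<tau> powr (p / 2)"
    proof -
      have "\<tau> powr (p / 2) = \<tau> powr (p / 2 - 1) * \<tau>" using \<tau>0(1) powr_diff[of \<tau> "p / 2" 1] by simp
      then show ?thesis by (simp only:) (simp add: algebra_simps)
    qed
    finally show "\<exists>d. ((\<lambda>\<tau>. \<tau> powr (p / 2) * u (x + \<tau> *\<^sub>R e)) has_real_derivative d) (at \<tau>) \<and> 0 \<le> d"
      using DERIV_mult[OF dp du] by blast
  qed
  have "omega \<alpha> u x r y \<ge> 0" if r: "0 < r" "r \<le> \<delta>" and y: "y \<in> ball x r - {x}" for r y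
  proof -
    define z where "z = inversion x r y"
    define s t where "s = norm (y - x)" and "t = norm (z - x)"
    have s: "0 < s" "s < r" using y by (auto simp: s_def dist_norm norm_minus_commute)
    have t: "t = r\<^sup>2 / s" by (simp add: t_def z_def norm_inversion s_def)
    have rt: "r < t" unfolding t using s r by (simp add: field_simps power2_eq_square)
    have r1: "r \<le> r0" "r \<le> 1" using r r0 by (auto simp: \<delta>_def)
    have K: "kelvin \<alpha> u x r y = (t / r) powr p * u z"
      using kelvin_inverted_value[of r y x \<alpha> u] r y by (simp add: z_def t_def p_def)
    have "u y \<le> kelvin \<alpha> u x r y"
    proof (cases "t \<le> r0")
      case True
      define e where "e = (1 / s) *\<^sub>R (y - x)"
      have e: "norm e = 1" using s by (simp add: e_def s_def)
      have ye: "y = x + s *\<^sub>R e" using s by (simp add: e_def)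
      have ze: "z = x + t *\<^sub>R e" using s unfolding z_def inversion_def t e_def
        by (simp add: s_def[symmetric] power2_eq_square)
      \<comment> \<open>Inversion gives s t = r^2, hence (t/s)^(p/2) = (t/r)^p, the factor in
        \<open>kelvin\<close>; this dictates the exponent p/2 in \<open>mono\<close>.\<close>
      have "s powr (p / 2) * u y \<le> t powr (p / 2) * u z"
        unfolding ye ze using s rt True e by (intro mono) auto
      then have "u y \<le> t powr (p / 2) * u z / s powr (p / 2)"
        using s by (simp add: pos_le_divide_eq mult_ac)
      then have "u y \<le> t powr (p / 2) / s powr (p / 2) * u z" by simp
      also have "t powr (p / 2) / s powr (p / 2) = (t / r) powr p"
      proof -
        have "t / s = (t / r)\<^sup>2" using s r unfolding t by (simp add: power2_eq_square)
        also have "\<dots> = (t / r) powr 2" using r rt by simp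
        finally have "(t / s) powr (p / 2) = ((t / r) powr 2) powr (p / 2)" by (rule arg_cong)
        also have "\<dots> = (t / r) powr p" by (simp only: powr_powr) simp
        finally show ?thesis using s rt r by (simp add: powr_divide)
      qed
      finally show ?thesis unfolding K .
    next
      case False
      have tz: "t powr p * u z \<ge> k"
      proof (cases "t \<le> 1")
        case True
        then have "m \<le> u z" by (intro m) (simp add: t_def dist_norm norm_minus_commute)
        moreover have "r0 powr p \<le> t powr p" using False r0 p by (intro powr_mono2) auto
        ultimately have "r0 powr p * m \<le> t powr p * u z" using m by (intro mult_mono) auto
        then show ?thesis by (simp add: k_def mult.commute min_def)
      next
        case False
        then have "c * t powr (- p) \<le> u z" using c(2)[of z] by (simp add: t_def p_def)
        then have "t powr p * (c * t powr (- p)) \<le> t powr p * u z" by (intro mult_left_mono) auto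
        moreover have "t powr p * t powr (- p) = 1" using False by (simp add: powr_add[symmetric])
        ultimately have "c \<le> t powr p * u z" by (simp add: mult.left_commute)
        then show ?thesis by (simp add: k_def)
      qed
      have "r \<le> (k / M) powr (1 / p)" using r by (simp add: \<delta>_def)
      then have "r powr p \<le> ((k / M) powr (1 / p)) powr p" using r p by (intro powr_mono2) auto
      also have "\<dots> = k / M" using p k M by (simp add: powr_powr)
      finally have "M * r powr p \<le> k" using M by (simp add: field_simps)
      then have "M * r powr p \<le> t powr p * u z" using tz by simp
      then have "M \<le> t powr p * u z / r powr p" using r by (simp add: pos_le_divide_eq)
      then have "M \<le> (t / r) powr p * u z" using r rt by (simp add: powr_divide)
      moreover have "u y \<le> M" using s r1 by (intro M) (simp add: s_def dist_norm norm_minus_commute)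
      ultimately show ?thesis unfolding K by simp
    qed
    then show ?thesis by (simp add: omega_def)
  qed
  then show ?thesis using \<delta> by blast
qed

section \<open>The Kelvin transform and the Laplacian\<close>

text \<open>\<open>deriv\<close> is defined by choice and has no calculus rules without
  differentiability. Carrying a first derivative \<open>g\<close> on a neighbourhood of 0 gives
  rules for sums, products and compositions, and it still determines
  \<open>(deriv ^^ 2) \<phi> 0\<close>, the quantity in \<open>laplacian\<close>.\<close>

definition deriv2_at0 :: "(real \<Rightarrow> real) \<Rightarrow> real \<Rightarrow> real \<Rightarrow> bool" where
  "deriv2_at0 \<phi> d D \<longleftrightarrow> (\<exists>g. (\<forall>\<^sub>F t in nhds 0. (\<phi> has_real_derivative g t) (at t)) \<and>
     (g has_real_derivative D) (at 0) \<and> g 0 = d)"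

lemma deriv2_at0_deriv:
  assumes "deriv2_at0 \<phi> d D"
  shows "(deriv ^^ 2) \<phi> 0 = D"
proof -
  obtain g where g: "\<forall>\<^sub>F t in nhds 0. (\<phi> has_real_derivative g t) (at t)" "(g has_real_derivative D) (at 0)"
    using assms unfolding deriv2_at0_def by blast
  have "\<forall>\<^sub>F t in nhds 0. deriv \<phi> t = g t"
    using g(1) by eventually_elim (rule DERIV_imp_deriv)
  then have "(deriv \<phi> has_real_derivative D) (at 0)"
    using g(2) by (subst DERIV_cong_ev[OF refl _ refl]) auto
  then show ?thesis by (simp add: numeral_2_eq_2 DERIV_imp_deriv)
qed

lemma deriv2_at0_add:
  assumes "deriv2_at0 \<phi> d D" "deriv2_at0 \<psi> d' D'"
  shows "deriv2_at0 (\<lambda>t. \<phi> t + \<psi> t) (d + d') (D + D')"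
proof -
  obtain g h where g: "\<forall>\<^sub>F t in nhds 0. (\<phi> has_real_derivative g t) (at t)" "(g has_real_derivative D) (at 0)" "g 0 = d"
    and h: "\<forall>\<^sub>F t in nhds 0. (\<psi> has_real_derivative h t) (at t)" "(h has_real_derivative D') (at 0)" "h 0 = d'"
    using assms unfolding deriv2_at0_def by blast
  have "\<forall>\<^sub>F t in nhds 0. ((\<lambda>t. \<phi> t + \<psi> t) has_real_derivative g t + h t) (at t)"
    using g(1) h(1) by eventually_elim (rule DERIV_add)
  moreover have "((\<lambda>t. g t + h t) has_real_derivative D + D') (at 0)" using g(2) h(2) by (rule DERIV_add)
  ultimately show ?thesis unfolding deriv2_at0_def using g(3) h(3) by (intro exI[of _ "\<lambda>t. g t + h t"]) simp
qed

lemma deriv2_at0_mult: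
  assumes "deriv2_at0 \<phi> d D" "deriv2_at0 \<psi> d' D'"
  shows "deriv2_at0 (\<lambda>t. \<phi> t * \<psi> t) (d * \<psi> 0 + d' * \<phi> 0) (D * \<psi> 0 + 2 * d * d' + \<phi> 0 * D')"
proof -
  obtain g h where g: "\<forall>\<^sub>F t in nhds 0. (\<phi> has_real_derivative g t) (at t)" "(g has_real_derivative D) (at 0)" "g 0 = d"
    and h: "\<forall>\<^sub>F t in nhds 0. (\<psi> has_real_derivative h t) (at t)" "(h has_real_derivative D') (at 0)" "h 0 = d'"
    using assms unfolding deriv2_at0_def by blast
  have "\<forall>\<^sub>F t in nhds 0. ((\<lambda>t. \<phi> t * \<psi> t) has_real_derivative g t * \<psi> t + h t * \<phi> t) (at t)"
    using g(1) h(1) by eventually_elim (rule DERIV_mult)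
  moreover have "((\<lambda>t. g t * \<psi> t + h t * \<phi> t) has_real_derivative (D * \<psi> 0 + h 0 * g 0) + (D' * \<phi> 0 + g 0 * h 0)) (at 0)"
    using eventually_nhds_x_imp_x[OF g(1)] eventually_nhds_x_imp_x[OF h(1)] g(2) h(2) by (intro DERIV_add DERIV_mult)
  ultimately show ?thesis unfolding deriv2_at0_def using g(3) h(3)
    by (intro exI[of _ "\<lambda>t. g t * \<psi> t + h t * \<phi> t"]) (simp add: algebra_simps)
qed

lemma deriv2_at0_const: "deriv2_at0 (\<lambda>t. c) 0 0"
  unfolding deriv2_at0_def by (intro exI[of _ "\<lambda>t. 0"]) simp

lemma deriv2_at0_cmult: "deriv2_at0 \<phi> d D \<Longrightarrow> deriv2_at0 (\<lambda>t. c * \<phi> t) (c * d) (c * D)"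
  using deriv2_at0_mult[OF deriv2_at0_const[of c], of \<phi> d D] by (simp add: mult.commute)

lemma deriv2_at0_cong:
  assumes "deriv2_at0 \<phi> d D" "\<forall>\<^sub>F t in nhds 0. \<phi> t = \<psi> t"
  shows "deriv2_at0 \<psi> d D"
proof -
  obtain g where g: "\<forall>\<^sub>F t in nhds 0. (\<phi> has_real_derivative g t) (at t)" "(g has_real_derivative D) (at 0)" "g 0 = d"
    using assms unfolding deriv2_at0_def by blast
  have "\<forall>\<^sub>F t in nhds 0. \<forall>\<^sub>F s in nhds t. \<phi> s = \<psi> s" using assms(2) by (simp add: eventually_eventually)
  then have "\<forall>\<^sub>F t in nhds 0. (\<psi> has_real_derivative g t) (at t)"
    using g(1) by eventually_elim (subst (asm) DERIV_cong_ev[OF refl _ refl], assumption)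
  then show ?thesis unfolding deriv2_at0_def using g by blast
qed

text \<open>If D were negative, the first derivative, which vanishes at the minimum, would be
  negative just to the right of 0, and by the mean value theorem the function would drop below its
  value at 0.\<close>

lemma deriv2_at0_local_min:
  assumes "deriv2_at0 \<phi> d D" "\<forall>\<^sub>F t in nhds 0. \<phi> 0 \<le> \<phi> t"
  shows "D \<ge> 0"
proof (rule ccontr)
  assume "\<not> D \<ge> 0"
  then have D: "D < 0" by simp
  obtain g where g: "\<forall>\<^sub>F t in nhds 0. (\<phi> has_real_derivative g t) (at t)" "(g has_real_derivative D) (at 0)" "g 0 = d"
    using assms unfolding deriv2_at0_def by blast
  obtain e1 where e1: "e1 > 0" "\<And>t. \<bar>t\<bar> < e1 \<Longrightarrow> (\<phi> has_real_derivative g t) (at t)"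
    using g(1) unfolding eventually_nhds_metric by (auto simp: dist_real_def)
  obtain e2 where e2: "e2 > 0" "\<And>t. \<bar>t\<bar> < e2 \<Longrightarrow> \<phi> 0 \<le> \<phi> t"
    using assms(2) unfolding eventually_nhds_metric by (auto simp: dist_real_def)
  have "g 0 = 0"
    by (rule DERIV_local_min[OF e1(2)[of 0] e2(1)]) (use e1 e2 in auto)
  obtain e3 where e3: "e3 > 0" "\<And>h. 0 < h \<Longrightarrow> h < e3 \<Longrightarrow> g 0 > g (0 + h)"
    using DERIV_neg_dec_right[OF g(2) D] by blast
  define t where "t = min e1 (min e2 e3) / 2"
  have t: "0 < t" "t < e1" "t < e2" "t < e3" using e1(1) e2(1) e3(1) by (auto simp: t_def)
  obtain s where s: "0 < s" "s < t" "\<phi> t - \<phi> 0 = (t - 0) * g s"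
    using MVT2[of 0 t \<phi> g] e1(2) t by (auto simp: abs_if)
  have "g s < 0" using e3(2)[of s] s t \<open>g 0 = 0\<close> by simp
  then have "\<phi> t - \<phi> 0 < 0" using s t by (simp add: mult_pos_neg)
  then show False using e2(2)[of t] t by simp
qed

text \<open>Second-order chain rule along a curve. The term with the acceleration \<open>a\<close>
  matters because the inversion bends coordinate lines.\<close>

lemma deriv2_at0_compose:
  fixes u :: "'a::euclidean_space \<Rightarrow> real" and u' :: "'a \<Rightarrow> 'a \<Rightarrow>\<^sub>L real" and u'' :: "'a \<Rightarrow> 'a \<Rightarrow>\<^sub>L ('a \<Rightarrow>\<^sub>L real)"
  assumes u': "\<And>y. (u has_derivative blinfun_apply (u' y)) (at y)"
    and u'': "\<And>y. (u' has_derivative blinfun_apply (u'' y)) (at y)"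
    and \<gamma>: "\<forall>\<^sub>F t in nhds 0. (\<gamma> has_vector_derivative \<gamma>' t) (at t)" "(\<gamma>' has_vector_derivative a) (at 0)"
  shows "deriv2_at0 (\<lambda>t. u (\<gamma> t)) (u' (\<gamma> 0) (\<gamma>' 0)) (u'' (\<gamma> 0) (\<gamma>' 0) (\<gamma>' 0) + u' (\<gamma> 0) a)"
  unfolding deriv2_at0_def
proof (intro exI[of _ "\<lambda>t. u' (\<gamma> t) (\<gamma>' t)"] conjI)
  show "\<forall>\<^sub>F t in nhds 0. ((\<lambda>t. u (\<gamma> t)) has_real_derivative blinfun_apply (u' (\<gamma> t)) (\<gamma>' t)) (at t)"
    using \<gamma>(1)
  proof eventually_elim
    case (elim t)
    have "((\<lambda>t. u (\<gamma> t)) has_vector_derivative blinfun_apply (u' (\<gamma> t)) (\<gamma>' t)) (at t)"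
      using vector_derivative_diff_chain_within[OF elim, of u "blinfun_apply (u' (\<gamma> t))"] has_derivative_at_withinI[OF u'[of "\<gamma> t"]]
      by (simp add: o_def)
    then show ?case by (simp add: has_real_derivative_iff_has_vector_derivative)
  qed
  have \<gamma>0: "(\<gamma> has_vector_derivative \<gamma>' 0) (at 0)" using \<gamma>(1) by (rule eventually_nhds_x_imp_x)
  have "((\<lambda>t. u' (\<gamma> t)) has_vector_derivative blinfun_apply (u'' (\<gamma> 0)) (\<gamma>' 0)) (at 0)"
    using vector_derivative_diff_chain_within[OF \<gamma>0, of u' "blinfun_apply (u'' (\<gamma> 0))"] has_derivative_at_withinI[OF u''[of "\<gamma> 0"]]
    by (simp add: o_def)
  then have "((\<lambda>t. blinfun_apply (u' (\<gamma> t)) (\<gamma>' t)) has_vector_derivative u' (\<gamma> 0) a + u'' (\<gamma> 0) (\<gamma>' 0) (\<gamma>' 0)) (at 0)"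
    using \<gamma>(2) by (rule blinfun.has_vector_derivative)
  then show "((\<lambda>t. blinfun_apply (u' (\<gamma> t)) (\<gamma>' t)) has_real_derivative u'' (\<gamma> 0) (\<gamma>' 0) (\<gamma>' 0) + u' (\<gamma> 0) a) (at 0)"
    by (simp add: has_real_derivative_iff_has_vector_derivative add.commute)
qed simp

lemma C2_on_UNIV_derivs:
  fixes u :: "'a::euclidean_space \<Rightarrow> real"
  assumes "C2_on UNIV u"
  shows "\<exists>(u' :: 'a \<Rightarrow> 'a \<Rightarrow>\<^sub>L real) (u'' :: 'a \<Rightarrow> 'a \<Rightarrow>\<^sub>L ('a \<Rightarrow>\<^sub>L real)).
    (\<forall>y. (u has_derivative blinfun_apply (u' y)) (at y)) \<and> (\<forall>y. (u' has_derivative blinfun_apply (u'' y)) (at y))"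
  using assms unfolding C2_on_def by (metis UNIV_I subset_UNIV top.extremum_uniqueI)

lemma deriv2_at0_line:
  fixes u :: "'a::euclidean_space \<Rightarrow> real"
  assumes "C2_on UNIV u"
  shows "\<exists>d. deriv2_at0 (\<lambda>t. u (y + t *\<^sub>R b)) d ((deriv ^^ 2) (\<lambda>t. u (y + t *\<^sub>R b)) 0)"
proof -
  obtain u' u'' where u': "\<And>y. (u has_derivative blinfun_apply (u' y)) (at y)"
    "\<And>y. (u' has_derivative blinfun_apply (u'' y)) (at y)"
    using C2_on_UNIV_derivs[OF assms] by blast
  have "deriv2_at0 (\<lambda>t. u (y + t *\<^sub>R b)) (u' (y + 0 *\<^sub>R b) b) (u'' (y + 0 *\<^sub>R b) b b + u' (y + 0 *\<^sub>R b) 0)"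
    by (rule deriv2_at0_compose[OF u']) (auto intro!: always_eventually derivative_eq_intros)
  then show ?thesis using deriv2_at0_deriv by metis
qed

lemma power2_norm_add_Basis:
  assumes "e \<in> Basis"
  shows "(norm (a + t *\<^sub>R e))\<^sup>2 = (norm a)\<^sup>2 + 2 * t * (a \<bullet> e) + t\<^sup>2"
proof -
  have "(norm (a + t *\<^sub>R e))\<^sup>2 = (a + t *\<^sub>R e) \<bullet> (a + t *\<^sub>R e)" "(norm a)\<^sup>2 = a \<bullet> a"
    by (simp_all only: power2_norm_eq_inner)
  then show ?thesis
    using assms by (simp add: inner_add_left inner_add_right inner_commute[of e a] power2_eq_square algebra_simps)
qed

lemma sum_Basis_inner_linear:
  fixes e :: "'a::euclidean_space" and f :: "'a \<Rightarrow> real"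
  assumes "bounded_linear f"
  shows "(\<Sum>b\<in>Basis. (e \<bullet> b) * f b) = f e"
proof -
  interpret bounded_linear f by fact
  have "f e = f (\<Sum>b\<in>Basis. (e \<bullet> b) *\<^sub>R b)" by (simp add: euclidean_representation)
  also have "\<dots> = (\<Sum>b\<in>Basis. (e \<bullet> b) * f b)" by (simp add: sum scaleR)
  finally show ?thesis ..
qed

text \<open>The Kelvin transform intertwines the Laplacian: the first-order terms cancel after summation over the
  basis, and the derivative of the inversion is a multiple of a reflection, which preserves traces.\<close>

lemma kelvin_laplacian:
  fixes u :: "'a::euclidean_space \<Rightarrow> real"
  assumes u: "C2_on UNIV u" and r: "r > 0" and y: "y \<noteq> x"
  shows "\<exists>D. (\<forall>b\<in>Basis. \<exists>d. deriv2_at0 (\<lambda>t. kelvin 2 u x r (y + t *\<^sub>R b)) d (D b)) \<and>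
    (\<Sum>b\<in>Basis. D b) = (r / norm (y - x)) powr (real DIM('a) + 2) * laplacian u (inversion x r y)"
proof -
  obtain u' u'' where u': "\<And>y. (u has_derivative blinfun_apply (u' y)) (at y)"
    "\<And>y. (u' has_derivative blinfun_apply (u'' y)) (at y)"
    using C2_on_UNIV_derivs[OF u] by blast
  define m where "m = real DIM('a) - 2"
  define e where "e = y - x"
  define \<rho> where "\<rho> = e \<bullet> e"
  have \<rho>: "\<rho> > 0" using y by (simp add: \<rho>_def e_def)
  define q where "q = inversion x r y"
  define A where "A = r powr m * \<rho> powr (- m / 2)"
  define U where "U = blinfun_apply (u' q)"
  define Q where "Q = (\<lambda>v w. blinfun_apply (blinfun_apply (u'' q) v) w)"
  \<comment> \<open>For the reflected coordinate line, \<open>G b\<close> is the velocity and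
    \<open>a b\<close> the acceleration at time 0, while \<open>A\<close> is the conformal factor
    there. \<open>G b\<close> is r^2/\<rho> times the reflection of \<open>b\<close> in the
    hyperplane orthogonal to \<open>e\<close>.\<close>
  define G where "G = (\<lambda>b. r\<^sup>2 *\<^sub>R ((1 / \<rho>) *\<^sub>R b - (2 * (e \<bullet> b) / \<rho>\<^sup>2) *\<^sub>R e))"
  define a where "a = (\<lambda>b. r\<^sup>2 *\<^sub>R ((- 4 * (e \<bullet> b) / \<rho>\<^sup>2) *\<^sub>R b + (8 * (e \<bullet> b)\<^sup>2 / \<rho> ^ 3 - 2 / \<rho>\<^sup>2) *\<^sub>R e))"
  define D where "D = (\<lambda>b. A * (m * (m + 2) * (e \<bullet> b)\<^sup>2 / \<rho>\<^sup>2 - m / \<rho>) * u q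
      + 2 * (- m * A * (e \<bullet> b) / \<rho>) * U (G b) + A * (Q (G b) (G b) + U (a b)))"
  have main: "\<exists>d. deriv2_at0 (\<lambda>t. kelvin 2 u x r (y + t *\<^sub>R b)) d (D b)" if b: "b \<in> Basis" for b
  proof -
    define \<beta> where "\<beta> = e \<bullet> b"
    define f where "f = (\<lambda>t. \<rho> + 2 * t * \<beta> + t\<^sup>2)"
    have fn: "(norm (y + t *\<^sub>R b - x))\<^sup>2 = f t" for t
      using power2_norm_add_Basis[OF b, of e t]
      by (simp add: e_def f_def \<rho>_def \<beta>_def power2_norm_eq_inner diff_add_eq)
    have f0: "f 0 = \<rho>" by (simp add: f_def)
    have "isCont f 0" unfolding f_def by (intro continuous_intros)
    then have "(f \<longlongrightarrow> f 0) (nhds 0)" by (simp only: isCont_def tendsto_at_iff_tendsto_nhds)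
    then have fpos: "\<forall>\<^sub>F t in nhds 0. f t > 0" using \<rho> by (intro order_tendstoD(1)) (auto simp: f0)
    have df: "(f has_real_derivative 2 * \<beta> + 2 * t) (at t)" for t
      unfolding f_def by (auto intro!: derivative_eq_intros)
    define \<phi> where "\<phi> = (\<lambda>t. r powr m * f t powr (- m / 2))"
    define \<gamma> where "\<gamma> = (\<lambda>t. x + (r\<^sup>2 / f t) *\<^sub>R (e + t *\<^sub>R b))"
    define g\<phi> where "g\<phi> = (\<lambda>t. r powr m * ((- m / 2) * f t powr (- m / 2 - 1) * (2 * \<beta> + 2 * t)))"
    define \<gamma>' where "\<gamma>' = (\<lambda>t. (r\<^sup>2 / f t) *\<^sub>R b - (r\<^sup>2 * (2 * \<beta> + 2 * t) / (f t)\<^sup>2) *\<^sub>R (e + t *\<^sub>R b))"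
    have dpow: "((\<lambda>t. f t powr c) has_real_derivative c * f t powr (c - 1) * (2 * \<beta> + 2 * t)) (at t)" if "f t > 0" for t c
      using DERIV_fun_powr[OF df that, of c] by (simp add: mult_ac)
    have \<phi>2: "deriv2_at0 \<phi> (- m * A * \<beta> / \<rho>) (A * (m * (m + 2) * \<beta>\<^sup>2 / \<rho>\<^sup>2 - m / \<rho>))"
      unfolding deriv2_at0_def
    proof (intro exI[of _ g\<phi>] conjI)
      show "\<forall>\<^sub>F t in nhds 0. (\<phi> has_real_derivative g\<phi> t) (at t)"
        using fpos unfolding \<phi>_def g\<phi>_def by eventually_elim (intro DERIV_cmult dpow)
      have p1: "\<rho> powr (- m / 2 - 1) = \<rho> powr (- m / 2) / \<rho>" using \<rho> powr_diff[of \<rho> "- m / 2" 1] by simp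
      have p2: "\<rho> powr (- m / 2 - 1 - 1) = \<rho> powr (- m / 2) / \<rho>\<^sup>2"
        using \<rho> powr_diff[of \<rho> "- m / 2 - 1" 1] p1 by (simp add: power2_eq_square)
      have "(g\<phi> has_real_derivative r powr m * ((- m / 2) * ((- m / 2 - 1) * f 0 powr (- m / 2 - 1 - 1) * (2 * \<beta> + 2 * 0)) * (2 * \<beta> + 2 * 0)
          + 2 * ((- m / 2) * f 0 powr (- m / 2 - 1)))) (at 0)"
        unfolding g\<phi>_def
        by (intro DERIV_cmult DERIV_mult dpow) (use \<rho> in \<open>auto simp: f0 intro!: derivative_eq_intros\<close>)
      then show "(g\<phi> has_real_derivative A * (m * (m + 2) * \<beta>\<^sup>2 / \<rho>\<^sup>2 - m / \<rho>)) (at 0)"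
        unfolding f0 p1 p2 A_def
        by (rule back_subst[where P = "\<lambda>D. (g\<phi> has_real_derivative D) (at 0)"]) (use \<rho> in \<open>simp add: field_simps power2_eq_square\<close>)
      show "g\<phi> 0 = - m * A * \<beta> / \<rho>" unfolding g\<phi>_def f0 p1 A_def by simp
    qed
    have dinv: "((\<lambda>t. c * inverse (f t)) has_real_derivative - (c * (2 * \<beta> + 2 * t) / (f t)\<^sup>2)) (at t)" if "f t > 0" for t c
      using that by (auto intro!: derivative_eq_intros df simp: power2_eq_square field_simps)
    have "deriv2_at0 (\<lambda>t. u (\<gamma> t)) (u' (\<gamma> 0) (\<gamma>' 0)) (u'' (\<gamma> 0) (\<gamma>' 0) (\<gamma>' 0) + u' (\<gamma> 0) (a b))"
    proof (rule deriv2_at0_compose[OF u'])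
      show "\<forall>\<^sub>F t in nhds 0. (\<gamma> has_vector_derivative \<gamma>' t) (at t)"
        using fpos
      proof eventually_elim
        case (elim t)
        have "((\<lambda>t. x + (r\<^sup>2 * inverse (f t)) *\<^sub>R (e + t *\<^sub>R b)) has_vector_derivative
            0 + ((r\<^sup>2 * inverse (f t)) *\<^sub>R b + (- (r\<^sup>2 * (2 * \<beta> + 2 * t) / (f t)\<^sup>2)) *\<^sub>R (e + t *\<^sub>R b))) (at t)"
          by (intro has_vector_derivative_add has_vector_derivative_const has_vector_derivative_scaleR dinv elim)
             (auto intro!: derivative_eq_intros)
        then show ?case unfolding \<gamma>_def \<gamma>'_def by (simp add: divide_inverse)
      qed
      have f0': "f 0 > 0" using \<rho> by (simp add: f0)
      have d2: "((\<lambda>t. r\<^sup>2 * (2 * \<beta> + 2 * t) / (f t)\<^sup>2) has_real_derivative r\<^sup>2 * (2 / \<rho>\<^sup>2 - 8 * \<beta>\<^sup>2 / \<rho> ^ 3)) (at 0)"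
        using \<rho> by (auto intro!: derivative_eq_intros df simp: f0 power2_eq_square power3_eq_cube field_simps)
      have "((\<lambda>t. (r\<^sup>2 * inverse (f t)) *\<^sub>R b - (r\<^sup>2 * (2 * \<beta> + 2 * t) / (f t)\<^sup>2) *\<^sub>R (e + t *\<^sub>R b)) has_vector_derivative
          ((r\<^sup>2 * inverse (f 0)) *\<^sub>R 0 + (- (r\<^sup>2 * (2 * \<beta> + 2 * 0) / (f 0)\<^sup>2)) *\<^sub>R b)
          - ((r\<^sup>2 * (2 * \<beta> + 2 * 0) / (f 0)\<^sup>2) *\<^sub>R b + (r\<^sup>2 * (2 / \<rho>\<^sup>2 - 8 * \<beta>\<^sup>2 / \<rho> ^ 3)) *\<^sub>R (e + 0 *\<^sub>R b))) (at 0)"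
        by (intro has_vector_derivative_diff has_vector_derivative_const has_vector_derivative_scaleR dinv d2 f0')
           (auto intro!: derivative_eq_intros)
      moreover have "(r\<^sup>2 * inverse (f 0)) *\<^sub>R 0 + (- (r\<^sup>2 * (2 * \<beta> + 2 * 0) / (f 0)\<^sup>2)) *\<^sub>R b
          - ((r\<^sup>2 * (2 * \<beta> + 2 * 0) / (f 0)\<^sup>2) *\<^sub>R b + (r\<^sup>2 * (2 / \<rho>\<^sup>2 - 8 * \<beta>\<^sup>2 / \<rho> ^ 3)) *\<^sub>R (e + 0 *\<^sub>R b)) = a b"
      proof -
        have 1: "- X *\<^sub>R b - (X *\<^sub>R b + Y *\<^sub>R e) = (- 2 * X) *\<^sub>R b + (- Y) *\<^sub>R e" for X Y :: real
          using scaleR_left_distrib[of "- X" "- X" b] by simp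
        have 2: "a b = (- 2 * (r\<^sup>2 * (2 * \<beta>) / \<rho>\<^sup>2)) *\<^sub>R b + (- (r\<^sup>2 * (2 / \<rho>\<^sup>2 - 8 * \<beta>\<^sup>2 / \<rho> ^ 3))) *\<^sub>R e"
          unfolding a_def \<beta>_def[symmetric] by (simp add: scaleR_add_right scaleR_diff_right right_diff_distrib mult_ac)
        show ?thesis unfolding 2 1[symmetric] f0 by simp
      qed
      moreover have "(\<lambda>t. (r\<^sup>2 * inverse (f t)) *\<^sub>R b - (r\<^sup>2 * (2 * \<beta> + 2 * t) / (f t)\<^sup>2) *\<^sub>R (e + t *\<^sub>R b)) = \<gamma>'"
        unfolding \<gamma>'_def by (simp add: divide_inverse)
      ultimately show "(\<gamma>' has_vector_derivative a b) (at 0)" by (simp only:)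
    qed
    moreover have "\<gamma> 0 = q" unfolding \<gamma>_def f0 q_def inversion_def \<rho>_def e_def by (simp add: power2_norm_eq_inner)
    moreover have "\<gamma>' 0 = G b" unfolding \<gamma>'_def f0 G_def \<beta>_def by (simp add: algebra_simps)
    ultimately have "deriv2_at0 (\<lambda>t. u (\<gamma> t)) (U (G b)) (Q (G b) (G b) + U (a b))"
      unfolding U_def Q_def by simp
    from deriv2_at0_mult[OF \<phi>2 this]
    obtain d where d: "deriv2_at0 (\<lambda>t. \<phi> t * u (\<gamma> t)) d (D b)"
      using \<open>\<gamma> 0 = q\<close> unfolding D_def \<beta>_def \<phi>_def f0 A_def by auto
    have ev: "\<forall>\<^sub>F t in nhds 0. \<phi> t * u (\<gamma> t) = kelvin 2 u x r (y + t *\<^sub>R b)"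
      using fpos
    proof eventually_elim
      case (elim t)
      let ?N = "norm (y + t *\<^sub>R b - x)"
      have N: "?N > 0" using fn[of t] elim by (cases "?N = 0") auto
      have "f t powr (- m / 2) = (?N powr 2) powr (- m / 2)" using N by (simp add: fn[symmetric])
      also have "\<dots> = ?N powr (- m)" by (simp only: powr_powr) simp
      finally have "\<phi> t = (r / ?N) powr m"
        unfolding \<phi>_def using r N by (simp add: powr_divide powr_minus_divide)
      moreover have "\<gamma> t = inversion x r (y + t *\<^sub>R b)"
        unfolding \<gamma>_def inversion_def fn by (simp add: e_def algebra_simps)
      ultimately show ?case by (simp add: kelvin_def m_def)
    qed
    show ?thesis by (rule exI, rule deriv2_at0_cong[OF d ev])
  qed
  have lap: "laplacian u q = (\<Sum>b\<in>Basis. Q b b)"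
    unfolding laplacian_def
  proof (rule sum.cong[OF refl])
    fix b :: 'a
    have "deriv2_at0 (\<lambda>t. u (q + t *\<^sub>R b)) (u' (q + 0 *\<^sub>R b) b) (u'' (q + 0 *\<^sub>R b) b b + u' (q + 0 *\<^sub>R b) 0)"
      by (rule deriv2_at0_compose[OF u']) (auto intro!: always_eventually derivative_eq_intros)
    from deriv2_at0_deriv[OF this] show "(deriv ^^ 2) (\<lambda>t. u (q + t *\<^sub>R b)) 0 = Q b b" by (simp add: Q_def blinfun.zero_right)
  qed
  have Ul: "U (v + w) = U v + U w" "U (v - w) = U v - U w" "U (c *\<^sub>R v) = c * U v" for v w c
    by (simp_all add: U_def blinfun.add_right blinfun.diff_right blinfun.scaleR_right)
  have Ql: "Q (v - w) z = Q v z - Q w z" "Q (c *\<^sub>R v) z = c * Q v z"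
    "Q z (v - w) = Q z v - Q z w" "Q z (c *\<^sub>R v) = c * Q z v" for v w z c
    by (simp_all add: Q_def blinfun.diff_right blinfun.scaleR_right blinfun.diff_left blinfun.scaleR_left)
  have S1: "(\<Sum>b\<in>Basis. (e \<bullet> b)\<^sup>2) = \<rho>" unfolding \<rho>_def by (subst euclidean_inner) (simp add: power2_eq_square)
  have S2: "(\<Sum>b\<in>Basis. (e \<bullet> b) * U b) = U e"
    by (rule sum_Basis_inner_linear) (simp add: U_def blinfun.bounded_linear_right)
  have S3: "(\<Sum>b\<in>Basis. (e \<bullet> b) * Q e b) = Q e e"
    by (rule sum_Basis_inner_linear) (simp add: Q_def blinfun.bounded_linear_right)
  have S4: "(\<Sum>b\<in>Basis. (e \<bullet> b) * Q b e) = Q e e"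
    by (rule sum_Basis_inner_linear) (auto simp: Q_def intro!: bounded_linear_intros)
  \<comment> \<open>Sorted so that every dependence on \<open>b\<close> is constant, one of the sums
    \<open>S1\<close> to \<open>S4\<close>, or the trace term.\<close>
  have Db: "D b = (A * m * (m + 2) / \<rho>\<^sup>2 * u q + 4 * m * A * r\<^sup>2 / \<rho> ^ 3 * U e + 8 * A * r\<^sup>2 / \<rho> ^ 3 * U e + 4 * A * r ^ 4 / \<rho> ^ 4 * Q e e) * (e \<bullet> b)\<^sup>2
      + (- A * m / \<rho> * u q - 2 * A * r\<^sup>2 / \<rho>\<^sup>2 * U e)
      + (- 2 * m * A * r\<^sup>2 / \<rho>\<^sup>2 - 4 * A * r\<^sup>2 / \<rho>\<^sup>2) * ((e \<bullet> b) * U b)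
      + A * r ^ 4 / \<rho>\<^sup>2 * Q b b
      + (- 2 * A * r ^ 4 / \<rho> ^ 3) * ((e \<bullet> b) * Q e b) + (- 2 * A * r ^ 4 / \<rho> ^ 3) * ((e \<bullet> b) * Q b e)" for b
    unfolding D_def G_def a_def Ul Ql
    by (simp add: divide_inverse algebra_simps power2_eq_square power3_eq_cube power4_eq_xxxx)
  have "(\<Sum>b\<in>Basis. D b) = (A * m * (m + 2) / \<rho>\<^sup>2 * u q + 4 * m * A * r\<^sup>2 / \<rho> ^ 3 * U e + 8 * A * r\<^sup>2 / \<rho> ^ 3 * U e + 4 * A * r ^ 4 / \<rho> ^ 4 * Q e e) * \<rho>
      + real DIM('a) * (- A * m / \<rho> * u q - 2 * A * r\<^sup>2 / \<rho>\<^sup>2 * U e)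
      + (- 2 * m * A * r\<^sup>2 / \<rho>\<^sup>2 - 4 * A * r\<^sup>2 / \<rho>\<^sup>2) * U e
      + A * r ^ 4 / \<rho>\<^sup>2 * laplacian u q
      + (- 2 * A * r ^ 4 / \<rho> ^ 3) * Q e e + (- 2 * A * r ^ 4 / \<rho> ^ 3) * Q e e"
    unfolding Db sum.distrib sum_distrib_left[symmetric] S1 S2 S3 S4 lap by simp
  \<comment> \<open>With n = m + 2 the coefficients of \<open>u q\<close>, \<open>U e\<close> and
    \<open>Q e e\<close> all vanish. For \<open>u q\<close> this is the harmonicity of |e|^(-m), and
    only the trace survives.\<close>
  also have "real DIM('a) = m + 2" by (simp add: m_def)
  also have "(A * m * (m + 2) / \<rho>\<^sup>2 * u q + 4 * m * A * r\<^sup>2 / \<rho> ^ 3 * U e + 8 * A * r\<^sup>2 / \<rho> ^ 3 * U e + 4 * A * r ^ 4 / \<rho> ^ 4 * Q e e) * \<rho>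
      + (m + 2) * (- A * m / \<rho> * u q - 2 * A * r\<^sup>2 / \<rho>\<^sup>2 * U e)
      + (- 2 * m * A * r\<^sup>2 / \<rho>\<^sup>2 - 4 * A * r\<^sup>2 / \<rho>\<^sup>2) * U e
      + A * r ^ 4 / \<rho>\<^sup>2 * laplacian u q
      + (- 2 * A * r ^ 4 / \<rho> ^ 3) * Q e e + (- 2 * A * r ^ 4 / \<rho> ^ 3) * Q e e = A * r ^ 4 / \<rho>\<^sup>2 * laplacian u q"
    using \<rho> by (simp add: field_simps power2_eq_square power3_eq_cube power4_eq_xxxx)
  also have "A * r ^ 4 / \<rho>\<^sup>2 = (r / norm (y - x)) powr (real DIM('a) + 2)"
  proof -
    let ?N = "norm (y - x)"
    have N: "?N > 0" using y by simp
    have \<rho>N: "\<rho> = ?N powr 2" using N by (simp add: \<rho>_def e_def power2_norm_eq_inner)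
    have "\<rho> powr (- m / 2) = ?N powr (- m)" unfolding \<rho>N by (simp only: powr_powr) simp
    moreover have "\<rho>\<^sup>2 = ?N ^ 4" using N by (simp add: \<rho>N)
    ultimately have "A * r ^ 4 / \<rho>\<^sup>2 = (r / ?N) powr m * (r / ?N) ^ 4"
      unfolding A_def using r N by (simp add: powr_divide powr_minus_divide power_divide)
    also have "(r / ?N) ^ 4 = (r / ?N) powr 4" using r N by simp
    also have "(r / ?N) powr m * (r / ?N) powr 4 = (r / ?N) powr (real DIM('a) + 2)"
      by (simp add: powr_add[symmetric] m_def add.commute)
    finally show ?thesis .
  qed
  finally show ?thesis using main unfolding q_def by (intro exI[of _ D]) simp
qed

section \<open>The nonlocal term\<close>

lemma P_nonneg: "P \<alpha> u y \<ge> 0"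
  unfolding P_def by (intro Bochner_Integration.integral_nonneg) simp

text \<open>The integrand is positive except at z = y, where the quotient takes the value 0; so the
  integral of this integrable function cannot vanish.\<close>

lemma P_pos:
  fixes u :: "'a::euclidean_space \<Rightarrow> real"
  assumes i: "integrable lborel (\<lambda>z. (u z)\<^sup>2 / norm (y - z) powr (2 * \<alpha>))" and pos: "\<And>z. u z > 0"
  shows "P \<alpha> u y > 0"
proof -
  have "P \<alpha> u y \<noteq> 0"
  proof
    assume "P \<alpha> u y = 0"
    then have "AE z in lborel. (u z)\<^sup>2 / norm (y - z) powr (2 * \<alpha>) = 0"
      unfolding P_def using integral_nonneg_eq_0_iff_AE[OF i] by simp
    then have "AE z in lborel. z \<notin> ball y 1"
      using AE_lborel_singleton[of y]
    proof eventually_elim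
      case (elim z)
      have "(u z)\<^sup>2 / norm (y - z) powr (2 * \<alpha>) > 0" using elim(2) pos[of z] by simp
      then show ?case using elim(1) by simp
    qed
    then have "emeasure lborel (ball y 1) = 0"
      by (subst (asm) AE_iff_measurable[where N = "ball y 1"]) auto
    then have "measure lborel (ball y 1) = 0" by (simp add: measure_def)
    then show False by simp
  qed
  then show ?thesis using P_nonneg[of \<alpha> u y] by linarith
qed

text \<open>Within 3R of \<open>x\<close>, u is bounded and the kernel is integrable because
  2\<alpha> < n. Farther out |x - z| \<le> 2 |y - z|, so the integrand is controlled by that of
  \<open>P\<close> at the single point \<open>x\<close>.\<close>

lemma P_bounded:
  fixes u :: "'a::euclidean_space \<Rightarrow> real"
  assumes i: "\<And>y. integrable lborel (\<lambda>z. (u z)\<^sup>2 / norm (y - z) powr (2 * \<alpha>))"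
    and \<alpha>: "0 < \<alpha>" "2 * \<alpha> < real DIM('a)" and R: "R > 0" and u: "continuous_on UNIV u" "\<And>z. u z > 0"
  shows "\<exists>C\<ge>0. \<forall>y\<in>cball x R. P \<alpha> u y \<le> C"
proof -
  obtain M where M: "M > 0" "\<And>z. z \<in> cball x (3 * R) \<Longrightarrow> u z \<le> M"
    using bounded_on_compact[OF u(1), of x "3 * R"] by blast
  define T where "T = (\<integral>z. indicator (ball (0::'a) (5 * R)) z * (1 / norm (0 - z) powr (2 * \<alpha>)) \<partial>lborel)"
  have "P \<alpha> u y \<le> M\<^sup>2 * T + 2 powr (2 * \<alpha>) * P \<alpha> u x" if y: "y \<in> cball x R" for y
  proof -
    let ?h = "\<lambda>z. indicator (ball (0::'a) (5 * R)) z * (1 / norm (0 - z) powr (2 * \<alpha>))"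
    have [measurable]: "ball (0::'a) (5 * R) \<in> sets borel" by simp
    have hi: "integrable lborel (\<lambda>z. ?h (z - y))"
      using integrable_kernel_near[of "2 * \<alpha>" "5 * R" 0] \<alpha> R by (subst integrable_lborel_shift) auto
    have i1: "integrable lborel (\<lambda>z. M\<^sup>2 * ?h (z - y))" using hi by (rule integrable_mult_right)
    have i2: "integrable lborel (\<lambda>z. 2 powr (2 * \<alpha>) * ((u z)\<^sup>2 / norm (x - z) powr (2 * \<alpha>)))"
      using i[of x] by (rule integrable_mult_right)
    have T: "T = (\<integral>z. ?h (z - y) \<partial>lborel)" unfolding T_def by (rule integral_lborel_shift[symmetric]) measurable
    have "P \<alpha> u y \<le> (\<integral>z. M\<^sup>2 * ?h (z - y) + 2 powr (2 * \<alpha>) * ((u z)\<^sup>2 / norm (x - z) powr (2 * \<alpha>)) \<partial>lborel)"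
      unfolding P_def
    proof (rule integral_mono)
      fix z
      have yx: "norm (x - y) \<le> R" using y by (simp add: dist_norm)
      show "(u z)\<^sup>2 / norm (y - z) powr (2 * \<alpha>) \<le> M\<^sup>2 * ?h (z - y) + 2 powr (2 * \<alpha>) * ((u z)\<^sup>2 / norm (x - z) powr (2 * \<alpha>))"
      proof (cases "norm (x - z) \<le> 3 * R")
        case True
        have "norm (y - z) \<le> norm (x - y) + norm (x - z)"
          using norm_triangle_ineq4[of "x - z" "x - y"] by simp
        then have lt: "norm (y - z) < 5 * R" using yx True R by linarith
        have "u z \<le> M" using True by (intro M) (simp add: dist_norm)
        then have "(u z)\<^sup>2 \<le> M\<^sup>2" using u(2)[of z] by (intro power_mono) auto
        then have "(u z)\<^sup>2 / norm (y - z) powr (2 * \<alpha>) \<le> M\<^sup>2 * ?h (z - y)"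
          using lt by (simp add: divide_right_mono norm_minus_commute)
        moreover have "0 \<le> 2 powr (2 * \<alpha>) * ((u z)\<^sup>2 / norm (x - z) powr (2 * \<alpha>))" by simp
        ultimately show ?thesis by linarith
      next
        case False
        have "norm (x - z) \<le> norm (x - y) + norm (y - z)" using norm_triangle_ineq[of "x - y" "y - z"] by simp
        then have "norm (x - z) \<le> 2 * norm (y - z)" using False yx R by linarith
        then have "norm (x - z) powr (2 * \<alpha>) \<le> (2 * norm (y - z)) powr (2 * \<alpha>)" using \<alpha> by (intro powr_mono2) auto
        then have *: "norm (x - z) powr (2 * \<alpha>) \<le> 2 powr (2 * \<alpha>) * norm (y - z) powr (2 * \<alpha>)" by (simp add: powr_mult)
        have p: "norm (x - z) powr (2 * \<alpha>) > 0" "norm (y - z) powr (2 * \<alpha>) > 0"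
          using False R \<open>norm (x - z) \<le> 2 * norm (y - z)\<close> by auto
        have "1 / norm (y - z) powr (2 * \<alpha>) \<le> 2 powr (2 * \<alpha>) / norm (x - z) powr (2 * \<alpha>)"
          using * p by (simp add: field_simps)
        then have "(u z)\<^sup>2 * (1 / norm (y - z) powr (2 * \<alpha>)) \<le> (u z)\<^sup>2 * (2 powr (2 * \<alpha>) / norm (x - z) powr (2 * \<alpha>))"
          by (rule mult_left_mono) simp
        then have "(u z)\<^sup>2 / norm (y - z) powr (2 * \<alpha>) \<le> 2 powr (2 * \<alpha>) * ((u z)\<^sup>2 / norm (x - z) powr (2 * \<alpha>))"
          by (simp add: mult_ac)
        moreover have "0 \<le> M\<^sup>2 * ?h (z - y)" by (simp add: indicator_def)
        ultimately show ?thesis by linarith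
      qed
    qed (rule i, rule Bochner_Integration.integrable_add[OF i1 i2])
    also have "\<dots> = M\<^sup>2 * T + 2 powr (2 * \<alpha>) * P \<alpha> u x"
      unfolding T P_def
      by (simp only: Bochner_Integration.integral_add[OF i1 i2] integral_mult_right_zero)
    finally show ?thesis .
  qed
  moreover have "0 \<le> M\<^sup>2 * T + 2 powr (2 * \<alpha>) * P \<alpha> u x"
    unfolding T_def using P_nonneg[of \<alpha> u x]
    by (intro add_nonneg_nonneg mult_nonneg_nonneg Bochner_Integration.integral_nonneg) auto
  ultimately show ?thesis by blast
qed

text \<open>Reflecting the exterior of the ball into its interior turns the difference of the two
  nonlocal terms into an integral over the ball against the positive kernel \<open>K - K'\<close>.\<close>

lemma kelvin_P_difference:
  fixes u :: "'a::euclidean_space \<Rightarrow> real"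
  assumes i: "\<And>y. integrable lborel (\<lambda>z. (u z)\<^sup>2 / norm (y - z) powr (2 * \<alpha>))"
    and \<alpha>: "0 < \<alpha>" "2 * \<alpha> < real DIM('a)" and r: "r > 0" and u: "continuous_on UNIV u" "\<And>z. u z > 0"
    and y: "y \<noteq> x" "norm (y - x) < r"
    and M: "\<And>z. z \<in> ball x r \<Longrightarrow> u z \<le> M" and \<mu>: "0 \<le> \<mu>" "\<And>z. z \<in> ball x r - {x} \<Longrightarrow> - \<mu> \<le> omega \<alpha> u x r z"
  shows "P \<alpha> u y - (r / norm (y - x)) powr (2 * \<alpha>) * P \<alpha> u (inversion x r y)
    \<le> 2 * M * \<mu> * (\<integral>z. indicator (ball 0 (2 * r)) z * (1 / norm (0 - z :: 'a) powr (2 * \<alpha>)) \<partial>lborel)"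
proof -
  let ?n = "DIM('a)"
  let ?T = "\<integral>z. indicator (ball 0 (2 * r)) z * (1 / norm (0 - z :: 'a) powr (2 * \<alpha>)) \<partial>lborel"
  define k where "k = kelvin \<alpha> u x r"
  define I where "I = inversion x r"
  have [measurable]: "u \<in> borel_measurable borel" using u(1) by (rule borel_measurable_continuous_onI)
  have Im [measurable]: "I \<in> borel_measurable borel" unfolding I_def by (rule borel_measurable_inversion)
  have km [measurable]: "k \<in> borel_measurable borel"
    unfolding k_def kelvin_def[abs_def] I_def[symmetric] by measurable
  define K where "K = (\<lambda>z. 1 / norm (y - z) powr (2 * \<alpha>))"
  have [measurable]: "K \<in> borel_measurable borel" unfolding K_def by measurable
  have uI: "integrable lborel (\<lambda>z. (u z)\<^sup>2 * K z)" using i[of y] by (simp add: K_def)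
  define s where "s = norm (y - x)"
  have s: "s > 0" using y by (simp add: s_def)
  \<comment> \<open>The exponents balance as 2n = 2(n-\<alpha>) + 2\<alpha>: the first part turns
    u^2 at the reflected point into k^2, the second is absorbed by the kernel. Thus the rescaled
    \<open>P\<close> at \<open>I y\<close> is the integral of k^2 against the kernel at
    \<open>y\<close>.\<close>
  have ksq: "(r / norm (z - x)) ^ (2 * ?n) * ((u (I z))\<^sup>2 / norm (I y - I z) powr (2 * \<alpha>))
      = (s / r) powr (2 * \<alpha>) * ((k z)\<^sup>2 * K z)" if z: "z \<noteq> x" for z
  proof -
    define t where "t = norm (z - x)"
    have t: "t > 0" using z by (simp add: t_def)
    have "norm (I y - I z) = (r\<^sup>2 / (s * t)) * norm (y - z)"
      unfolding I_def using dist_inversion[OF r y(1) z] by (simp add: s_def t_def)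
    then have 1: "norm (I y - I z) powr (2 * \<alpha>) = (r\<^sup>2 / (s * t)) powr (2 * \<alpha>) * norm (y - z) powr (2 * \<alpha>)"
      using s t by (simp only:) (subst powr_mult, auto)
    have 2: "(k z)\<^sup>2 = (r / t) powr (2 * (real ?n - \<alpha>)) * (u (I z))\<^sup>2"
      unfolding k_def kelvin_def I_def t_def[symmetric] using r t
      by (simp add: power_mult_distrib powr_power mult.commute)
    have 3: "(r / t) ^ (2 * ?n) = (r / t) powr (2 * (real ?n - \<alpha>)) * (r / t) powr (2 * \<alpha>)"
      using r t by (simp add: powr_add[symmetric] powr_realpow[symmetric] right_diff_distrib)
    have 4: "(r / t) powr (2 * \<alpha>) = (s / r) powr (2 * \<alpha>) * (r\<^sup>2 / (s * t)) powr (2 * \<alpha>)"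
      using r t s by (subst powr_mult[symmetric]) (auto simp: power2_eq_square)
    have "(r\<^sup>2 / (s * t)) powr (2 * \<alpha>) > 0" using r t s by simp
    moreover have "A * (B * X) * (U / (X * N)) = B * (A * U * (1 / N))" if "X > 0" for A B X U N :: real
      using that by simp
    ultimately show ?thesis
      unfolding t_def[symmetric] 3 1 2 K_def 4 by (simp only:)
  qed
  have ae: "AE z in lborel. (r / norm (z - x)) ^ (2 * ?n) * ((u (I z))\<^sup>2 / norm (I y - I z) powr (2 * \<alpha>))
      = (s / r) powr (2 * \<alpha>) * ((k z)\<^sup>2 * K z)"
    by (rule AE_mp[OF AE_lborel_singleton[of x]]) (use ksq in auto)
  have Pm: "(\<lambda>z. (u z)\<^sup>2 / norm (I y - z) powr (2 * \<alpha>)) \<in> borel_measurable borel" by measurable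
  have kI: "integrable lborel (\<lambda>z. (k z)\<^sup>2 * K z)"
  proof -
    have "integrable lborel (\<lambda>z. (r / norm (z - x)) ^ (2 * ?n) * ((u (I z))\<^sup>2 / norm (I y - I z) powr (2 * \<alpha>)))"
      using integrable_inversion_iff[OF r Pm, of x] i[of "I y"] unfolding I_def by simp
    then have "integrable lborel (\<lambda>z. (s / r) powr (2 * \<alpha>) * ((k z)\<^sup>2 * K z))"
      by (subst (asm) integrable_cong_AE[OF _ _ ae]) (simp_all, measurable)
    then show ?thesis using s r by simp
  qed
  have "P \<alpha> u (I y) = (\<integral>z. (s / r) powr (2 * \<alpha>) * ((k z)\<^sup>2 * K z) \<partial>lborel)"
  proof -
    have "P \<alpha> u (I y) = (\<integral>z. (r / norm (z - x)) ^ (2 * ?n) * ((u (I z))\<^sup>2 / norm (I y - I z) powr (2 * \<alpha>)) \<partial>lborel)"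
      unfolding P_def using integral_inversion[OF r Pm, of x] by (simp add: I_def)
    also have "\<dots> = (\<integral>z. (s / r) powr (2 * \<alpha>) * ((k z)\<^sup>2 * K z) \<partial>lborel)"
      by (rule integral_cong_AE[OF _ _ ae]) (simp_all, measurable)
    finally show ?thesis .
  qed
  then have "(r / s) powr (2 * \<alpha>) * P \<alpha> u (I y) = ((r / s) powr (2 * \<alpha>) * (s / r) powr (2 * \<alpha>)) * (\<integral>z. (k z)\<^sup>2 * K z \<partial>lborel)"
    by simp
  also have "(r / s) powr (2 * \<alpha>) * (s / r) powr (2 * \<alpha>) = 1"
    using r s by (subst powr_mult[symmetric]) auto
  finally have Pk: "(r / s) powr (2 * \<alpha>) * P \<alpha> u (I y) = (\<integral>z. (k z)\<^sup>2 * K z \<partial>lborel)" by simp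
  define G where "G = (\<lambda>z. ((u z)\<^sup>2 - (k z)\<^sup>2) * K z)"
  have Gm [measurable]: "G \<in> borel_measurable borel" unfolding G_def by measurable
  have GI: "integrable lborel G"
    unfolding G_def left_diff_distrib using uI kI by (rule Bochner_Integration.integrable_diff)
  have diff: "P \<alpha> u y - (r / s) powr (2 * \<alpha>) * P \<alpha> u (I y) = (\<integral>z. G z \<partial>lborel)"
    unfolding Pk unfolding G_def left_diff_distrib
    by (subst Bochner_Integration.integral_diff[OF uI kI]) (simp add: P_def K_def)
  let ?B = "ball x r"
  have [measurable]: "?B \<in> sets borel" by simp
  define G' where "G' = (\<lambda>z. (r / norm (z - x)) ^ (2 * ?n) * (indicator (- ?B) (I z) * G (I z)))"
  have cm: "(\<lambda>z. indicator (- ?B) z * G z) \<in> borel_measurable borel" by measurable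
  have ci: "integrable lborel (\<lambda>z. indicator (- ?B) z * G z)"
    using integrable_mult_indicator[of "- ?B" lborel G] GI by simp
  have bi: "integrable lborel (\<lambda>z. indicator ?B z * G z)"
    using integrable_mult_indicator[of "?B" lborel G] GI by simp
  have G'i: "integrable lborel G'"
    unfolding G'_def I_def using integrable_inversion_iff[OF r cm, of x] ci by simp
  have "(\<integral>z. G z \<partial>lborel) = (\<integral>z. indicator ?B z * G z + indicator (- ?B) z * G z \<partial>lborel)"
    by (rule Bochner_Integration.integral_cong) (auto simp: indicator_def)
  also have "\<dots> = (\<integral>z. indicator ?B z * G z \<partial>lborel) + (\<integral>z. indicator (- ?B) z * G z \<partial>lborel)"
    by (rule Bochner_Integration.integral_add[OF bi ci])
  also have "(\<integral>z. indicator (- ?B) z * G z \<partial>lborel) = (\<integral>z. G' z \<partial>lborel)"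
    unfolding G'_def I_def by (rule integral_inversion[OF r cm, symmetric])
  also have "(\<integral>z. indicator ?B z * G z \<partial>lborel) + (\<integral>z. G' z \<partial>lborel) = (\<integral>z. indicator ?B z * G z + G' z \<partial>lborel)"
    by (rule Bochner_Integration.integral_add[OF bi G'i, symmetric])
  finally have GG: "(\<integral>z. G z \<partial>lborel) = (\<integral>z. indicator ?B z * G z + G' z \<partial>lborel)" .
  let ?h = "\<lambda>z. indicator (ball (0::'a) (2 * r)) z * (1 / norm (0 - z) powr (2 * \<alpha>))"
  have [measurable]: "ball (0::'a) (2 * r) \<in> sets borel" by simp
  have hi: "integrable lborel (\<lambda>z. ?h (z - y))"
    using integrable_kernel_near[of "2 * \<alpha>" "2 * r" 0] \<alpha> r by (subst integrable_lborel_shift) auto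
  have T: "?T = (\<integral>z. ?h (z - y) \<partial>lborel)" by (rule integral_lborel_shift[symmetric]) measurable
  have M0: "M \<ge> 0" using M[of x] u(2)[of x] r by (simp add: less_eq_real_def order_trans less_le_trans)
  have pw: "indicator ?B z * G z + G' z \<le> 2 * M * \<mu> * ?h (z - y)" if z: "z \<noteq> x" and zy: "y \<noteq> z" for z
  proof -
    define t where "t = norm (z - x)"
    have t: "t > 0" using z by (simp add: t_def)
    have It: "norm (I z - x) = r\<^sup>2 / t" by (simp add: I_def norm_inversion t_def)
    have rhs: "0 \<le> 2 * M * \<mu> * ?h (z - y)" using M0 \<mu> by (simp add: indicator_def)
    define K' where "K' = (r / t) powr (2 * \<alpha>) / norm (y - I z) powr (2 * \<alpha>)"
    have GIz: "(r / t) ^ (2 * ?n) * G (I z) = ((k z)\<^sup>2 - (u z)\<^sup>2) * K'"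
    proof -
      have kI: "k (I z) = (t / r) powr (real ?n - \<alpha>) * u z"
        unfolding k_def I_def t_def using r z by (rule kelvin_inversion)
      have uIz: "u (I z) = (t / r) powr (real ?n - \<alpha>) * k z"
      proof -
        have "(t / r) powr (real ?n - \<alpha>) * (r / t) powr (real ?n - \<alpha>) = 1"
          using r t by (subst powr_mult[symmetric]) simp_all
        then show ?thesis unfolding k_def kelvin_def I_def t_def[symmetric] by (simp add: mult.assoc[symmetric])
      qed
      have 3: "(r / t) ^ (2 * ?n) = (r / t) powr (real ?n - \<alpha>) * (r / t) powr (real ?n - \<alpha>) * (r / t) powr (2 * \<alpha>)"
        using r t by (simp add: powr_add[symmetric] powr_realpow[symmetric])
      have 4: "(r / t) powr (real ?n - \<alpha>) * (t / r) powr (real ?n - \<alpha>) = 1"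
        using r t by (subst powr_mult[symmetric]) simp_all
      have gen: "a * a * c * (((b * k1)\<^sup>2 - (b * u1)\<^sup>2) * (1 / N)) = (k1\<^sup>2 - u1\<^sup>2) * (c / N)" if "a * b = 1" for a b c k1 u1 N :: real
      proof -
        have "a * a * c * (((b * k1)\<^sup>2 - (b * u1)\<^sup>2) * (1 / N)) = (a * b) * (a * b) * ((k1\<^sup>2 - u1\<^sup>2) * (c / N))"
          by (simp add: power2_eq_square algebra_simps diff_divide_distrib)
        then show ?thesis using that by simp
      qed
      show ?thesis unfolding G_def K_def K'_def 3 kI uIz by (rule gen[OF 4])
    qed
    show ?thesis
    proof (cases "t \<le> r")
      case False
      then have "r\<^sup>2 / t < r" using r t by (simp add: field_simps power2_eq_square)
      then have "I z \<in> ?B" using It by (simp add: dist_norm norm_minus_commute)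
      moreover have "z \<notin> ?B" using False by (simp add: dist_norm norm_minus_commute t_def)
      ultimately show ?thesis using rhs by (simp add: G'_def)
    next
      case True
      then have "r \<le> r\<^sup>2 / t" using r t by (simp add: field_simps power2_eq_square)
      then have "I z \<notin> ?B" using It by (simp add: dist_norm norm_minus_commute)
      then have G'z: "G' z = ((k z)\<^sup>2 - (u z)\<^sup>2) * K'" unfolding G'_def t_def[symmetric] using GIz by simp
      show ?thesis
      proof (cases "t = r")
        case True
        then have "I z = z" using r by (simp add: I_def inversion_def t_def)
        then have "k z = u z" using True r by (simp add: k_def kelvin_def t_def I_def[symmetric])
        moreover have "z \<notin> ?B" using True by (simp add: dist_norm norm_minus_commute t_def)
        ultimately show ?thesis using rhs G'z by simp
      next
        case False
        then have zB: "z \<in> ?B" using \<open>t \<le> r\<close> by (simp add: dist_norm norm_minus_commute t_def)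
        have "norm (y - z) \<le> norm (y - I z) * t / r"
          unfolding I_def t_def using r y(2) \<open>t \<le> r\<close> z by (intro dist_inversion_ge) (auto simp: t_def)
        then have KK: "K' \<le> K z" if "y \<noteq> z"
        proof -
          have p: "norm (y - z) > 0" using that by simp
          have q: "norm (y - I z) > 0"
            using p \<open>norm (y - z) \<le> norm (y - I z) * t / r\<close> by (cases "norm (y - I z) = 0") auto
          have "norm (y - z) powr (2 * \<alpha>) \<le> (norm (y - I z) * (t / r)) powr (2 * \<alpha>)"
            using \<open>norm (y - z) \<le> norm (y - I z) * t / r\<close> \<alpha> by (intro powr_mono2) auto
          also have "\<dots> = norm (y - I z) powr (2 * \<alpha>) * (t / r) powr (2 * \<alpha>)"
            using t r by (subst powr_mult) auto
          finally have 1: "norm (y - z) powr (2 * \<alpha>) \<le> norm (y - I z) powr (2 * \<alpha>) * (t / r) powr (2 * \<alpha>)" .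
          have 2: "(r / t) powr (2 * \<alpha>) * (t / r) powr (2 * \<alpha>) = 1"
            using r t by (subst powr_mult[symmetric]) simp_all
          have "(r / t) powr (2 * \<alpha>) * norm (y - z) powr (2 * \<alpha>) \<le> (r / t) powr (2 * \<alpha>) * (norm (y - I z) powr (2 * \<alpha>) * (t / r) powr (2 * \<alpha>))"
            using 1 by (rule mult_left_mono) simp
          also have "\<dots> = norm (y - I z) powr (2 * \<alpha>)" using 2 by (simp add: mult_ac)
          finally show ?thesis unfolding K'_def K_def using p q by (simp add: field_simps)
        qed
        have K'0: "K' \<ge> 0" unfolding K'_def by simp
        have uk: "u z - k z \<le> \<mu>" using \<mu>(2)[of z] zB z by (simp add: omega_def k_def)
        have uM: "u z \<le> M" using zB by (rule M)
        have k0: "k z \<ge> 0" unfolding k_def kelvin_def using u(2)[of "inversion x r z"] by simp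
        have dK: "norm (y - z) < 2 * r"
          using norm_triangle_ineq4[of "y - x" "z - x"] y(2) \<open>t \<le> r\<close> by (simp add: t_def)
        have hz: "?h (z - y) = K z" using dK by (simp add: K_def norm_minus_commute)
        have lhs: "indicator ?B z * G z + G' z = ((u z)\<^sup>2 - (k z)\<^sup>2) * (K z - K')"
          unfolding G'z using zB by (simp add: G_def algebra_simps)
        have "((u z)\<^sup>2 - (k z)\<^sup>2) \<le> 2 * M * \<mu>"
        proof (cases "u z \<le> k z")
          case True
          then have "(u z)\<^sup>2 \<le> (k z)\<^sup>2" using u(2)[of z] by (intro power_mono) auto
          moreover have "0 \<le> 2 * M * \<mu>" using M0 \<mu> by simp
          ultimately show ?thesis by linarith
        next
          case False
          have "(u z)\<^sup>2 - (k z)\<^sup>2 = (u z + k z) * (u z - k z)" by (simp add: power2_eq_square algebra_simps)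
          also have "\<dots> \<le> (2 * M) * \<mu>" using False uk uM k0 M0 by (intro mult_mono) auto
          finally show ?thesis by simp
        qed
        then have "((u z)\<^sup>2 - (k z)\<^sup>2) * (K z - K') \<le> (2 * M * \<mu>) * (K z - K')"
          using KK[OF zy] by (intro mult_right_mono) auto
        also have "\<dots> \<le> (2 * M * \<mu>) * K z" using M0 \<mu> K'0 by (intro mult_left_mono) auto
        finally show ?thesis unfolding lhs hz .
      qed
    qed
  qed
  have "(\<integral>z. indicator ?B z * G z + G' z \<partial>lborel) \<le> (\<integral>z. 2 * M * \<mu> * ?h (z - y) \<partial>lborel)"
  proof (rule integral_mono_AE)
    show "AE z in lborel. indicator ?B z * G z + G' z \<le> 2 * M * \<mu> * ?h (z - y)"
      using AE_lborel_singleton[of x] AE_lborel_singleton[of y] by eventually_elim (rule pw, auto)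
    show "integrable lborel (\<lambda>z. indicator ?B z * G z + G' z)"
      using bi G'i by (rule Bochner_Integration.integrable_add)
    show "integrable lborel (\<lambda>z. 2 * M * \<mu> * ?h (z - y))"
      using hi by (rule integrable_mult_right)
  qed
  also have "\<dots> = 2 * M * \<mu> * ?T" unfolding T by (rule integral_mult_right_zero)
  finally show ?thesis using diff GG unfolding s_def I_def by simp
qed

section \<open>Narrow regions\<close>

text \<open>The antisymmetry \<open>omega_inversion\<close> folds the exterior integral into the ball, where the reflected
  kernel \<open>K2\<close> is dominated by \<open>K\<close>; only the exterior mass of the kernel survives.\<close>

lemma omega_pv_bound:
  fixes u :: "'a::euclidean_space \<Rightarrow> real"
  assumes \<alpha>: "0 < \<alpha>" and r: "r > 0" and L: "omega \<alpha> u x r \<in> L_space \<alpha>"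
    and y: "negative_minimum_at \<alpha> u x r y" and cont: "isCont (omega \<alpha> u x r) y"
  shows "\<forall>\<^sub>F \<epsilon> in at_right 0. (LINT z:{z. norm (z - y) \<ge> \<epsilon>}|lborel.
       (omega \<alpha> u x r y - omega \<alpha> u x r z) / norm (y - z) powr (real DIM('a) + \<alpha>))
     \<le> omega \<alpha> u x r y * (\<integral>z. indicator (- ball x r) z * (1 / norm (y - z) powr (real DIM('a) + \<alpha>)) \<partial>lborel)"
proof -
  let ?n = "DIM('a)"
  let ?s = "real ?n + \<alpha>"
  define w where "w = omega \<alpha> u x r"
  have [measurable]: "w \<in> borel_measurable borel" unfolding w_def using L by (rule L_space_measurable)
  have yB: "y \<in> ball x r" "y \<noteq> x" and wy: "w y < 0" and wmin: "\<And>z. z \<in> ball x r \<Longrightarrow> z \<noteq> x \<Longrightarrow> w y \<le> w z"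
    using y unfolding negative_minimum_at_def w_def by auto
  define d where "d = r - norm (y - x)"
  have d: "d > 0" using yB by (simp add: d_def dist_norm norm_minus_commute)
  let ?B = "ball x r"
  have [measurable]: "?B \<in> sets borel" by simp
  have "(w \<longlongrightarrow> w y) (nhds y)" using cont unfolding w_def by (simp only: isCont_def tendsto_at_iff_tendsto_nhds)
  then have "\<forall>\<^sub>F z in nhds y. w z < 0" using wy by (rule order_tendstoD)
  then obtain e0 where e0: "e0 > 0" "\<And>z. dist z y < e0 \<Longrightarrow> w z < 0"
    unfolding eventually_nhds_metric by blast
  define K where "K = (\<lambda>z. 1 / norm (y - z) powr ?s)"
  have [measurable]: "K \<in> borel_measurable borel" unfolding K_def by measurable
  have far: "d \<le> norm (z - y)" if "z \<notin> ?B" for z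
    using that norm_triangle_ineq[of "z - y" "y - x"] by (simp add: d_def dist_norm norm_minus_commute)
  have Ki: "integrable lborel (\<lambda>z. indicator (- ?B) z * K z)"
  proof (rule Bochner_Integration.integrable_bound[OF integrable_kernel_far[of ?s d y]])
    show "AE z in lborel. norm (indicator (- ?B) z * K z) \<le> norm (indicator {z. d \<le> norm (z - y)} z * (1 / norm (y - z) powr ?s))"
      using far by (intro AE_I2) (auto simp: indicator_def K_def)
  qed (use \<alpha> d in auto)
  have wi: "integrable lborel (\<lambda>z. indicator (- ?B) z * (w z * K z))"
  proof (rule Bochner_Integration.integrable_bound[OF integrable_L_space_far[OF L \<alpha> d, of y]])
    show "AE z in lborel. norm (indicator (- ?B) z * (w z * K z)) \<le> norm (indicator {z. d \<le> norm (z - y)} z * (omega \<alpha> u x r z / norm (y - z) powr ?s))"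
      using far by (intro AE_I2) (auto simp: indicator_def K_def w_def)
  qed auto
  define W where "W = (\<lambda>z. (r / norm (z - x)) ^ (2 * ?n) * (indicator (- ?B) (inversion x r z) * (w (inversion x r z) * K (inversion x r z))))"
  have wm: "(\<lambda>z. indicator (- ?B) z * (w z * K z)) \<in> borel_measurable borel" by measurable
  have Wi: "integrable lborel W" unfolding W_def using integrable_inversion_iff[OF r wm, of x] wi by simp
  have WI: "(\<integral>z. indicator (- ?B) z * (w z * K z) \<partial>lborel) = (\<integral>z. W z \<partial>lborel)"
    unfolding W_def by (rule integral_inversion[OF r wm, symmetric])
  \<comment> \<open>\<epsilon> < d keeps the excised ball inside \<open>?B\<close>, so the exterior
    is counted in full. \<epsilon> < e0 keeps \<omega> negative on the excised ball, where the
    folded exterior term - \<open>W\<close> is present without a matching interior term.\<close>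
  have main: "(LINT z:{z. norm (z - y) \<ge> \<epsilon>}|lborel. (w y - w z) / norm (y - z) powr ?s)
     \<le> w y * (\<integral>z. indicator (- ?B) z * K z \<partial>lborel)" if \<epsilon>: "0 < \<epsilon>" "\<epsilon> < d" "\<epsilon> < e0" for \<epsilon>
  proof -
    let ?N = "{z. \<epsilon> \<le> norm (z - y)}"
    have Ni: "integrable lborel (\<lambda>z. indicator ?N z * ((w y - w z) / norm (y - z) powr ?s))"
      unfolding w_def using L \<alpha> \<epsilon>(1) by (rule integrable_frac_kernel)
    define F where "F = (\<lambda>z. indicator ?B z * (indicator ?N z * ((w y - w z) / norm (y - z) powr ?s)))"
    have Fi: "integrable lborel F"
      unfolding F_def using integrable_mult_indicator[OF _ Ni, of ?B] by simp
    have pw: "F z - W z \<le> 0" if z: "z \<noteq> x" for z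
    proof -
      define t where "t = norm (z - x)"
      have t: "t > 0" using z by (simp add: t_def)
      define I where "I = inversion x r z"
      have It: "norm (I - x) = r\<^sup>2 / t" by (simp add: I_def norm_inversion t_def)
      show ?thesis
      proof (cases "t \<le> r")
        case False
        then have "r\<^sup>2 / t < r" using r t by (simp add: field_simps power2_eq_square)
        then have "I \<in> ?B" using It by (simp add: dist_norm norm_minus_commute)
        moreover have "z \<notin> ?B" using False by (simp add: dist_norm norm_minus_commute t_def)
        ultimately show ?thesis by (simp add: F_def W_def I_def)
      next
        case True
        then have "r \<le> r\<^sup>2 / t" using r t by (simp add: field_simps power2_eq_square)
        then have INB: "I \<notin> ?B" using It by (simp add: dist_norm norm_minus_commute)
        define K2 where "K2 = (r / t) powr ?s / norm (y - I) powr ?s"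
        have K20: "K2 \<ge> 0" unfolding K2_def by simp
        have Wz: "W z = - (w z * K2)"
        proof -
          have "w I = - ((t / r) powr (real ?n - \<alpha>) * w z)"
            unfolding w_def I_def t_def using r z by (rule omega_inversion)
          moreover have "(r / t) ^ (2 * ?n) = (r / t) powr ?s * (r / t) powr (real ?n - \<alpha>)"
            using r t by (simp add: powr_add[symmetric] powr_realpow[symmetric])
          moreover have "(r / t) powr (real ?n - \<alpha>) * (t / r) powr (real ?n - \<alpha>) = 1"
            using r t by (subst powr_mult[symmetric]) simp_all
          moreover have "a * b * (- (c * v) * (1 / N)) = - (v * (a / N))" if "b * c = 1" for a b c v N :: real
          proof -
            have "a * b * (- (c * v) * (1 / N)) = - ((b * c) * (v * (a / N)))" by simp
            then show ?thesis using that by simp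
          qed
          ultimately show ?thesis
            unfolding W_def I_def[symmetric] t_def[symmetric] K2_def K_def using INB by simp
        qed
        show ?thesis
        proof (cases "t = r")
          case True
          then have "inversion x r z = z" using r by (simp add: inversion_def t_def)
          then have "w z = 0" using True r by (simp add: w_def omega_def kelvin_def t_def)
          moreover have "z \<notin> ?B" using True by (simp add: dist_norm norm_minus_commute t_def)
          ultimately show ?thesis using Wz by (simp add: F_def)
        next
          case False
          then have zB: "z \<in> ?B" using True by (simp add: dist_norm norm_minus_commute t_def)
          have wz: "w y \<le> w z" using wmin zB z by blast
          show ?thesis
          proof (cases "z \<in> ?N")
            case False
            then have "w z < 0" by (intro e0(2)) (use \<epsilon> in \<open>simp add: dist_norm\<close>)
            then have "w z * K2 \<le> 0" using K20 by (simp add: mult_nonpos_nonneg)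
            then show ?thesis using False Wz by (simp add: F_def)
          next
            case True
            then have p: "norm (y - z) > 0" using \<epsilon> by (auto simp: norm_minus_commute)
            have le: "norm (y - z) \<le> norm (y - I) * t / r"
              unfolding I_def t_def using r yB \<open>t \<le> r\<close> z
              by (intro dist_inversion_ge) (auto simp: t_def dist_norm norm_minus_commute)
            then have q: "norm (y - I) > 0" using p by (cases "norm (y - I) = 0") auto
            have KK: "K2 \<le> K z"
            proof -
              have "norm (y - z) powr ?s \<le> (norm (y - I) * (t / r)) powr ?s"
                using le \<alpha> by (intro powr_mono2) auto
              also have "\<dots> = norm (y - I) powr ?s * (t / r) powr ?s"
                using t r by (subst powr_mult) auto
              finally have "(r / t) powr ?s * norm (y - z) powr ?s \<le> (r / t) powr ?s * (norm (y - I) powr ?s * (t / r) powr ?s)"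
                by (rule mult_left_mono) simp
              also have "\<dots> = norm (y - I) powr ?s * ((r / t) powr ?s * (t / r) powr ?s)" by simp
              also have "(r / t) powr ?s * (t / r) powr ?s = 1"
                using r t by (subst powr_mult[symmetric]) simp_all
              finally show ?thesis unfolding K2_def K_def using p q by (simp add: field_simps)
            qed
            \<comment> \<open>Since w y - w z \<le> 0, replacing K by the smaller \<open>K2\<close>
              can only increase the product; adding the reflected term w z K2 then leaves w y K2,
              which is at most 0.\<close>
            have "(w y - w z) * K z \<le> (w y - w z) * K2" using KK wz by (intro mult_left_mono_neg) auto
            moreover have "w y * K2 \<le> 0" using wy K20 by (simp add: mult_nonpos_nonneg)
            ultimately have "(w y - w z) * K z + w z * K2 \<le> 0" by (simp add: algebra_simps)
            moreover have "F z = (w y - w z) * K z" using True zB by (simp add: F_def K_def)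
            ultimately show ?thesis using Wz by simp
          qed
        qed
      qed
    qed
    have "(LINT z:{z. norm (z - y) \<ge> \<epsilon>}|lborel. (w y - w z) / norm (y - z) powr ?s)
        = (\<integral>z. F z + (w y * (indicator (- ?B) z * K z) - indicator (- ?B) z * (w z * K z)) \<partial>lborel)"
      unfolding set_lebesgue_integral_def
    proof (rule Bochner_Integration.integral_cong[OF refl])
      fix z
      show "indicator {z. norm (z - y) \<ge> \<epsilon>} z *\<^sub>R ((w y - w z) / norm (y - z) powr ?s)
          = F z + (w y * (indicator (- ?B) z * K z) - indicator (- ?B) z * (w z * K z))"
      proof (cases "z \<in> ?B")
        case False
        then have "\<epsilon> \<le> norm (z - y)" using far[of z] \<epsilon> by simp
        then show ?thesis using False by (simp add: F_def K_def diff_divide_distrib)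
      qed (simp add: F_def)
    qed
    also have "\<dots> = (\<integral>z. F z \<partial>lborel) + (w y * (\<integral>z. indicator (- ?B) z * K z \<partial>lborel) - (\<integral>z. W z \<partial>lborel))"
      using Fi Ki wi by (simp only: Bochner_Integration.integral_add Bochner_Integration.integral_diff
        Bochner_Integration.integrable_diff integrable_mult_right integral_mult_right_zero WI)
    also have "\<dots> = (\<integral>z. F z - W z \<partial>lborel) + w y * (\<integral>z. indicator (- ?B) z * K z \<partial>lborel)"
      using Fi Wi by simp
    also have "(\<integral>z. F z - W z \<partial>lborel) \<le> (\<integral>z. 0 \<partial>(lborel :: 'a measure))"
    proof (rule integral_mono_AE)
      show "AE z in lborel. F z - W z \<le> 0"
        using AE_lborel_singleton[of x] by eventually_elim (rule pw)
    qed (use Fi Wi in auto)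
    finally show ?thesis by simp
  qed
  have "\<forall>\<^sub>F \<epsilon> in at_right 0. \<epsilon> \<in> {0<..<min d e0}"
    using d e0 by (intro eventually_at_right_real) auto
  then show ?thesis
    unfolding w_def[symmetric] K_def[symmetric] by eventually_elim (rule main[unfolded K_def], auto)
qed

text \<open>With d the distance to the sphere, the ball of radius d whose centre lies 2d beyond
  \<open>y\<close> on the ray from \<open>x\<close> is outside and within 3d of \<open>y\<close>.
  Its volume, of order d^n, against a kernel of at least (3d)^(-n-\<alpha>) gives
  d^(-\<alpha>).\<close>

lemma exterior_kernel_mass:
  fixes x y :: "'a::euclidean_space"
  assumes \<alpha>: "0 < \<alpha>" and y: "y \<in> ball x r" "y \<noteq> x"
  shows "(measure lborel (ball (0::'a) 1) / 3 powr (real DIM('a) + \<alpha>)) * (r - norm (y - x)) powr (- \<alpha>)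
    \<le> (\<integral>z. indicator (- ball x r) z * (1 / norm (y - z) powr (real DIM('a) + \<alpha>)) \<partial>lborel)"
proof -
  let ?n = "DIM('a)"
  let ?s = "real ?n + \<alpha>"
  define d where "d = r - norm (y - x)"
  have d: "d > 0" using y by (simp add: d_def dist_norm norm_minus_commute)
  have N: "norm (y - x) > 0" using y by simp
  define c where "c = y + (2 * d / norm (y - x)) *\<^sub>R (y - x)"
  have cx: "norm (c - x) = r + d"
  proof -
    have "c - x = (1 + 2 * d / norm (y - x)) *\<^sub>R (y - x)" by (simp add: c_def scaleR_add_left)
    then have "norm (c - x) = \<bar>1 + 2 * d / norm (y - x)\<bar> * norm (y - x)" by (simp only: norm_scaleR)
    also have "\<bar>1 + 2 * d / norm (y - x)\<bar> = 1 + 2 * d / norm (y - x)" using d N by (intro abs_of_nonneg) simp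
    also have "(1 + 2 * d / norm (y - x)) * norm (y - x) = norm (y - x) + 2 * d" using N by (simp add: field_simps)
    finally show ?thesis by (simp add: d_def)
  qed
  have cy: "norm (c - y) = 2 * d" using N d by (simp add: c_def)
  have out: "z \<notin> ball x r" if "z \<in> ball c d" for z
    using that cx norm_triangle_ineq[of "c - z" "z - x"] by (simp add: dist_norm norm_minus_commute)
  have near: "norm (y - z) \<le> 3 * d" if "z \<in> ball c d" for z
    using that cy norm_triangle_ineq[of "y - c" "c - z"] by (simp add: dist_norm norm_minus_commute)
  have far: "d \<le> norm (z - y)" if "z \<notin> ball x r" for z
    using that norm_triangle_ineq[of "z - y" "y - x"] by (simp add: d_def dist_norm norm_minus_commute)
  have [measurable]: "ball x r \<in> sets borel" by simp
  have Ki: "integrable lborel (\<lambda>z. indicator (- ball x r) z * (1 / norm (y - z) powr ?s))"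
  proof (rule Bochner_Integration.integrable_bound[OF integrable_kernel_far[of ?s d y]])
    show "AE z in lborel. norm (indicator (- ball x r) z * (1 / norm (y - z) powr ?s)) \<le> norm (indicator {z. d \<le> norm (z - y)} z * (1 / norm (y - z) powr ?s))"
      using far by (intro AE_I2) (auto simp: indicator_def)
  qed (use \<alpha> d in auto)
  have Bi: "integrable lborel (\<lambda>z. 1 / (3 * d) powr ?s * indicator (ball c d) z)"
    by (intro integrable_mult_right integrable_real_indicator[OF _ emeasure_lborel_ball_finite]) simp
  have "(\<integral>z. 1 / (3 * d) powr ?s * indicator (ball c d) z \<partial>lborel) \<le> (\<integral>z. indicator (- ball x r) z * (1 / norm (y - z) powr ?s) \<partial>lborel)"
  proof (rule integral_mono[OF Bi Ki])
    fix z
    show "1 / (3 * d) powr ?s * indicator (ball c d) z \<le> indicator (- ball x r) z * (1 / norm (y - z) powr ?s)"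
    proof (cases "z \<in> ball c d")
      case True
      have "d \<le> norm (z - y)" using far out True by blast
      then have "0 < norm (y - z)" using d unfolding norm_minus_commute[of z y] by linarith
      then have "1 / (3 * d) powr ?s \<le> 1 / norm (y - z) powr ?s"
        using near[OF True] d \<alpha> by (intro divide_left_mono powr_mono2) (auto intro!: mult_pos_pos)
      then show ?thesis using True out by simp
    qed simp
  qed
  also have "(\<integral>z. 1 / (3 * d) powr ?s * indicator (ball c d) z \<partial>lborel) = 1 / (3 * d) powr ?s * measure lborel (ball c d)"
    by simp
  also have "measure lborel (ball c d) = measure lborel (ball (0::'a) 1) * d ^ ?n"
    using d by (simp add: content_ball)
  also have "1 / (3 * d) powr ?s * (measure lborel (ball (0::'a) 1) * d ^ ?n) = (measure lborel (ball (0::'a) 1) / 3 powr ?s) * d powr (- \<alpha>)"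
  proof -
    have "(3 * d) powr ?s = 3 powr ?s * (d ^ ?n * d powr \<alpha>)"
      using d by (simp add: powr_mult powr_add powr_realpow)
    then show ?thesis using d by (simp add: powr_minus field_simps)
  qed
  finally show ?thesis unfolding d_def .
qed

text \<open>Exponents of both signs occur: p1 - 1 is nonpositive and p2 - 1 may be either.
  Monotonicity puts the bound at one of the endpoints.\<close>

lemma powr_bounded_on_Icc:
  fixes q :: real
  assumes "0 < m"
  shows "\<exists>B\<ge>0. \<forall>t. m \<le> t \<and> t \<le> M \<longrightarrow> t powr q \<le> B"
proof (intro exI[of _ "max (m powr q) (M powr q)"] conjI allI impI)
  fix t assume t: "m \<le> t \<and> t \<le> M"
  show "t powr q \<le> max (m powr q) (M powr q)"
  proof (cases "q \<ge> 0")
    case True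
    then have "t powr q \<le> M powr q" using t assms by (intro powr_mono2) auto
    then show ?thesis by simp
  next
    case False
    then have "t powr q \<le> m powr q" using t assms by (intro powr_mono2') auto
    then show ?thesis by simp
  qed
qed (simp add: le_max_iff_disj)

text \<open>From the outer half of the ball the inversion leads at most to distance 2r from
  \<open>x\<close>, where the compactness minimum \<open>m\<close> applies, and the conformal factor
  is at least 1. This is why minima in the inner half are treated separately and why bounds for
  \<open>u\<close> are taken on \<open>cball x (2 * b)\<close>.\<close>

lemma kelvin_lower_bound:
  fixes u :: "'a::euclidean_space \<Rightarrow> real"
  assumes r: "0 < r" "r \<le> b" and y: "r / 2 \<le> norm (y - x)" "norm (y - x) < r"
    and m: "\<And>z. z \<in> cball x (2 * b) \<Longrightarrow> m \<le> u z" "m > 0" and \<alpha>: "\<alpha> < real DIM('a)"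
  shows "m \<le> kelvin \<alpha> u x r y"
proof -
  have N: "norm (y - x) > 0" using r y by linarith
  have "norm (inversion x r y - x) \<le> 2 * r"
    using r y N by (simp add: norm_inversion field_simps power2_eq_square)
  then have "m \<le> u (inversion x r y)" using r by (intro m) (simp add: dist_norm norm_minus_commute)
  moreover have "1 \<le> (r / norm (y - x)) powr (real DIM('a) - \<alpha>)"
    using N y \<alpha> by (intro ge_one_powr_ge_zero) auto
  ultimately have "1 * m \<le> (r / norm (y - x)) powr (real DIM('a) - \<alpha>) * u (inversion x r y)"
    using m(2) by (intro mult_mono) auto
  then show ?thesis by (simp add: kelvin_def)
qed

lemma riesz_integral_shift:
  fixes y :: "'a::euclidean_space"
  assumes \<alpha>: "0 < \<alpha>" "2 * \<alpha> < real DIM('a)" and R: "R > 0"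
  shows "integrable lborel (\<lambda>z. indicator (ball y R) z * (1 / norm (y - z) powr (2 * \<alpha>)))"
    and "(\<integral>z. indicator (ball y R) z * (1 / norm (y - z) powr (2 * \<alpha>)) \<partial>lborel)
      = (\<integral>z. indicator (ball 0 R) z * (1 / norm (0 - z :: 'a) powr (2 * \<alpha>)) \<partial>lborel)"
proof -
  show "integrable lborel (\<lambda>z. indicator (ball y R) z * (1 / norm (y - z) powr (2 * \<alpha>)))"
    using \<alpha> R by (intro integrable_kernel_near) auto
  have [measurable]: "ball (0::'a) R \<in> sets borel" by simp
  let ?h = "\<lambda>z::'a. indicator (ball 0 R) z * (1 / norm (0 - z) powr (2 * \<alpha>))"
  have "(\<integral>z. indicator (ball y R) z * (1 / norm (y - z) powr (2 * \<alpha>)) \<partial>lborel) = (\<integral>z. ?h (z - y) \<partial>lborel)"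
    by (intro Bochner_Integration.integral_cong) (auto simp: indicator_def dist_norm norm_minus_commute)
  also have "\<dots> = (\<integral>z. ?h z \<partial>lborel)" by (rule integral_lborel_shift) measurable
  finally show "(\<integral>z. indicator (ball y R) z * (1 / norm (y - z) powr (2 * \<alpha>)) \<partial>lborel) = (\<integral>z. ?h z \<partial>lborel)" .
qed

text \<open>At the minimum the fractional Laplacian is at most $C d^{-\alpha}$ times the minimum, \<open>d\<close> being the
  distance to the sphere; the differential inequality forbids this if \<open>d\<close> is small.\<close>

lemma narrow_region_frac:
  fixes u :: "'a::euclidean_space \<Rightarrow> real"
  assumes n: "DIM('a) \<ge> 2" and \<alpha>: "0 < \<alpha>" "\<alpha> < 2" "2 * \<alpha> < real DIM('a)"
    and c: "c1 \<ge> 0" "c2 \<ge> 0" and p: "0 < p1" "0 < p2"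
    and u: "continuous_on UNIV u" "\<And>y. u y > 0"
    and i: "c1 \<noteq> 0 \<Longrightarrow> (\<And>y. integrable lborel (\<lambda>z. (u z)\<^sup>2 / norm (y - z) powr (2 * \<alpha>)))"
    and ab: "0 < a" "a \<le> b"
  shows "\<exists>l0>0. \<forall>r y S. a \<le> r \<and> r \<le> b \<and> negative_minimum_at \<alpha> u x r y \<and> y \<in> S \<and>
      omega \<alpha> u x r \<in> L_space \<alpha> \<and> C11_loc_on S (omega \<alpha> u x r) \<and>
      frac_lap \<alpha> (omega \<alpha> u x r) y - L_coeff \<alpha> c1 c2 p1 p2 u x r y * omega \<alpha> u x r y
        - 2 * c1 * (LINT z:B_minus \<alpha> u x r|lborel. u z * omega \<alpha> u x r z / norm (y - z) powr (2 * \<alpha>)) * u y powr p1 \<ge> 0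
      \<longrightarrow> l0 \<le> r - norm (y - x)"
proof -
  let ?n = "DIM('a)"
  let ?s = "real ?n + \<alpha>"
  have b: "b > 0" using ab by simp
  then have b2: "2 * b > 0" by simp
  obtain m where m: "m > 0" "\<And>z. z \<in> cball x (2 * b) \<Longrightarrow> m \<le> u z"
    using positive_min_on_compact[OF u(1,2), of x "2 * b"] by blast
  obtain M where M: "M > 0" "\<And>z. z \<in> cball x (2 * b) \<Longrightarrow> u z \<le> M"
    using bounded_on_compact[OF u(1), of x "2 * b"] by blast
  \<comment> \<open>If \<open>c1 = 0\<close> no integrability is known for the integral in
    \<open>P\<close>; the term then enters only multiplied by 0, so any constant will do.\<close>
  obtain Pm where Pm: "Pm \<ge> 0" "\<And>y. c1 \<noteq> 0 \<Longrightarrow> y \<in> cball x b \<Longrightarrow> P \<alpha> u y \<le> Pm"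
  proof (cases "c1 = 0")
    case False
    then show ?thesis using P_bounded[OF i[OF False] \<alpha>(1,3) b u, of x] that by blast
  qed (use that[of 0] in auto)
  obtain B1 where B1: "B1 \<ge> 0" "\<And>t. m \<le> t \<Longrightarrow> t \<le> M \<Longrightarrow> t powr (p1 - 1) \<le> B1"
    using powr_bounded_on_Icc[OF m(1), of M "p1 - 1"] by blast
  obtain B2 where B2: "B2 \<ge> 0" "\<And>t. m \<le> t \<Longrightarrow> t \<le> M \<Longrightarrow> t powr (p2 - 1) \<le> B2"
    using powr_bounded_on_Icc[OF m(1), of M "p2 - 1"] by blast
  define T where "T = (\<integral>z. indicator (ball 0 (2 * b)) z * (1 / norm (0 - z :: 'a) powr (2 * \<alpha>)) \<partial>lborel)"
  have T: "T \<ge> 0" unfolding T_def by (intro Bochner_Integration.integral_nonneg) simp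
  \<comment> \<open>The total zeroth-order coefficient: the two parts of \<open>L_coeff\<close> and
    the nonlocal term, which is measured in units of \<omega>(y) because \<omega> \<ge> \<omega>(y)
    on \<open>B_minus\<close>.\<close>
  define \<Lambda> where "\<Lambda> = c1 * p1 * Pm * B1 + c2 * p2 * B2 + 2 * c1 * (M * T) * M powr p1"
  have \<Lambda>: "\<Lambda> \<ge> 0" unfolding \<Lambda>_def using c p Pm B1 B2 M T by simp
  define \<kappa> where "\<kappa> = frac_lap_const TYPE('a) \<alpha> * (measure lborel (ball (0::'a) 1) / 3 powr ?s)"
  have \<kappa>: "\<kappa> > 0" unfolding \<kappa>_def using frac_lap_const_pos[OF n \<alpha>(1,2)] by simp
  \<comment> \<open>a/2 covers minima in the inner half of the ball. The other entry solves \<kappa>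
    d^(-\<alpha>) = \<Lambda> + 1 for d, the 1 avoiding division by a vanishing \<Lambda>.\<close>
  define l0 where "l0 = min (a / 2) ((\<kappa> / (\<Lambda> + 1)) powr (1 / \<alpha>))"
  have l0: "l0 > 0" unfolding l0_def using ab \<kappa> \<Lambda> by simp
  have "l0 \<le> r - norm (y - x)"
    if r: "a \<le> r" "r \<le> b" and y: "negative_minimum_at \<alpha> u x r y" "y \<in> S"
      and w: "omega \<alpha> u x r \<in> L_space \<alpha>" "C11_loc_on S (omega \<alpha> u x r)"
      and ineq: "frac_lap \<alpha> (omega \<alpha> u x r) y - L_coeff \<alpha> c1 c2 p1 p2 u x r y * omega \<alpha> u x r y
        - 2 * c1 * (LINT z:B_minus \<alpha> u x r|lborel. u z * omega \<alpha> u x r z / norm (y - z) powr (2 * \<alpha>)) * u y powr p1 \<ge> 0"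
    for r y S
  proof (cases "r / 2 \<le> norm (y - x)")
    case False
    then have "a / 2 \<le> r - norm (y - x)" using r by linarith
    then show ?thesis by (simp add: l0_def)
  next
    case half: True
    have r0: "r > 0" using r ab by simp
    define w where "w = omega \<alpha> u x r"
    have yB: "y \<in> ball x r" "y \<noteq> x" and wy: "w y < 0" and wmin: "\<And>z. z \<in> ball x r \<Longrightarrow> z \<noteq> x \<Longrightarrow> w y \<le> w z"
      using y unfolding negative_minimum_at_def w_def by auto
    have yr: "norm (y - x) < r" using yB by (simp add: dist_norm norm_minus_commute)
    define d where "d = r - norm (y - x)"
    have d: "d > 0" using yr by (simp add: d_def)
    have inb: "z \<in> cball x (2 * b)" if "z \<in> ball x r" for z using that r b by auto
    have k: "m \<le> kelvin \<alpha> u x r y"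
      using \<alpha> by (intro kelvin_lower_bound[OF r0 r(2) half yr m(2,1)]) auto
    have ku: "kelvin \<alpha> u x r y < u y" using wy by (simp add: w_def omega_def)
    have uy: "m \<le> u y" "u y \<le> M" using m(2) M(2) inb[OF yB(1)] by auto
    have Lc: "L_coeff \<alpha> c1 c2 p1 p2 u x r y \<le> c1 * p1 * Pm * B1 + c2 * p2 * B2"
      unfolding L_coeff_def
    proof (rule add_mono)
      show "c1 * p1 * P \<alpha> u y * kelvin \<alpha> u x r y powr (p1 - 1) \<le> c1 * p1 * Pm * B1"
      proof (cases "c1 = 0")
        case False
        have "P \<alpha> u y \<le> Pm" using False yB r by (intro Pm) auto
        moreover have "kelvin \<alpha> u x r y powr (p1 - 1) \<le> B1" using k ku uy by (intro B1) auto
        ultimately show ?thesis using c p Pm(1) P_nonneg[of \<alpha> u y] by (intro mult_mono) auto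
      qed simp
      have "max (u y powr (p2 - 1)) (kelvin \<alpha> u x r y powr (p2 - 1)) \<le> B2"
        using k ku uy by (intro max.boundedI B2) auto
      then show "c2 * p2 * max (u y powr (p2 - 1)) (kelvin \<alpha> u x r y powr (p2 - 1)) \<le> c2 * p2 * B2"
        using c p by (intro mult_left_mono) auto
    qed
    have int: "M * T * w y \<le> (LINT z:B_minus \<alpha> u x r|lborel. u z * w z / norm (y - z) powr (2 * \<alpha>))"
    proof -
      let ?g = "\<lambda>z. (- w y * M) * (indicator (ball y (2 * b)) z * (1 / norm (y - z) powr (2 * \<alpha>)))"
      have gi: "integrable lborel ?g" using \<alpha> b by (intro integrable_mult_right riesz_integral_shift) auto
      have "(\<integral>z. - (indicator (B_minus \<alpha> u x r) z *\<^sub>R (u z * w z / norm (y - z) powr (2 * \<alpha>))) \<partial>lborel) \<le> (\<integral>z. ?g z \<partial>lborel)"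
      \<comment> \<open>Only the nonnegative majorant has to be integrable: if the integral over
        \<open>B_minus\<close> diverged, its default value 0 would still lie below.\<close>
      proof (rule integral_mono'[OF gi])
        fix z
        have "0 \<le> - w y * M" using wy M(1) by (intro mult_nonneg_nonneg) auto
        then show "0 \<le> ?g z" by (rule mult_nonneg_nonneg) simp
        show "- (indicator (B_minus \<alpha> u x r) z *\<^sub>R (u z * w z / norm (y - z) powr (2 * \<alpha>))) \<le> ?g z"
        proof (cases "z \<in> B_minus \<alpha> u x r")
          case False
          then show ?thesis using \<open>0 \<le> ?g z\<close> by simp
        next
          case True
          then have z: "z \<in> ball x r" "z \<noteq> x" "w z < 0" by (auto simp: B_minus_def w_def)
          have "dist y z < 2 * b" using z(1) yB(1) r dist_triangle_less_add[of y x r z r] by (simp add: dist_commute)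
          moreover have "u z * (- w z) \<le> M * (- w y)"
            using M(2)[OF inb[OF z(1)]] u(2)[of z] wmin[OF z(1,2)] z(3) by (intro mult_mono) auto
          then have "- (u z * w z / norm (y - z) powr (2 * \<alpha>)) \<le> (- w y * M) * (1 / norm (y - z) powr (2 * \<alpha>))"
            using divide_right_mono[of "u z * (- w z)" "M * (- w y)" "norm (y - z) powr (2 * \<alpha>)"] by (simp add: mult.commute)
          ultimately show ?thesis using True by simp
        qed
      qed
      also have "\<dots> = (- w y * M) * T"
        unfolding T_def riesz_integral_shift(2)[OF \<alpha>(1,3) b2, of y, symmetric] by (rule integral_mult_right_zero)
      finally show ?thesis unfolding set_lebesgue_integral_def by (simp add: mult_ac)
    qed
    have "isCont w y"
    proof -
      obtain \<rho> L w' where "\<rho> > 0" "\<forall>z\<in>ball y \<rho>. (w has_derivative blinfun_apply (w' z)) (at z)"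
        using C11_loc_on_ball[OF w(2) y(2)] unfolding w_def by blast
      then have "(w has_derivative blinfun_apply (w' y)) (at y)" by simp
      then show ?thesis by (rule has_derivative_continuous)
    qed
    then have ev: "\<forall>\<^sub>F \<epsilon> in at_right 0. (LINT z:{z. norm (z - y) \<ge> \<epsilon>}|lborel. (w y - w z) / norm (y - z) powr ?s)
       \<le> w y * (\<integral>z. indicator (- ball x r) z * (1 / norm (y - z) powr ?s) \<partial>lborel)"
      unfolding w_def by (rule omega_pv_bound[OF \<alpha>(1) r0 w(1) y(1)])
    obtain l where l: "frac_lap \<alpha> w y = frac_lap_const TYPE('a) \<alpha> * l"
      "((\<lambda>\<epsilon>. LINT z:{z. norm (z - y) \<ge> \<epsilon>}|lborel. (w y - w z) / norm (y - z) powr ?s) \<longlongrightarrow> l) (at_right 0)"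
      unfolding w_def by (rule frac_lap_limit[OF n \<alpha>(1,2) w y(2)])
    have "l \<le> w y * (\<integral>z. indicator (- ball x r) z * (1 / norm (y - z) powr ?s) \<partial>lborel)"
      by (rule tendsto_upperbound[OF l(2) ev]) simp
    also have "\<dots> \<le> w y * ((measure lborel (ball (0::'a) 1) / 3 powr ?s) * d powr (- \<alpha>))"
      unfolding d_def using exterior_kernel_mass[OF \<alpha>(1) yB] wy by (intro mult_left_mono_neg) auto
    finally have "frac_lap \<alpha> w y \<le> frac_lap_const TYPE('a) \<alpha> * (w y * ((measure lborel (ball (0::'a) 1) / 3 powr ?s) * d powr (- \<alpha>)))"
      unfolding l(1) using frac_lap_const_pos[OF n \<alpha>(1,2)] by (intro mult_left_mono) auto
    also have "\<dots> = w y * (\<kappa> * d powr (- \<alpha>))" by (simp add: \<kappa>_def)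
    finally have upper: "frac_lap \<alpha> w y \<le> w y * (\<kappa> * d powr (- \<alpha>))" .
    have "w y * \<Lambda> \<le> frac_lap \<alpha> w y"
    proof -
      have 1: "L_coeff \<alpha> c1 c2 p1 p2 u x r y * w y \<ge> (c1 * p1 * Pm * B1 + c2 * p2 * B2) * w y"
        using Lc wy by (intro mult_right_mono_neg) auto
      have up: "u y powr p1 \<le> M powr p1" using uy m p by (intro powr_mono2) auto
      have "2 * c1 * (LINT z:B_minus \<alpha> u x r|lborel. u z * w z / norm (y - z) powr (2 * \<alpha>)) * u y powr p1
          \<ge> 2 * c1 * (M * T * w y) * u y powr p1"
        using int c by (intro mult_right_mono mult_left_mono) auto
      moreover have "2 * c1 * (M * T * w y) * u y powr p1 \<ge> 2 * c1 * (M * T * w y) * M powr p1"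
        using up c M T wy by (intro mult_left_mono_neg) (auto simp: mult_nonneg_nonpos)
      ultimately have 2: "2 * c1 * (LINT z:B_minus \<alpha> u x r|lborel. u z * w z / norm (y - z) powr (2 * \<alpha>)) * u y powr p1
          \<ge> 2 * c1 * (M * T * w y) * M powr p1" by linarith
      have "w y * \<Lambda> = (c1 * p1 * Pm * B1 + c2 * p2 * B2) * w y + 2 * c1 * (M * T * w y) * M powr p1"
        unfolding \<Lambda>_def by (simp add: algebra_simps)
      then show ?thesis using 1 2 ineq unfolding w_def[symmetric] by linarith
    qed
    then have "w y * \<Lambda> \<le> w y * (\<kappa> * d powr (- \<alpha>))" using upper by linarith
    then have "\<kappa> * d powr (- \<alpha>) \<le> \<Lambda>" using wy by simp
    then have "\<kappa> * d powr (- \<alpha>) * d powr \<alpha> \<le> (\<Lambda> + 1) * d powr \<alpha>" by (intro mult_right_mono) auto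
    moreover have "d powr (- \<alpha>) * d powr \<alpha> = 1" using d by (simp add: powr_add[symmetric])
    ultimately have "\<kappa> \<le> (\<Lambda> + 1) * d powr \<alpha>" by (simp add: mult.assoc)
    then have "\<kappa> / (\<Lambda> + 1) \<le> d powr \<alpha>" using \<Lambda> by (simp add: pos_divide_le_eq mult.commute)
    then have "(\<kappa> / (\<Lambda> + 1)) powr (1 / \<alpha>) \<le> (d powr \<alpha>) powr (1 / \<alpha>)"
      using \<alpha> \<kappa> \<Lambda> by (intro powr_mono2) auto
    also have "\<dots> = d" using \<alpha> d by (simp add: powr_powr)
    finally show ?thesis unfolding l0_def d_def by simp
  qed
  then show ?thesis using l0 by blast
qed

text \<open>A locally uniform choice of \<open>l0\<close> can be made 1-Lipschitz: take half of the supremum of the \<open>\<epsilon>\<close> that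
  work on the whole \<open>\<epsilon>\<close>-neighbourhood.\<close>

lemma continuous_threshold:
  fixes Q :: "real \<Rightarrow> real \<Rightarrow> bool"
  assumes down: "\<And>s l l'. Q s l \<Longrightarrow> l' \<le> l \<Longrightarrow> Q s l'"
    and loc: "\<And>a b. 0 < a \<Longrightarrow> a \<le> b \<Longrightarrow> \<exists>l0>0. \<forall>s. a \<le> s \<and> s \<le> b \<longrightarrow> Q s l0"
  shows "\<exists>l0. continuous_on {0<..} l0 \<and> (\<forall>r>0. l0 r > 0 \<and> Q r (l0 r))"
proof -
  \<comment> \<open>Values above 1 are excluded to keep the supremum finite, and 0 always belongs to
    the set because |s - r| < 0 is impossible. The supremum itself need not belong to it, whereas
    every positive number below it is admissible at \<open>r\<close>.\<close>
  define A where "A = (\<lambda>r. {e. 0 \<le> e \<and> e \<le> 1 \<and> (\<forall>s>0. \<bar>s - r\<bar> < e \<longrightarrow> Q s e)})"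
  define E where "E = (\<lambda>r. Sup (A r))"
  have A0: "0 \<in> A r" for r by (simp add: A_def)
  have bdd: "bdd_above (A r)" for r by (rule bdd_aboveI[of _ 1]) (simp add: A_def)
  have shift: "E r - \<bar>r - r'\<bar> \<le> E r'" for r r'
  proof -
    have "e \<le> E r' + \<bar>r - r'\<bar>" if e: "e \<in> A r" for e
    proof (cases "\<bar>r - r'\<bar> \<le> e")
      case True
      have "Q s (e - \<bar>r - r'\<bar>)" if "s > 0" "\<bar>s - r'\<bar> < e - \<bar>r - r'\<bar>" for s
      proof (rule down)
        have "\<bar>s - r\<bar> < e" using that by linarith
        then show "Q s e" using e that by (simp add: A_def)
      qed simp
      then have "e - \<bar>r - r'\<bar> \<in> A r'" using True e by (auto simp: A_def)
      then have "e - \<bar>r - r'\<bar> \<le> E r'" unfolding E_def by (rule cSup_upper[OF _ bdd])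
      then show ?thesis by simp
    next
      case False
      moreover have "0 \<le> E r'" unfolding E_def by (rule cSup_upper[OF A0 bdd])
      ultimately show ?thesis by linarith
    qed
    then have "Sup (A r) \<le> E r' + \<bar>r - r'\<bar>" using A0 by (intro cSup_least) auto
    then show ?thesis by (simp add: E_def)
  qed
  have lip: "1-lipschitz_on UNIV E"
  proof (rule lipschitz_onI)
    fix r r' show "dist (E r) (E r') \<le> 1 * dist r r'"
      using shift[of r r'] shift[of r' r] by (simp add: dist_real_def abs_le_iff abs_minus_commute)
  qed simp
  have "continuous_on {0<..} E"
    using lipschitz_on_continuous_on[OF lip] by (rule continuous_on_subset) simp
  moreover have Epos: "E r > 0" if r: "r > 0" for r
  proof -
    obtain l where l: "l > 0" "\<And>s. r / 2 \<le> s \<and> s \<le> 2 * r \<Longrightarrow> Q s l" using loc[of "r / 2" "2 * r"] r by auto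
    define e where "e = min 1 (min l (r / 2))"
    have "Q s e" if "s > 0" "\<bar>s - r\<bar> < e" for s
    proof (rule down)
      have "\<bar>s - r\<bar> < r / 2" using that by (simp add: e_def)
      then show "Q s l" using r by (intro l) linarith
    qed (simp add: e_def)
    then have "e \<in> A r" using l r by (auto simp: A_def e_def)
    then have "e \<le> E r" unfolding E_def by (rule cSup_upper[OF _ bdd])
    moreover have "e > 0" using l r by (simp add: e_def)
    ultimately show ?thesis by linarith
  qed
  moreover have "Q r (E r / 2)" if r: "r > 0" for r
  proof -
    have "E r / 2 < E r" using Epos[OF r] by simp
    moreover have "A r \<noteq> {}" using A0 by blast
    ultimately obtain e where e: "e \<in> A r" "E r / 2 < e"
      unfolding E_def using less_cSup_iff[OF _ bdd] by blast
    then have "e > 0" using Epos[OF r] by linarith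
    then have "Q r e" using e r by (simp add: A_def)
    then show ?thesis by (rule down) (use e in simp)
  qed
  ultimately show ?thesis
    by (intro exI[of _ "\<lambda>r. E r / 2"]) (auto intro!: continuous_intros)
qed

section \<open>Comparison arguments for the classical Laplacian\<close>

lemma deriv2_at0_minimum:
  fixes h :: "'a::euclidean_space \<Rightarrow> real"
  assumes "open S" "y \<in> S" "\<And>z. z \<in> S \<Longrightarrow> h y \<le> h z" and d: "deriv2_at0 (\<lambda>t. h (y + t *\<^sub>R b)) d D"
  shows "D \<ge> 0"
proof (rule deriv2_at0_local_min[OF d])
  have "isCont (\<lambda>t::real. y + t *\<^sub>R b) 0" by (intro continuous_intros)
  then have "((\<lambda>t::real. y + t *\<^sub>R b) \<longlongrightarrow> y + 0 *\<^sub>R b) (nhds 0)"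
    unfolding isCont_def using tendsto_at_iff_tendsto_nhds[of "\<lambda>t. y + t *\<^sub>R b" 0] by simp
  then have "\<forall>\<^sub>F t::real in nhds 0. y + t *\<^sub>R b \<in> S"
    using assms(1,2) by (intro topological_tendstoD) auto
  then show "\<forall>\<^sub>F t in nhds 0. h (y + 0 *\<^sub>R b) \<le> h (y + t *\<^sub>R b)"
    by eventually_elim (use assms(3) in simp)
qed

lemma C2_on_const: "C2_on S (\<lambda>_::'a::euclidean_space. c)"
  unfolding C2_on_def
  by (intro exI[of _ UNIV] exI[of _ "\<lambda>_. 0"]) (auto simp: zero_blinfun.rep_eq)

lemma laplacian_const: "laplacian (\<lambda>_::'a::euclidean_space. c) y = 0"
  unfolding laplacian_def by (simp add: numeral_2_eq_2)

text \<open>The strict sign of the Laplacian replaces a strong maximum principle. At a negative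
  interior minimum of u - c \<Phi> + \<eta> all second derivatives along the axes are nonnegative,
  and \<Phi> is harmonic off \<open>x\<close>, so the Laplacian of \<open>u\<close> could not be
  negative.\<close>

lemma laplacian_superharmonic_lower_bound:
  fixes u :: "'a::euclidean_space \<Rightarrow> real"
  assumes n: "DIM('a) > 2" and u: "C2_on UNIV u" "\<And>y. u y > 0" and sup: "\<And>y. laplacian u y < 0"
  shows "\<exists>c>0. \<forall>z. 1 \<le> norm (z - x) \<longrightarrow> c * norm (z - x) powr (2 - real DIM('a)) \<le> u z"
proof -
  let ?n = "DIM('a)"
  \<comment> \<open>Writing the fundamental solution as the Kelvin transform of the constant 1 lets
    \<open>kelvin_laplacian\<close> supply its harmonicity.\<close>
  define \<Phi> where "\<Phi> = kelvin 2 (\<lambda>_::'a. 1) x 1"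
  have \<Phi>: "\<Phi> z = norm (z - x) powr (2 - real ?n)" for z
    unfolding \<Phi>_def kelvin_def by (simp add: powr_divide powr_diff)
  obtain u' where u': "\<And>y. (u has_derivative blinfun_apply (u' y)) (at y)" using C2_continuous[OF u(1)] by blast
  have uc: "continuous_on UNIV u"
    using u' by (intro continuous_at_imp_continuous_on ballI has_derivative_continuous)
  obtain c where c: "c > 0" "\<And>z. z \<in> cball x 1 \<Longrightarrow> c \<le> u z"
    using positive_min_on_compact[OF uc u(2), of x 1] by blast
  have "c * \<Phi> z1 \<le> u z1" if z1: "1 \<le> norm (z1 - x)" for z1
  proof (rule ccontr)
    assume "\<not> c * \<Phi> z1 \<le> u z1"
    then have neg: "u z1 < c * \<Phi> z1" by simp
    define \<eta> where "\<eta> = (c * \<Phi> z1 - u z1) / 2"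
    have \<eta>: "\<eta> > 0" using neg by (simp add: \<eta>_def)
    define w where "w = (\<lambda>z. u z + (- c) * \<Phi> z + \<eta>)"
    have w1: "w z1 < 0" using neg by (simp add: w_def \<eta>_def field_simps)
    have "((\<lambda>t. c * t powr (2 - real ?n)) \<longlongrightarrow> c * 0) at_top"
      using n by (intro tendsto_mult tendsto_const tendsto_neg_powr filterlim_ident) auto
    then have "eventually (\<lambda>t. c * t powr (2 - real ?n) < \<eta>) at_top"
      using \<eta> by (intro order_tendstoD(2)[where a = \<eta>]) auto
    then obtain R where R: "\<And>t. t \<ge> R \<Longrightarrow> c * t powr (2 - real ?n) < \<eta>"
      by (auto simp: eventually_at_top_linorder)
    define S where "S = cball x (max R (norm (z1 - x))) - ball x 1"
    have "compact S" unfolding S_def by (intro compact_diff) auto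
    moreover have "z1 \<in> S" using z1 by (simp add: S_def dist_norm norm_minus_commute)
    moreover have "continuous_on S w"
      unfolding w_def \<Phi> by (intro continuous_intros continuous_on_subset[OF uc]) (auto simp: S_def)
    ultimately obtain y where y: "y \<in> S" "\<And>z. z \<in> S \<Longrightarrow> w y \<le> w z"
      using continuous_attains_inf[of S w] by blast
    have wy: "w y < 0" using y(2)[OF \<open>z1 \<in> S\<close>] w1 by simp
    have wmin: "w y \<le> w z" if "z \<in> - cball x 1" for z
    proof (cases "z \<in> S")
      case False
      then have "R \<le> norm (z - x)" using that by (auto simp: S_def dist_norm norm_minus_commute)
      then have "w z > 0" using R[of "norm (z - x)"] u(2)[of z] by (simp add: w_def \<Phi>)
      then show ?thesis using wy by simp
    qed (rule y(2))
    have y1: "y \<in> - cball x 1"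
    proof (rule ccontr)
      assume "y \<notin> - cball x 1"
      then have "y \<in> cball x 1" by simp
      moreover have "norm (y - x) = 1" using y(1) calculation by (auto simp: S_def dist_norm norm_minus_commute)
      ultimately have "c \<le> u y" "\<Phi> y = 1" using c(2) \<Phi>[of y] by auto
      then show False using wy \<eta> by (simp add: w_def)
    qed
    then have "y \<noteq> x" by auto
    obtain D where D: "\<forall>b\<in>Basis. \<exists>d. deriv2_at0 (\<lambda>t. \<Phi> (y + t *\<^sub>R b)) d (D b)"
      "(\<Sum>b\<in>Basis. D b) = (1 / norm (y - x)) powr (real DIM('a) + 2) * laplacian (\<lambda>_::'a. 1) (inversion x 1 y)"
      using kelvin_laplacian[OF C2_on_const[of UNIV 1] _ \<open>y \<noteq> x\<close>, of 1] unfolding \<Phi>_def by auto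
    have "0 \<le> (\<Sum>b\<in>Basis. (deriv ^^ 2) (\<lambda>t. u (y + t *\<^sub>R b)) 0 + (- c) * D b + 0)"
    proof (rule sum_nonneg)
      fix b :: 'a assume b: "b \<in> Basis"
      obtain d1 where d1: "deriv2_at0 (\<lambda>t. u (y + t *\<^sub>R b)) d1 ((deriv ^^ 2) (\<lambda>t. u (y + t *\<^sub>R b)) 0)"
        using deriv2_at0_line[OF u(1)] by blast
      obtain d2 where d2: "deriv2_at0 (\<lambda>t. \<Phi> (y + t *\<^sub>R b)) d2 (D b)" using D(1) b by blast
      show "0 \<le> (deriv ^^ 2) (\<lambda>t. u (y + t *\<^sub>R b)) 0 + (- c) * D b + 0"
      proof (rule deriv2_at0_minimum[of "- cball x 1" y w])
        show "deriv2_at0 (\<lambda>t. w (y + t *\<^sub>R b)) (d1 + (- c) * d2 + 0) ((deriv ^^ 2) (\<lambda>t. u (y + t *\<^sub>R b)) 0 + (- c) * D b + 0)"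
          unfolding w_def by (intro deriv2_at0_add deriv2_at0_cmult deriv2_at0_const d1 d2)
      qed (use y1 wmin in auto)
    qed
    also have "\<dots> = laplacian u y + (- c) * (\<Sum>b\<in>Basis. D b)"
      unfolding laplacian_def by (simp add: sum_subtractf sum_distrib_left sum_negf)
    finally show False using sup[of y] D(2) by (simp add: laplacian_const)
  qed
  then show ?thesis using c(1) unfolding \<Phi> by blast
qed

lemma powr_lipschitz_on_Icc:
  fixes q :: real
  assumes "0 < m" "q > 0"
  shows "\<exists>B\<ge>0. \<forall>s t. m \<le> s \<and> s \<le> t \<and> t \<le> M \<longrightarrow> t powr q - s powr q \<le> B * (t - s)"
proof -
  obtain B where B: "B \<ge> 0" "\<And>t. m \<le> t \<Longrightarrow> t \<le> M \<Longrightarrow> t powr (q - 1) \<le> B"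
    using powr_bounded_on_Icc[OF assms(1), of M "q - 1"] by blast
  have "t powr q - s powr q \<le> (q * B) * (t - s)" if "m \<le> s" "s \<le> t" "t \<le> M" for s t
  proof (cases "s = t")
    case False
    then have "s < t" using that by simp
    have "((\<lambda>z. z powr q) has_real_derivative q * z powr (q - 1)) (at z)" if "s \<le> z" for z
      using that \<open>m \<le> s\<close> assms(1) by (intro has_real_derivative_powr) linarith
    then obtain z where z: "s < z" "z < t" "t powr q - s powr q = (t - s) * (q * z powr (q - 1))"
      using MVT2[OF \<open>s < t\<close>, of "\<lambda>z. z powr q" "\<lambda>z. q * z powr (q - 1)"] by blast
    have "z powr (q - 1) \<le> B" using z that by (intro B) auto
    then have "(t - s) * (q * z powr (q - 1)) \<le> (t - s) * (q * B)"
      using assms that by (intro mult_left_mono) auto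
    then show ?thesis using z by (simp add: mult_ac)
  qed simp
  then show ?thesis using B(1) assms(2) by (intro exI[of _ "q * B"]) auto
qed

text \<open>At the minimum itself one only knows $-\Delta\omega \le 0$, without a rate. But the equation for
  \<open>u\<close> yields $-\Delta\omega \ge -C\mu$ wherever \<open>\<omega>\<close> is negative in the outer half of the ball,
  \<open>-\<mu>\<close> being the minimum, and comparison with $-\mu A(r^2-|y-x|^2)$ keeps the minimum away
  from the sphere.\<close>

lemma narrow_region_laplacian:
  fixes u :: "'a::euclidean_space \<Rightarrow> real"
  assumes n: "DIM('a) > 4"
    and c: "c1 \<ge> 0" "c2 \<ge> 0" and p: "0 < p1" "p1 \<le> 1" "0 < p2" "p2 \<le> (real DIM('a) + 2) / (real DIM('a) - 2)"
    and u: "C2_on UNIV u" "\<And>y. u y > 0"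
    and i: "c1 \<noteq> 0 \<Longrightarrow> (\<And>y. integrable lborel (\<lambda>z. (u z)\<^sup>2 / norm (y - z) powr (2 * 2)))"
    and eq: "\<And>y. - laplacian u y = c1 * P 2 u y * u y powr p1 + c2 * u y powr p2"
    and ab: "0 < a" "a \<le> b"
  shows "\<exists>l0>0. \<forall>r y. a \<le> r \<and> r \<le> b \<and> negative_minimum_at 2 u x r y \<longrightarrow> l0 \<le> r - norm (y - x)"
proof -
  let ?n = "real DIM('a)"
  have b: "b > 0" using ab by simp
  obtain u' where u': "\<And>y. (u has_derivative blinfun_apply (u' y)) (at y)" using C2_continuous[OF u(1)] by blast
  have uc: "continuous_on UNIV u"
    using u' by (intro continuous_at_imp_continuous_on ballI has_derivative_continuous)
  obtain m where m: "m > 0" "\<And>z. z \<in> cball x (2 * b) \<Longrightarrow> m \<le> u z"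
    using positive_min_on_compact[OF uc u(2), of x "2 * b"] by blast
  obtain M where M: "M > 0" "\<And>z. z \<in> cball x (2 * b) \<Longrightarrow> u z \<le> M"
    using bounded_on_compact[OF uc, of x "2 * b"] by blast
  have n4: "2 * 2 < ?n" using n by simp
  obtain Pm where Pm: "Pm \<ge> 0" "\<And>y. c1 \<noteq> 0 \<Longrightarrow> y \<in> cball x b \<Longrightarrow> P 2 u y \<le> Pm"
  proof (cases "c1 = 0")
    case False
    then show ?thesis using P_bounded[OF i[OF False] _ n4 b uc u(2), of x] that by auto
  qed (use that[of 0] in auto)
  obtain B1 where B1: "B1 \<ge> 0" "\<And>s t. m \<le> s \<Longrightarrow> s \<le> t \<Longrightarrow> t \<le> M \<Longrightarrow> t powr p1 - s powr p1 \<le> B1 * (t - s)"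
    using powr_lipschitz_on_Icc[OF m(1) p(1), of M] by blast
  obtain B2 where B2: "B2 \<ge> 0" "\<And>s t. m \<le> s \<Longrightarrow> s \<le> t \<Longrightarrow> t \<le> M \<Longrightarrow> t powr p2 - s powr p2 \<le> B2 * (t - s)"
    using powr_lipschitz_on_Icc[OF m(1) p(3), of M] by blast
  define T where "T = (\<integral>z. indicator (ball 0 (2 * b)) z * (1 / norm (0 - z :: 'a) powr (2 * 2)) \<partial>lborel)"
  have T: "T \<ge> 0" unfolding T_def by (intro Bochner_Integration.integral_nonneg) simp
  define C where "C = c1 * (2 * M * T * M powr p1 + Pm * B1) + c2 * B2"
  have C: "C \<ge> 0" unfolding C_def using c M T Pm B1 B2 by simp
  \<comment> \<open>Two requirements on the barrier \<psi>: its Laplacian -2nA must beat the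
    constant C, and A \<ge> 2/a^2 gives \<psi> \<ge> 1 on the inner sphere |z - x| = r/2, where
    \<psi> = (3/4) A r^2.\<close>
  define A where "A = C + 1 + 2 / a\<^sup>2"
  have A: "A > 0" "C < 2 * ?n * A" "2 / a\<^sup>2 \<le> A"
  proof -
    have "2 / a\<^sup>2 > 0" using ab by simp
    then have "C + 1 \<le> A" by (simp add: A_def)
    then show "A > 0" using C by linarith
    show "2 / a\<^sup>2 \<le> A" using C by (simp add: A_def)
    have "1 * A \<le> (2 * ?n) * A" using \<open>A > 0\<close> n by (intro mult_right_mono) auto
    then show "C < 2 * ?n * A" using \<open>C + 1 \<le> A\<close> by simp
  qed
  \<comment> \<open>a/2 covers minima in the inner half. The other entry comes from \<psi>(y) \<ge>
    1, as \<psi>(y) \<le> 2 A b (r - |y - x|).\<close>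
  define l0 where "l0 = min (a / 2) (1 / (2 * A * b))"
  have l0: "l0 > 0" unfolding l0_def using ab A b by simp
  have "l0 \<le> r - norm (y - x)" if r: "a \<le> r" "r \<le> b" and y: "negative_minimum_at 2 u x r y" for r y
  proof (cases "r / 2 \<le> norm (y - x)")
    case False
    then have "a / 2 \<le> r - norm (y - x)" using r by linarith
    then show ?thesis by (simp add: l0_def)
  next
    case half: True
    have r0: "r > 0" using r ab by simp
    define w where "w = omega 2 u x r"
    define k where "k = kelvin 2 u x r"
    have yB: "y \<in> ball x r" "y \<noteq> x" and wy: "w y < 0" and wmin: "\<And>z. z \<in> ball x r \<Longrightarrow> z \<noteq> x \<Longrightarrow> w y \<le> w z"
      using y unfolding negative_minimum_at_def w_def by auto
    have yr: "norm (y - x) < r" using yB by (simp add: dist_norm norm_minus_commute)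
    define \<mu> where "\<mu> = - w y"
    have \<mu>: "\<mu> > 0" using wy by (simp add: \<mu>_def)
    have inb: "z \<in> cball x (2 * b)" if "z \<in> ball x r" for z using that r b by auto
    have lap: "(r / norm (z - x)) powr (?n + 2) * laplacian u (inversion x r z) - laplacian u z \<le> C * \<mu>"
      if z: "r / 2 \<le> norm (z - x)" "norm (z - x) < r" and wz: "w z < 0" for z
    proof -
      have zx: "z \<noteq> x" using z r0 by auto
      have zB: "z \<in> ball x r" using z by (simp add: dist_norm norm_minus_commute)
      define \<tau> where "\<tau> = r / norm (z - x)"
      have \<tau>: "\<tau> \<ge> 1" unfolding \<tau>_def using z zx by simp
      define q where "q = inversion x r z"
      have kz: "k z = \<tau> powr (?n - 2) * u q" by (simp add: k_def kelvin_def \<tau>_def q_def)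
      have km: "m \<le> k z" unfolding k_def using n by (intro kelvin_lower_bound[OF r0 r(2) z m(2,1)]) auto
      have ku: "k z \<le> u z" using wz by (simp add: w_def omega_def k_def)
      have uM: "u z \<le> M" using M(2) inb[OF zB] by blast
      have diffu: "u z - k z \<le> \<mu>" using wmin[OF zB zx] by (simp add: \<mu>_def w_def omega_def k_def)
      have scale: "\<tau> powr e * (k z) powr e' \<le> \<tau> powr (e + (?n - 2) * e') * u q powr e'" if "e' > 0" for e e'
        unfolding kz using \<tau> u(2)[of q] by (simp add: powr_mult powr_powr powr_add)
      have t2: "c2 * u z powr p2 - c2 * (\<tau> powr (?n + 2) * u q powr p2) \<le> c2 * (B2 * \<mu>)"
      proof -
        have "0 \<le> ?n + 2 - (?n - 2) * p2" using p(4) n by (simp add: pos_le_divide_eq mult.commute)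
        then have "1 * k z powr p2 \<le> \<tau> powr (?n + 2 - (?n - 2) * p2) * k z powr p2"
          using \<tau> by (intro mult_right_mono ge_one_powr_ge_zero) auto
        also have "\<dots> \<le> \<tau> powr (?n + 2) * u q powr p2"
          using scale[OF p(3), of "?n + 2 - (?n - 2) * p2"] by simp
        finally have 1: "k z powr p2 \<le> \<tau> powr (?n + 2) * u q powr p2" by simp
        have 2: "u z powr p2 - k z powr p2 \<le> B2 * \<mu>"
          using B2(2)[OF km ku uM] mult_left_mono[OF diffu B2(1)] by linarith
        have "c2 * (u z powr p2 - \<tau> powr (?n + 2) * u q powr p2) \<le> c2 * (B2 * \<mu>)"
          using 1 2 c by (intro mult_left_mono) linarith+
        then show ?thesis by (simp add: right_diff_distrib)
      qed
      have t1: "c1 * (P 2 u z * u z powr p1) - c1 * (\<tau> powr (?n + 2) * (P 2 u q * u q powr p1)) \<le> c1 * ((2 * M * T * M powr p1 + Pm * B1) * \<mu>)"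
      proof (cases "c1 = 0")
        case False
        \<comment> \<open>\<open>Pk\<close> is the nonlocal term belonging to the Kelvin transform.
          Its factor \<tau>^4 and the factor \<tau>^(n-2) from the comparison of
          \<open>k z powr p1\<close> below combine to the \<tau>^(n+2) of the transformed
          Laplacian.\<close>
        define Pk where "Pk = \<tau> powr (2 * 2) * P 2 u q"
        have Pk0: "Pk \<ge> 0" unfolding Pk_def using P_nonneg[of 2 u q] by simp
        define Tr where "Tr = (\<integral>z. indicator (ball 0 (2 * r)) z * (1 / norm (0 - z :: 'a) powr (2 * 2)) \<partial>lborel)"
        have Tr: "Tr \<le> T"
          unfolding Tr_def T_def
        proof (rule integral_mono)
          show "integrable lborel (\<lambda>z::'a. indicator (ball 0 (2 * r)) z * (1 / norm (0 - z) powr (2 * 2)))"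
            using n4 r0 by (intro integrable_kernel_near) auto
          show "integrable lborel (\<lambda>z::'a. indicator (ball 0 (2 * b)) z * (1 / norm (0 - z) powr (2 * 2)))"
            using n4 b by (intro integrable_kernel_near) auto
        qed (use r in \<open>auto simp: indicator_def\<close>)
        have "P 2 u z - Pk \<le> 2 * M * \<mu> * Tr"
          unfolding Pk_def \<tau>_def q_def Tr_def
        proof (rule kelvin_P_difference[OF i[OF False] _ n4 r0 uc u(2) zx z(2)])
          fix v assume "v \<in> ball x r - {x}"
          then show "- \<mu> \<le> omega 2 u x r v" using wmin[of v] by (simp add: \<mu>_def w_def)
        qed (use M(2) inb \<mu> in auto)
        also have "\<dots> \<le> 2 * M * \<mu> * T" using Tr M \<mu> by (intro mult_left_mono) auto
        finally have 1: "P 2 u z - Pk \<le> 2 * M * \<mu> * T" .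
        \<comment> \<open>p1 \<le> 1 plays the part that the critical bound plays for
          \<open>p2\<close>.\<close>
        have "0 \<le> (?n - 2) - (?n - 2) * p1" using p(2) n mult_left_mono[of p1 1 "?n - 2"] by simp
        then have "1 * k z powr p1 \<le> \<tau> powr ((?n - 2) - (?n - 2) * p1) * k z powr p1"
          using \<tau> by (intro mult_right_mono ge_one_powr_ge_zero) auto
        also have "\<dots> \<le> \<tau> powr (?n - 2) * u q powr p1"
          using scale[OF p(1), of "(?n - 2) - (?n - 2) * p1"] by simp
        finally have 2: "k z powr p1 \<le> \<tau> powr (?n - 2) * u q powr p1" by simp
        have "Pk * k z powr p1 \<le> Pk * (\<tau> powr (?n - 2) * u q powr p1)" using 2 Pk0 by (rule mult_left_mono)
        also have "\<dots> = \<tau> powr (?n + 2) * (P 2 u q * u q powr p1)"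
        proof -
          have "\<tau> powr (2 * 2) * \<tau> powr (?n - 2) = \<tau> powr (?n + 2)"
            by (simp add: powr_add[symmetric] add.commute)
          then show ?thesis unfolding Pk_def by (metis mult.assoc mult.left_commute)
        qed
        finally have 3: "Pk * k z powr p1 \<le> \<tau> powr (?n + 2) * (P 2 u q * u q powr p1)" .
        have kp: "0 \<le> k z powr p1" "k z powr p1 \<le> M powr p1"
          using km ku uM m p by (auto intro!: powr_mono2)
        have "(P 2 u z - Pk) * k z powr p1 \<le> (2 * M * \<mu> * T) * k z powr p1" using 1 by (rule mult_right_mono) simp
        also have "\<dots> \<le> (2 * M * \<mu> * T) * M powr p1" using kp M \<mu> T by (intro mult_left_mono) auto
        finally have 4: "(P 2 u z - Pk) * k z powr p1 \<le> (2 * M * \<mu> * T) * M powr p1" .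
        have up: "u z powr p1 - k z powr p1 \<le> B1 * \<mu>"
          using B1(2)[OF km ku uM] mult_left_mono[OF diffu B1(1)] by linarith
        have "k z powr p1 \<le> u z powr p1" using ku km m p by (intro powr_mono2) auto
        \<comment> \<open>The product difference P u^p1 - Pk k^p1 is split as P (u^p1 - k^p1) + (P -
          Pk) k^p1, with the second summand bounded in step \<open>4\<close>.\<close>
        then have "P 2 u z * (u z powr p1 - k z powr p1) \<le> Pm * (B1 * \<mu>)"
          using up Pm(2)[OF False, of z] Pm(1) zB r by (intro mult_mono) auto
        then have "P 2 u z * u z powr p1 - Pk * k z powr p1 \<le> (2 * M * T * M powr p1 + Pm * B1) * \<mu>"
          using 4 by (simp add: algebra_simps)
        then have "P 2 u z * u z powr p1 - \<tau> powr (?n + 2) * (P 2 u q * u q powr p1) \<le> (2 * M * T * M powr p1 + Pm * B1) * \<mu>"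
          using 3 by linarith
        then have "c1 * (P 2 u z * u z powr p1 - \<tau> powr (?n + 2) * (P 2 u q * u q powr p1)) \<le> c1 * ((2 * M * T * M powr p1 + Pm * B1) * \<mu>)"
          using c by (intro mult_left_mono) auto
        then show ?thesis by (simp add: right_diff_distrib)
      qed simp
      have l1: "laplacian u q = - (c1 * P 2 u q * u q powr p1 + c2 * u q powr p2)" using eq[of q] by linarith
      have l2: "laplacian u z = - (c1 * P 2 u z * u z powr p1 + c2 * u z powr p2)" using eq[of z] by linarith
      have "\<tau> powr (?n + 2) * laplacian u q - laplacian u z
          = (c1 * (P 2 u z * u z powr p1) - c1 * (\<tau> powr (?n + 2) * (P 2 u q * u q powr p1)))
            + (c2 * u z powr p2 - c2 * (\<tau> powr (?n + 2) * u q powr p2))"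
        unfolding l1 l2 by (simp add: algebra_simps)
      also have "\<dots> \<le> C * \<mu>" using t1 t2 unfolding C_def by (simp add: algebra_simps)
      finally show ?thesis unfolding \<tau>_def q_def .
    qed
    define \<psi> where "\<psi> = (\<lambda>z. A * (r\<^sup>2 - (norm (z - x))\<^sup>2))"
    \<comment> \<open>Subtraction is written as multiplication by -1 so that the rules for
      \<open>deriv2_at0\<close> apply to the sum as it stands.\<close>
    define h where "h = (\<lambda>z. (k z + (- 1) * u z) + \<mu> * \<psi> z)"
    have hw: "h z = w z + \<mu> * \<psi> z" for z by (simp add: h_def w_def omega_def k_def)
    define S where "S = cball x r - ball x (r / 2)"
    have Sx: "z \<noteq> x" if "z \<in> S" for z using that r0 by (auto simp: S_def)
    have "continuous_on S h"
      unfolding h_def k_def kelvin_def \<psi>_def inversion_def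
      using Sx r0 by (intro continuous_intros continuous_on_compose2[OF uc] continuous_on_powr') auto
    moreover have "compact S" unfolding S_def by (intro compact_diff) auto
    moreover have yS: "y \<in> S" using half yr by (simp add: S_def dist_norm norm_minus_commute)
    ultimately obtain v where v: "v \<in> S" "\<And>z. z \<in> S \<Longrightarrow> h v \<le> h z"
      using continuous_attains_inf[of S h] by blast
    \<comment> \<open>A negative minimum is impossible on the outer sphere, where \<omega> and
      \<psi> vanish, and on the inner one, where \<psi> \<ge> 1 and \<omega> \<ge> -\<mu>. In
      between, h < 0 forces \<omega> < 0, so \<open>lap\<close> applies and makes the Laplacian of h
      negative.\<close>
    have "h v \<ge> 0"
    proof (rule ccontr)
      assume "\<not> h v \<ge> 0"
      then have hv: "h v < 0" by simp
      have vx: "v \<noteq> x" using v(1) by (rule Sx)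
      have vr: "norm (v - x) \<noteq> r"
      proof
        assume e: "norm (v - x) = r"
        then have "inversion x r v = v" using r0 by (simp add: inversion_def)
        then have "w v = 0" using e r0 by (simp add: w_def omega_def kelvin_def)
        then show False using hv e by (simp add: hw \<psi>_def)
      qed
      have vr2: "norm (v - x) \<noteq> r / 2"
      proof
        assume e: "norm (v - x) = r / 2"
        have "v \<in> ball x r" using e r0 by (simp add: dist_norm norm_minus_commute)
        then have "- \<mu> \<le> w v" using wmin[of v] vx by (simp add: \<mu>_def)
        moreover have "1 \<le> \<psi> v"
        proof -
          have "1 \<le> (2 / a\<^sup>2) * (3 / 4 * a\<^sup>2)" using ab by simp
          also have "\<dots> \<le> A * (3 / 4 * r\<^sup>2)" using A ab r by (intro mult_mono power_mono) auto
          finally show ?thesis unfolding \<psi>_def e by (simp add: power_divide)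
        qed
        then have "\<mu> * 1 \<le> \<mu> * \<psi> v" using \<mu> by (intro mult_left_mono) auto
        ultimately show False using hv by (simp add: hw)
      qed
      have vin: "r / 2 < norm (v - x)" "norm (v - x) < r"
        using v(1) vr vr2 by (auto simp: S_def dist_norm norm_minus_commute)
      have "\<psi> v \<ge> 0"
        unfolding \<psi>_def using A vin by (intro mult_nonneg_nonneg) (auto intro!: power_mono)
      then have "0 \<le> \<mu> * \<psi> v" using \<mu> by simp
      then have "w v < 0" using hv unfolding hw by linarith
      then have lv: "(r / norm (v - x)) powr (?n + 2) * laplacian u (inversion x r v) - laplacian u v \<le> C * \<mu>"
        using vin by (intro lap) auto
      obtain D where D: "\<forall>b\<in>Basis. \<exists>d. deriv2_at0 (\<lambda>t. k (v + t *\<^sub>R b)) d (D b)"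
        "(\<Sum>b\<in>Basis. D b) = (r / norm (v - x)) powr (?n + 2) * laplacian u (inversion x r v)"
        using kelvin_laplacian[OF u(1) r0 vx] unfolding k_def by blast
      let ?O = "ball x r - cball x (r / 2)"
      have "0 \<le> (\<Sum>b\<in>Basis. (D b + (- 1) * (deriv ^^ 2) (\<lambda>t. u (v + t *\<^sub>R b)) 0) + \<mu> * (A * (- 2)))"
      proof (rule sum_nonneg)
        fix e :: 'a assume e: "e \<in> Basis"
        obtain d1 where d1: "deriv2_at0 (\<lambda>t. u (v + t *\<^sub>R e)) d1 ((deriv ^^ 2) (\<lambda>t. u (v + t *\<^sub>R e)) 0)"
          using deriv2_at0_line[OF u(1)] by blast
        obtain d2 where d2: "deriv2_at0 (\<lambda>t. k (v + t *\<^sub>R e)) d2 (D e)" using D(1) e by blast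
        have "(norm (v + t *\<^sub>R e - x))\<^sup>2 = (norm (v - x))\<^sup>2 + 2 * t * ((v - x) \<bullet> e) + t\<^sup>2" for t
          using power2_norm_add_Basis[OF e, of "v - x" t] by (simp add: algebra_simps)
        then have \<psi>t: "(\<lambda>t. \<psi> (v + t *\<^sub>R e)) = (\<lambda>t. A * (r\<^sup>2 - ((norm (v - x))\<^sup>2 + 2 * t * ((v - x) \<bullet> e) + t\<^sup>2)))"
          by (simp add: \<psi>_def)
        have d3: "deriv2_at0 (\<lambda>t. \<psi> (v + t *\<^sub>R e)) (A * (- (2 * ((v - x) \<bullet> e) + 2 * 0))) (A * (- 2))"
          unfolding deriv2_at0_def \<psi>t
          by (intro exI[of _ "\<lambda>t. A * (- (2 * ((v - x) \<bullet> e) + 2 * t))"] conjI always_eventually allI)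
             (auto intro!: derivative_eq_intros)
        show "0 \<le> (D e + (- 1) * (deriv ^^ 2) (\<lambda>t. u (v + t *\<^sub>R e)) 0) + \<mu> * (A * (- 2))"
        proof (rule deriv2_at0_minimum[of ?O v h])
          show "deriv2_at0 (\<lambda>t. h (v + t *\<^sub>R e)) ((d2 + (- 1) * d1) + \<mu> * (A * (- (2 * ((v - x) \<bullet> e) + 2 * 0))))
              ((D e + (- 1) * (deriv ^^ 2) (\<lambda>t. u (v + t *\<^sub>R e)) 0) + \<mu> * (A * (- 2)))"
            unfolding h_def by (intro deriv2_at0_add deriv2_at0_cmult d1 d2 d3)
          show "h v \<le> h z" if "z \<in> ?O" for z using that by (intro v(2)) (auto simp: S_def)
        qed (use vin in \<open>auto simp: dist_norm norm_minus_commute\<close>)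
      qed
      also have "\<dots> = (\<Sum>b\<in>Basis. D b) - laplacian u v - 2 * ?n * A * \<mu>"
        unfolding laplacian_def by (simp add: sum.distrib sum_negf sum_subtractf)
      also have "\<dots> \<le> C * \<mu> - 2 * ?n * A * \<mu>" using lv D(2) by simp
      also have "\<dots> = (C - 2 * ?n * A) * \<mu>" by (simp add: left_diff_distrib)
      also have "\<dots> < 0" using A \<mu> by (simp add: mult_neg_pos)
      finally show False by simp
    qed
    then have "0 \<le> h y" using v(2)[OF yS] by simp
    \<comment> \<open>As w y = -\<mu>, nonnegativity of h at y says exactly that \<psi>(y) \<ge> 1,
      which keeps y away from the zero set of \<psi>.\<close>
    then have "\<mu> * 1 \<le> \<mu> * \<psi> y" by (simp add: hw \<mu>_def)
    then have "1 \<le> \<psi> y" using \<mu> by simp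
    also have "\<psi> y = A * ((r - norm (y - x)) * (r + norm (y - x)))"
      by (simp add: \<psi>_def power2_eq_square algebra_simps)
    also have "\<dots> \<le> A * ((r - norm (y - x)) * (2 * b))" using yr r A by (intro mult_left_mono) auto
    finally have "1 \<le> (r - norm (y - x)) * (2 * A * b)" by (simp add: mult_ac)
    then have "1 / (2 * A * b) \<le> r - norm (y - x)" using A b by (simp add: pos_divide_le_eq)
    then show ?thesis by (simp add: l0_def)
  qed
  then show ?thesis using l0 by blast
qed

section \<open>Choice of the two thresholds\<close>

theorem theorem2p3:
  fixes u :: "'a::euclidean_space \<Rightarrow> real" and x :: 'a
    and \<alpha> c1 c2 p1 p2 :: real
  assumes "DIM('a) \<ge> 2"
    and "0 < \<alpha>" and "\<alpha> \<le> 2"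
    and "real DIM('a) > 2 * \<alpha>"
    and "c1 \<ge> 0" and "c2 \<ge> 0" and "c1 + c2 > 0"
    and "0 < p1" and "p1 \<le> 1"
    and "0 < p2" and "p2 \<le> (real DIM('a) + \<alpha>) / (real DIM('a) - \<alpha>)"
    and "positive_classical_solution \<alpha> c1 c2 p1 p2 u"
  shows "(\<exists>\<delta>0>0. \<forall>r l \<Omega>. 0 < r \<and> r \<le> \<delta>0 \<and> 0 < l \<and> l < r \<and>
            narrow_region_hyps \<alpha> c1 c2 p1 p2 u x r l \<Omega> \<longrightarrow>
            (\<forall>y\<in>\<Omega>. omega \<alpha> u x r y \<ge> 0))
       \<and> (\<exists>l0 :: real \<Rightarrow> real. continuous_on {0<..} l0 \<and> (\<forall>r>0. l0 r > 0) \<and>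
            (\<forall>r l \<Omega>. 0 < r \<and> 0 < l \<and> l < r \<and> l \<le> l0 r \<and>
              narrow_region_hyps \<alpha> c1 c2 p1 p2 u x r l \<Omega> \<longrightarrow>
              (\<forall>y\<in>\<Omega>. omega \<alpha> u x r y \<ge> 0)))"
proof -
  note n = assms(1) and \<alpha> = assms(2-4) and c = assms(5-7) and p = assms(8-11)
  have \<alpha>n: "\<alpha> < real DIM('a)" using \<alpha> by linarith
  have pos: "u y > 0"
    and reg: "if \<alpha> < 2 then C11_loc_on UNIV u \<and> u \<in> L_space \<alpha> else C2_on UNIV u"
    and int: "c1 \<noteq> 0 \<Longrightarrow> integrable lborel (\<lambda>z. (u z)\<^sup>2 / norm (y - z) powr (2 * \<alpha>))"
    and eq: "frac_lap \<alpha> u y = c1 * P \<alpha> u y * u y powr p1 + c2 * u y powr p2" for y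
    using assms(12) unfolding positive_classical_solution_def by blast+
  \<comment> \<open>The classical comparison needs strict positivity. If c2 = 0 then c1 > 0, and it
    comes from the nonlocal term.\<close>
  have eq_pos: "c1 * P \<alpha> u y * u y powr p1 + c2 * u y powr p2 > 0" for y
  proof (cases "c2 > 0")
    case True
    have "0 \<le> c1 * P \<alpha> u y * u y powr p1" using c P_nonneg[of \<alpha> u y] by simp
    moreover have "0 < c2 * u y powr p2" using True pos[of y] by simp
    ultimately show ?thesis by linarith
  next
    case False
    then have c1: "c1 > 0" "c2 = 0" using c by auto
    then have "P \<alpha> u y > 0" using P_pos[OF int pos] by simp
    then show ?thesis using c1 pos[of y] by simp
  qed
  have "\<exists>u' :: 'a \<Rightarrow> 'a \<Rightarrow>\<^sub>L real. (\<forall>y. (u has_derivative blinfun_apply (u' y)) (at y)) \<and> continuous_on UNIV u'"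
    using reg C11_continuous C2_continuous by (auto split: if_splits)
  then obtain u' :: "'a \<Rightarrow> 'a \<Rightarrow>\<^sub>L real"
    where u': "\<And>y. (u has_derivative blinfun_apply (u' y)) (at y)" "continuous_on UNIV u'" by blast
  have uc: "continuous_on UNIV u"
    using u'(1) by (intro continuous_at_imp_continuous_on ballI has_derivative_continuous)
  have lap: "- laplacian u y = c1 * P 2 u y * u y powr p1 + c2 * u y powr p2" if "\<alpha> = 2" for y
    using eq[of y] that by (simp add: frac_lap_def)
  have "\<exists>c>0. \<forall>z. 1 \<le> norm (z - x) \<longrightarrow> c * norm (z - x) powr (\<alpha> - real DIM('a)) \<le> u z"
  proof (cases "\<alpha> < 2")
    case True
    then have "u \<in> L_space \<alpha>" "C11_loc_on UNIV u" using reg by simp_all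
    moreover have "frac_lap \<alpha> u y \<ge> 0" for y using eq[of y] eq_pos[of y] by simp
    ultimately show ?thesis
      using n \<alpha>(1) True \<alpha>n pos by (intro frac_superharmonic_lower_bound)
  next
    case False
    then have \<alpha>2: "\<alpha> = 2" using \<alpha> by simp
    have "laplacian u y < 0" for y using lap[OF \<alpha>2, of y] eq_pos[of y] \<alpha>2 by simp
    moreover have "DIM('a) > 2" using \<alpha>n \<alpha>2 by simp
    moreover have "C2_on UNIV u" using reg \<alpha>2 by simp
    ultimately show ?thesis
      using pos unfolding \<alpha>2 by (intro laplacian_superharmonic_lower_bound)
  qed
  then obtain c where c0: "c > 0" "\<And>z. 1 \<le> norm (z - x) \<Longrightarrow> c * norm (z - x) powr (\<alpha> - real DIM('a)) \<le> u z"
    by blast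
  obtain \<delta> where \<delta>: "\<delta> > 0" "\<And>r y. 0 < r \<Longrightarrow> r \<le> \<delta> \<Longrightarrow> y \<in> ball x r - {x} \<Longrightarrow> omega \<alpha> u x r y \<ge> 0"
    using small_sphere_nonneg[where u = u and x = x, OF \<alpha>n pos u' c0] by blast
  have "\<exists>\<delta>0>0. \<forall>r l \<Omega>. 0 < r \<and> r \<le> \<delta>0 \<and> 0 < l \<and> l < r \<and>
            narrow_region_hyps \<alpha> c1 c2 p1 p2 u x r l \<Omega> \<longrightarrow> (\<forall>y\<in>\<Omega>. omega \<alpha> u x r y \<ge> 0)"
    using \<delta> unfolding narrow_region_hyps_def by (intro exI[of _ \<delta>]) blast
  moreover
  \<comment> \<open>All \<Omega> and all thicknesses up to \<open>l0\<close> are quantified inside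
    \<open>Q\<close>, which makes the threshold independent of \<Omega>; \<open>Q r\<close> is
    downward closed in \<open>l0\<close>, as \<open>continuous_threshold\<close> demands.\<close>
  define Q where "Q = (\<lambda>r l0. \<forall>l \<Omega>. 0 < l \<and> l < r \<and> l \<le> l0 \<and>
              narrow_region_hyps \<alpha> c1 c2 p1 p2 u x r l \<Omega> \<longrightarrow> (\<forall>y\<in>\<Omega>. omega \<alpha> u x r y \<ge> 0))"
  have "\<exists>l0. continuous_on {0<..} l0 \<and> (\<forall>r>0. l0 r > 0 \<and> Q r (l0 r))"
  proof (rule continuous_threshold)
    show "Q s l'" if "Q s l" "l' \<le> l" for s l l'
      using that unfolding Q_def by (meson order_trans)
    fix a b :: real
    assume ab: "0 < a" "a \<le> b"
    have "\<exists>l0>0. \<forall>r l \<Omega> y. a \<le> r \<and> r \<le> b \<and> narrow_region_hyps \<alpha> c1 c2 p1 p2 u x r l \<Omega> \<and>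
        negative_minimum_at \<alpha> u x r y \<and> y \<in> \<Omega> \<longrightarrow> l0 \<le> r - norm (y - x)"
    proof (cases "\<alpha> < 2")
      case True
      obtain l0 where l0: "l0 > 0" "\<forall>r y S. a \<le> r \<and> r \<le> b \<and> negative_minimum_at \<alpha> u x r y \<and> y \<in> S \<and>
          omega \<alpha> u x r \<in> L_space \<alpha> \<and> C11_loc_on S (omega \<alpha> u x r) \<and>
          frac_lap \<alpha> (omega \<alpha> u x r) y - L_coeff \<alpha> c1 c2 p1 p2 u x r y * omega \<alpha> u x r y
            - 2 * c1 * (LINT z:B_minus \<alpha> u x r|lborel. u z * omega \<alpha> u x r z / norm (y - z) powr (2 * \<alpha>)) * u y powr p1 \<ge> 0
          \<longrightarrow> l0 \<le> r - norm (y - x)"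
        using narrow_region_frac[where u = u and x = x, OF n \<alpha>(1) True \<alpha>(3) c(1,2) p(1,3) uc pos int ab] by blast
      have "l0 \<le> r - norm (y - x)" if r: "a \<le> r" "r \<le> b" and h: "narrow_region_hyps \<alpha> c1 c2 p1 p2 u x r l \<Omega>"
        and y: "negative_minimum_at \<alpha> u x r y" "y \<in> \<Omega>" for r l \<Omega> y
      proof -
        have "y \<in> \<Omega> \<inter> B_minus \<alpha> u x r" using y by (simp add: negative_minimum_at_def B_minus_def)
        then have "frac_lap \<alpha> (omega \<alpha> u x r) y - L_coeff \<alpha> c1 c2 p1 p2 u x r y * omega \<alpha> u x r y
            - 2 * c1 * (LINT z:B_minus \<alpha> u x r|lborel. u z * omega \<alpha> u x r z / norm (y - z) powr (2 * \<alpha>)) * u y powr p1 \<ge> 0"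
          using h unfolding narrow_region_hyps_def by blast
        moreover have "omega \<alpha> u x r \<in> L_space \<alpha>" "C11_loc_on \<Omega> (omega \<alpha> u x r)"
          using h True unfolding narrow_region_hyps_def by simp_all
        ultimately show ?thesis using l0(2) r y by blast
      qed
      then show ?thesis using l0(1) by blast
    next
      case False
      then have \<alpha>2: "\<alpha> = 2" using \<alpha> by simp
      have "DIM('a) > 4" using \<alpha> \<alpha>2 by simp
      moreover have "C2_on UNIV u" using reg \<alpha>2 by simp
      ultimately obtain l0 where "l0 > 0" "\<forall>r y. a \<le> r \<and> r \<le> b \<and> negative_minimum_at 2 u x r y \<longrightarrow> l0 \<le> r - norm (y - x)"
        using narrow_region_laplacian[where u = u and x = x, OF _ c(1,2) p(1,2,3) p(4)[unfolded \<alpha>2] _ pos int[unfolded \<alpha>2] lap[OF \<alpha>2] ab] by blast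
      then show ?thesis unfolding \<alpha>2 by blast
    qed
    then obtain l0 where l0: "l0 > 0" "\<And>r l \<Omega> y. a \<le> r \<Longrightarrow> r \<le> b \<Longrightarrow> narrow_region_hyps \<alpha> c1 c2 p1 p2 u x r l \<Omega> \<Longrightarrow>
        negative_minimum_at \<alpha> u x r y \<Longrightarrow> y \<in> \<Omega> \<Longrightarrow> l0 \<le> r - norm (y - x)"
      by blast
    have "Q r l0" if r: "a \<le> r" "r \<le> b" for r
      unfolding Q_def
    proof (intro allI impI ballI)
      fix l \<Omega> y
      assume h: "0 < l \<and> l < r \<and> l \<le> l0 \<and> narrow_region_hyps \<alpha> c1 c2 p1 p2 u x r l \<Omega>" and y: "y \<in> \<Omega>"
      then have hyps: "narrow_region_hyps \<alpha> c1 c2 p1 p2 u x r l \<Omega>" by blast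
      have sub: "\<Omega> \<subseteq> (ball x r - {x}) \<inter> annulus x r l" using hyps unfolding narrow_region_hyps_def by blast
      show "0 \<le> omega \<alpha> u x r y"
      proof (rule ccontr)
        assume "\<not> 0 \<le> omega \<alpha> u x r y"
        then have "y \<in> B_minus \<alpha> u x r" using y sub by (auto simp: B_minus_def)
        then obtain y0 where y0: "negative_minimum_at \<alpha> u x r y0"
          using hyps unfolding narrow_region_hyps_def by blast
        then have "y0 \<in> ball x r - {x}" by (simp add: negative_minimum_at_def)
        \<comment> \<open>Hypothesis (c) puts the minimum supplied by (b) into \<Omega>. Membership
          in \<open>annulus x r l\<close> then gives r - |y0 - x| < l \<le> l0, against the lower
          bound l0.\<close>
        then have "y0 \<in> \<Omega>" using y0 hyps unfolding narrow_region_hyps_def by blast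
        then have "l0 \<le> r - norm (y0 - x)" "y0 \<in> annulus x r l" using l0(2) r hyps y0 sub by blast+
        then show False using h by (simp add: annulus_def)
      qed
    qed
    then show "\<exists>l0>0. \<forall>s. a \<le> s \<and> s \<le> b \<longrightarrow> Q s l0" using l0(1) by blast
  qed
  then have "\<exists>l0 :: real \<Rightarrow> real. continuous_on {0<..} l0 \<and> (\<forall>r>0. l0 r > 0) \<and>
            (\<forall>r l \<Omega>. 0 < r \<and> 0 < l \<and> l < r \<and> l \<le> l0 r \<and>
              narrow_region_hyps \<alpha> c1 c2 p1 p2 u x r l \<Omega> \<longrightarrow> (\<forall>y\<in>\<Omega>. omega \<alpha> u x r y \<ge> 0))"
    unfolding Q_def by blast
  ultimately show ?thesis by (rule conjI)
qed

end
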